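(* Let $\mathbb{F}=\mathbb{R}$ or $\mathbb{F}=\mathbb{C}$, and let $A$, $\Lambda$, $\Psi$ be as in the context. For every signal $0\neq f\in L^2(A)$, one has $$\mathfrak{C}_{W_\Psi f}\ \leq\ \mathfrak{C}_{G(f)},$$ where $\mathfrak{C}_{W_\Psi f}$ is the kernel Cheeger constant of $W_\Psi f\in\mathcal{H}_\Psi$ and $\mathfrak{C}_{G(f)}$ is the Cheeger constant of the weighted graph $G(f)$. In particular, if $f$ is phase retrievable, then $$C(f)\ \geq\ \sqrt{\mathfrak{C}_{G(f)}^{-1}-1}.$$
   Context: Let $\mathbb{F}\in\{\mathbb{R},\mathbb{C}\}$, $\mathbb{T}=\{z\in\mathbb{F}:|z|=1\}$, $a\wedge b=\min\{a,b\}$, and $0^{-1}=\infty$. Let $A$ be a second-countable locally compact abelian Hausdorff group with dual $\widehat A$, with Haar measures normalized so that Plancherel's theorem holds; $L^2(A)$ consists of $\mathbb{F}$-valued functions. Write $g^*(x)=\overline{g(-x)}$, and let $*$ denote convolution. Let $\Lambda$ be a countable discrete set with counting measure and $\Psi=(\psi_\lambda)_{\lambda\in\Lambda}\subset L^2(A)$ a family satisfying the Calderón condition $\sum_{\lambda\in\Lambda}|\widehat\psi_\lambda(\xi)|^2=1$ for a.e. $\xi\in\widehat A$. The generalized wavelet transform is $W_\Psi f(x,\lambda)=(f*\psi_\lambda^* )(x)$; under the Calderón condition it is an isometry $L^2(A)\to L^2(A\times\Lambda)$. Its image $\mathcal{H}_\Psi=W_\Psi(L^2(A))$ is a reproducing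 kernel Hilbert space with orthogonal projection $K_\Psi=W_\Psi W_\Psi^*$ from $L^2(A\times\Lambda)$ onto $\mathcal{H}_\Psi$. For measurable $S\subset A\times\Lambda$ let $P_SH=H\cdot\mathbf{1}_S$, $S^c=(A\times\Lambda)\setminus S$, $[K_\Psi,P_S]=K_\Psi P_S-P_SK_\Psi$. The kernel Cheeger constant of $0\ne F\in\mathcal{H}_\Psi$ is $$\mathfrak{C}_F=\inf\left\{\frac{\|[K_\Psi,P_S]F\|_2^2}{\|P_SF\|_2^2\wedge\|P_{S^c}F\|_2^2}\ :\ S\subset A\times\Lambda\text{ measurable},\ \|P_SF\|_2>0,\ \|P_{S^c}F\|_2>0\right\}$$ if at least one such $S$ exists, and $\mathfrak{C}_F=1$ otherwise. For $0\ne f\in L^2(A)$ the weighted graph $G(f)=(V,E,w)$ has $V=\{\lambda\in\Lambda:\|f*\psi_\lambda\|_2>0\}$, $E=\{(\lambda,\lambda')\in V\times V:\|f*\psi_\lambda*\psi_{\lambda'}\|_2>0\}$, vertex weights $w_\lambda=\|f*\psi_\lambda\|_2^2$ and edge weights $w_{\lambda,\lambda'}=\|f*\psi_\lambda*\psi_{\lambda'}\|_2^2$. For $S\subset V$ put (here) $S^c=V\setminus S$ and $\partial S=\{(\lambda,\lambda')\in E:\lambda\in S,\ \lambda'\in S^c\}$. If $\#V>1$, the graph Cheeger constant is $$\mathfrak{C}_{G(f)}=\inf_{\emptyset\ne S\subsetneq V}\frac{\sum_{(\lambda,\lambda')\in\partial S}w_{\lambda,\lambda'}}{\left(\sum_{\lambda\in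 S}w_\lambda\right)\wedge\left(\sum_{\lambda\in S^c}w_\lambda\right)},$$ and $\mathfrak{C}_{G(f)}=1$ if $\#V=1$. One has $\mathfrak{C}_{G(f)}\in[0,1]$. The signal $f$ is phase retrievable if $g\in L^2(A)$ and $|W_\Psi f|=|W_\Psi g|$ imply $f=\alpha g$ for some $\alpha\in\mathbb{T}$. The local stability constant $C(f)\in[1,\infty]$ is the smallest $C>0$ such that $\inf_{\alpha\in\mathbb{T}}\|f-\alpha g\|_{L^2(A)}\le C\,\||W_\Psi f|-|W_\Psi g|\|_{L^2(A\times\Lambda)}$ for all $g\in L^2(A)$ ($C(f)=\infty$ if no finite constant works). *)

theory Defs
  imports "HOL-Analysis.Analysis"
begin

section \<open>Haar measures and the dual group\<close>

text \<open>
  Abelian topological groups are given by a topology \<open>X\<close> on the carrier \<open>topspace X\<close> and an operation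
  \<open>mul\<close>, so that one definition serves both a type-class group and its dual, whose
  carrier is a set of functions.  No regularity clause is needed: every group below is
  second countable and locally compact, where Borel measures that are finite on compact sets are
  automatically regular.
\<close>

definition haar_measure :: "'g topology \<Rightarrow> ('g \<Rightarrow> 'g \<Rightarrow> 'g) \<Rightarrow> 'g measure \<Rightarrow> bool" where
  "haar_measure X mul \<mu> \<longleftrightarrow>
     space \<mu> = topspace X \<and>
     sets \<mu> = sigma_sets (topspace X) {U. openin X U} \<and>
     (\<forall>a\<in>topspace X. \<forall>B\<in>sets \<mu>. emeasure \<mu> (mul a ` B) = emeasure \<mu> B) \<and>
     (\<forall>K\<in>sets \<mu>. compactin X K \<longrightarrow> emeasure \<mu> K < \<infinity>) \<and>
     (\<forall>U. openin X U \<and> U \<noteq> {} \<longrightarrow> 0 < emeasure \<mu> U)"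

definition characters :: "('a::topological_ab_group_add \<Rightarrow> complex) set" where
  "characters = {\<xi>. continuous_on UNIV \<xi> \<and> (\<forall>x. norm (\<xi> x) = 1) \<and>
                    (\<forall>x y. \<xi> (x + y) = \<xi> x * \<xi> y)}"

text \<open>The compact-open topology.\<close>

definition dual_topology :: "('a::topological_ab_group_add \<Rightarrow> complex) topology" where
  "dual_topology = topology_generated_by
     {{\<xi> \<in> characters. \<xi> ` K \<subseteq> U} | K U. compact K \<and> open U}"

definition dual_mult :: "('a \<Rightarrow> complex) \<Rightarrow> ('a \<Rightarrow> complex) \<Rightarrow> ('a \<Rightarrow> complex)" where
  "dual_mult \<xi> \<eta> = (\<lambda>x. \<xi> x * \<eta> x)"


section \<open>Square-integrable functions\<close>

text \<open>
  The scalar field is a subset \<open>F\<close> of the complex numbers, either \<open>\<real>\<close> or \<open>UNIV\<close>.  Elements of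
  \<open>L\<^sup>2\<close> are represented by functions; equality in \<open>L\<^sup>2\<close> is equality almost everywhere.
  Norms are extended nonnegative reals, so that an infinite norm is not silently turned into \<open>0\<close>.
\<close>

definition L2_norm_sq :: "'b measure \<Rightarrow> ('b \<Rightarrow> 'c::real_normed_vector) \<Rightarrow> ennreal" where
  "L2_norm_sq M f = (\<integral>\<^sup>+ x. ennreal ((norm (f x))\<^sup>2) \<partial>M)"

definition ennreal_sqrt :: "ennreal \<Rightarrow> ennreal" where
  "ennreal_sqrt x = (if x = \<infinity> then \<infinity> else ennreal (sqrt (enn2real x)))"

definition L2_norm :: "'b measure \<Rightarrow> ('b \<Rightarrow> 'c::real_normed_vector) \<Rightarrow> ennreal" where
  "L2_norm M f = ennreal_sqrt (L2_norm_sq M f)"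

definition L2_space :: "complex set \<Rightarrow> 'b measure \<Rightarrow> ('b \<Rightarrow> complex) set" where
  "L2_space F M = {f \<in> borel_measurable M. (\<forall>x\<in>space M. f x \<in> F) \<and> L2_norm_sq M f < \<infinity>}"

definition L2_inner :: "'b measure \<Rightarrow> ('b \<Rightarrow> complex) \<Rightarrow> ('b \<Rightarrow> complex) \<Rightarrow> complex" where
  "L2_inner M f g = (LINT x|M. f x * cnj (g x))"

definition unit_scalars :: "complex set \<Rightarrow> complex set" where
  "unit_scalars F = {z \<in> F. norm z = 1}"


section \<open>Fourier transform\<close>

definition fourier_L1 ::
  "'a measure \<Rightarrow> ('a \<Rightarrow> complex) \<Rightarrow> ('a \<Rightarrow> complex) \<Rightarrow> complex" where
  "fourier_L1 \<mu> f \<xi> = (LINT x|\<mu>. f x * cnj (\<xi> x))"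

text \<open>
  The Haar measures are normalized so that Plancherel's theorem holds; this determines the Haar
  measure \<open>\<nu>\<close> of the dual group in terms of \<open>\<mu>\<close>.
\<close>

definition plancherel_normalized :: "'a measure \<Rightarrow> ('a \<Rightarrow> complex) measure \<Rightarrow> bool" where
  "plancherel_normalized \<mu> \<nu> \<longleftrightarrow>
     (\<forall>f \<in> L2_space UNIV \<mu>. integrable \<mu> f \<longrightarrow> L2_norm_sq \<nu> (fourier_L1 \<mu> f) = L2_norm_sq \<mu> f)"

text \<open>
  The Fourier transform on \<open>L\<^sup>2\<close> is the continuous extension of the one on \<open>L\<^sup>1 \<inter> L\<^sup>2\<close>; it is
  determined up to \<open>\<nu>\<close>-null sets, and a representative is chosen.
\<close>

definition is_fourier_L2 ::
  "'a measure \<Rightarrow> ('a \<Rightarrow> complex) measure \<Rightarrow> ('a \<Rightarrow> complex) \<Rightarrow> (('a \<Rightarrow> complex) \<Rightarrow> complex) \<Rightarrow> bool" where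
  "is_fourier_L2 \<mu> \<nu> f g \<longleftrightarrow> g \<in> L2_space UNIV \<nu> \<and>
     (\<exists>h :: nat \<Rightarrow> 'a \<Rightarrow> complex.
        (\<forall>n. h n \<in> L2_space UNIV \<mu> \<and> integrable \<mu> (h n)) \<and>
        (\<lambda>n. L2_norm \<mu> (\<lambda>x. h n x - f x)) \<longlonglongrightarrow> 0 \<and>
        (\<lambda>n. L2_norm \<nu> (\<lambda>\<xi>. fourier_L1 \<mu> (h n) \<xi> - g \<xi>)) \<longlonglongrightarrow> 0)"

definition fourier_L2 ::
  "'a measure \<Rightarrow> ('a \<Rightarrow> complex) measure \<Rightarrow> ('a \<Rightarrow> complex) \<Rightarrow> ('a \<Rightarrow> complex) \<Rightarrow> complex" where
  "fourier_L2 \<mu> \<nu> f = (SOME g. is_fourier_L2 \<mu> \<nu> f g)"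

definition calderon_condition ::
  "'a measure \<Rightarrow> ('a \<Rightarrow> complex) measure \<Rightarrow> 'l set \<Rightarrow> ('l \<Rightarrow> 'a \<Rightarrow> complex) \<Rightarrow> bool" where
  "calderon_condition \<mu> \<nu> \<Lambda> \<psi> \<longleftrightarrow>
     (AE \<xi> in \<nu>. ((\<lambda>l. (norm (fourier_L2 \<mu> \<nu> (\<psi> l) \<xi>))\<^sup>2) has_sum 1) \<Lambda>)"


section \<open>The generalized wavelet transform\<close>

text \<open>For \<open>f\<close>, \<open>g\<close> in \<open>L\<^sup>2\<close> the convolution integral converges absolutely at every point.\<close>

definition conv ::
  "'a::ab_group_add measure \<Rightarrow> ('a \<Rightarrow> complex) \<Rightarrow> ('a \<Rightarrow> complex) \<Rightarrow> 'a \<Rightarrow> complex" where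
  "conv \<mu> f g x = (LINT y|\<mu>. f y * g (x - y))"

definition involution :: "('a::ab_group_add \<Rightarrow> complex) \<Rightarrow> 'a \<Rightarrow> complex" where
  "involution g x = cnj (g (- x))"

definition wavelet_transform ::
  "'a::ab_group_add measure \<Rightarrow> ('l \<Rightarrow> 'a \<Rightarrow> complex) \<Rightarrow> ('a \<Rightarrow> complex) \<Rightarrow> 'a \<times> 'l \<Rightarrow> complex" where
  "wavelet_transform \<mu> \<psi> f = (\<lambda>(x, l). conv \<mu> f (involution (\<psi> l)) x)"

definition phase_space :: "'a measure \<Rightarrow> 'l set \<Rightarrow> ('a \<times> 'l) measure" where
  "phase_space \<mu> \<Lambda> = \<mu> \<Otimes>\<^sub>M count_space \<Lambda>"

text \<open>The Hilbert space adjoint; its value is unique up to null sets.\<close>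

definition wavelet_adjoint ::
  "complex set \<Rightarrow> 'a::ab_group_add measure \<Rightarrow> 'l set \<Rightarrow> ('l \<Rightarrow> 'a \<Rightarrow> complex) \<Rightarrow>
   ('a \<times> 'l \<Rightarrow> complex) \<Rightarrow> 'a \<Rightarrow> complex" where
  "wavelet_adjoint F \<mu> \<Lambda> \<psi> H = (SOME f. f \<in> L2_space F \<mu> \<and>
     (\<forall>g \<in> L2_space F \<mu>.
        L2_inner \<mu> f g = L2_inner (phase_space \<mu> \<Lambda>) H (wavelet_transform \<mu> \<psi> g)))"

definition kernel_projection ::
  "complex set \<Rightarrow> 'a::ab_group_add measure \<Rightarrow> 'l set \<Rightarrow> ('l \<Rightarrow> 'a \<Rightarrow> complex) \<Rightarrow>
   ('a \<times> 'l \<Rightarrow> complex) \<Rightarrow> 'a \<times> 'l \<Rightarrow> complex" where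
  "kernel_projection F \<mu> \<Lambda> \<psi> H = wavelet_transform \<mu> \<psi> (wavelet_adjoint F \<mu> \<Lambda> \<psi> H)"


section \<open>Kernel Cheeger constant\<close>

definition restrict_to :: "'b set \<Rightarrow> ('b \<Rightarrow> complex) \<Rightarrow> 'b \<Rightarrow> complex" where
  "restrict_to S H = (\<lambda>p. H p * indicator S p)"

definition kernel_commutator ::
  "complex set \<Rightarrow> 'a::ab_group_add measure \<Rightarrow> 'l set \<Rightarrow> ('l \<Rightarrow> 'a \<Rightarrow> complex) \<Rightarrow> ('a \<times> 'l) set \<Rightarrow>
   ('a \<times> 'l \<Rightarrow> complex) \<Rightarrow> 'a \<times> 'l \<Rightarrow> complex" where
  "kernel_commutator F \<mu> \<Lambda> \<psi> S H = (\<lambda>p.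
     kernel_projection F \<mu> \<Lambda> \<psi> (restrict_to S H) p -
     restrict_to S (kernel_projection F \<mu> \<Lambda> \<psi> H) p)"

definition kernel_cheeger ::
  "complex set \<Rightarrow> 'a::ab_group_add measure \<Rightarrow> 'l set \<Rightarrow> ('l \<Rightarrow> 'a \<Rightarrow> complex) \<Rightarrow>
   ('a \<times> 'l \<Rightarrow> complex) \<Rightarrow> ennreal" where
  "kernel_cheeger F \<mu> \<Lambda> \<psi> H = (
     let M = phase_space \<mu> \<Lambda>;
         \<S> = {S \<in> sets M. 0 < L2_norm M (restrict_to S H) \<and>
                           0 < L2_norm M (restrict_to (space M - S) H)}
     in if \<S> = {} then 1
        else INF S\<in>\<S>. L2_norm_sq M (kernel_commutator F \<mu> \<Lambda> \<psi> S H) /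
               min (L2_norm_sq M (restrict_to S H)) (L2_norm_sq M (restrict_to (space M - S) H)))"


section \<open>Graph Cheeger constant\<close>

definition graph_vertices ::
  "'a::ab_group_add measure \<Rightarrow> 'l set \<Rightarrow> ('l \<Rightarrow> 'a \<Rightarrow> complex) \<Rightarrow> ('a \<Rightarrow> complex) \<Rightarrow> 'l set" where
  "graph_vertices \<mu> \<Lambda> \<psi> f = {l \<in> \<Lambda>. 0 < L2_norm \<mu> (conv \<mu> f (\<psi> l))}"

definition graph_edges ::
  "'a::ab_group_add measure \<Rightarrow> 'l set \<Rightarrow> ('l \<Rightarrow> 'a \<Rightarrow> complex) \<Rightarrow> ('a \<Rightarrow> complex) \<Rightarrow> ('l \<times> 'l) set" where
  "graph_edges \<mu> \<Lambda> \<psi> f = {(l, l') \<in> graph_vertices \<mu> \<Lambda> \<psi> f \<times> graph_vertices \<mu> \<Lambda> \<psi> f.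
     0 < L2_norm \<mu> (conv \<mu> (conv \<mu> f (\<psi> l)) (\<psi> l'))}"

definition vertex_weight ::
  "'a::ab_group_add measure \<Rightarrow> ('l \<Rightarrow> 'a \<Rightarrow> complex) \<Rightarrow> ('a \<Rightarrow> complex) \<Rightarrow> 'l \<Rightarrow> ennreal" where
  "vertex_weight \<mu> \<psi> f l = L2_norm_sq \<mu> (conv \<mu> f (\<psi> l))"

definition edge_weight ::
  "'a::ab_group_add measure \<Rightarrow> ('l \<Rightarrow> 'a \<Rightarrow> complex) \<Rightarrow> ('a \<Rightarrow> complex) \<Rightarrow> 'l \<times> 'l \<Rightarrow> ennreal" where
  "edge_weight \<mu> \<psi> f = (\<lambda>(l, l'). L2_norm_sq \<mu> (conv \<mu> (conv \<mu> f (\<psi> l)) (\<psi> l')))"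

definition edge_boundary ::
  "'a::ab_group_add measure \<Rightarrow> 'l set \<Rightarrow> ('l \<Rightarrow> 'a \<Rightarrow> complex) \<Rightarrow> ('a \<Rightarrow> complex) \<Rightarrow> 'l set \<Rightarrow>
   ('l \<times> 'l) set" where
  "edge_boundary \<mu> \<Lambda> \<psi> f S =
     {(l, l') \<in> graph_edges \<mu> \<Lambda> \<psi> f. l \<in> S \<and> l' \<in> graph_vertices \<mu> \<Lambda> \<psi> f - S}"

text \<open>
  The vertex set may be infinite (where \<open>card\<close> is \<open>0\<close>), hence \<open>is_singleton\<close>; it is never
  empty when \<open>f\<close> is nonzero and the Calderon condition holds.
\<close>

definition graph_cheeger ::
  "'a::ab_group_add measure \<Rightarrow> 'l set \<Rightarrow> ('l \<Rightarrow> 'a \<Rightarrow> complex) \<Rightarrow> ('a \<Rightarrow> complex) \<Rightarrow> ennreal" where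
  "graph_cheeger \<mu> \<Lambda> \<psi> f = (
     let V = graph_vertices \<mu> \<Lambda> \<psi> f
     in if is_singleton V then 1
        else INF S\<in>{S. S \<noteq> {} \<and> S \<subset> V}.
               (\<Sum>\<^sub>\<infinity>e\<in>edge_boundary \<mu> \<Lambda> \<psi> f S. edge_weight \<mu> \<psi> f e) /
               min (\<Sum>\<^sub>\<infinity>l\<in>S. vertex_weight \<mu> \<psi> f l) (\<Sum>\<^sub>\<infinity>l\<in>V - S. vertex_weight \<mu> \<psi> f l))"


section \<open>Phase retrieval and its stability\<close>

definition phase_retrievable ::
  "complex set \<Rightarrow> 'a::ab_group_add measure \<Rightarrow> 'l set \<Rightarrow> ('l \<Rightarrow> 'a \<Rightarrow> complex) \<Rightarrow> ('a \<Rightarrow> complex) \<Rightarrow>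
   bool" where
  "phase_retrievable F \<mu> \<Lambda> \<psi> f \<longleftrightarrow>
     (\<forall>g \<in> L2_space F \<mu>.
        (AE p in phase_space \<mu> \<Lambda>.
           norm (wavelet_transform \<mu> \<psi> f p) = norm (wavelet_transform \<mu> \<psi> g p)) \<longrightarrow>
        (\<exists>\<alpha> \<in> unit_scalars F. AE x in \<mu>. f x = \<alpha> * g x))"

text \<open>The infimum of the empty set of \<open>ennreal\<close> is \<open>\<infinity>\<close>, as required.\<close>

definition local_stability_constant ::
  "complex set \<Rightarrow> 'a::ab_group_add measure \<Rightarrow> 'l set \<Rightarrow> ('l \<Rightarrow> 'a \<Rightarrow> complex) \<Rightarrow> ('a \<Rightarrow> complex) \<Rightarrow>
   ennreal" where
  "local_stability_constant F \<mu> \<Lambda> \<psi> f = Inf {ennreal C | C :: real. 0 < C \<and>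
     (\<forall>g \<in> L2_space F \<mu>.
        (INF \<alpha>\<in>unit_scalars F. L2_norm \<mu> (\<lambda>x. f x - \<alpha> * g x)) \<le>
        ennreal C * L2_norm (phase_space \<mu> \<Lambda>)
          (\<lambda>p. norm (wavelet_transform \<mu> \<psi> f p) - norm (wavelet_transform \<mu> \<psi> g p)))}"

end

theory Submission
  imports Defs
begin

text \<open>
  On the Fourier side everything is multiplication.  For a set \<open>T\<close> of vertices put
  \<open>m\<^sub>T = (\<Sum>l\<in>T. \<bar>psihat l\<bar>\<^sup>2)\<close>, which lies between 0 and 1 by the Calderon condition.  For \<open>S = A \<times> T\<close> the projection \<open>K P\<^sub>S W f\<close> is
  \<open>W f\<^sub>T\<close>, where \<open>f\<^sub>T\<close> has transform \<open>m\<^sub>T f'\<close> if \<open>f'\<close> is the transform of \<open>f\<close>, and Plancherel's theorem gives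
  \<open>\<parallel>[K, P\<^sub>S] W f\<parallel>\<^sup>2 = \<integral>m\<^sub>T (1 - m\<^sub>T) \<bar>f'\<bar>\<^sup>2\<close>.  This is exactly the weight of the edge boundary of \<open>T\<close>, and likewise
  the vertex weights of \<open>T\<close> and of its complement are \<open>\<integral>m\<^sub>T \<bar>f'\<bar>\<^sup>2\<close> and \<open>\<integral>(1 - m\<^sub>T) \<bar>f'\<bar>\<^sup>2\<close>, so every graph cut
  occurs among the kernel cuts with the same quotient.  The stability bound comes from testing with
  \<open>g = 2 f\<^sub>T - f\<close>: with \<open>b\<close> the boundary weight and \<open>w\<close> the smaller vertex weight,
  \<open>\<parallel>\<bar>W f\<bar> - \<bar>W g\<bar>\<parallel>\<^sup>2 \<le> 4 b\<close>, whereas \<open>\<parallel>f - \<alpha> g\<parallel>\<^sup>2 \<ge> 4 w - 4 b\<close> for every unit scalar \<open>\<alpha>\<close>.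
\<close>

section \<open>The Hilbert space of square-integrable functions\<close>

text \<open>The recurring obstacle is that the convolution of two square-integrable functions need
  not be square integrable. Each term of the Calderon sum is at most 1, so \<open>psihat l\<close>
  is bounded almost everywhere and convolution with \<open>\<psi> l\<close> does act on L2. A second
  difficulty is the scalar field: over the reals \<open>f_T\<close> has to be real valued. It is
  therefore obtained as a limit of finite sums of f * psi_l^* * psi_l, which take values in
  \<open>F\<close>, and the isometry carries convergence of the transforms back to the group. Only
  the moduli |psihat_l| enter the norms, so it does no harm that the graph is built with psi_l and
  the wavelet transform with psi_l^*. The stability constant arises from 4 w - 4 b <= C^2 * 4 b,
  that is b / w >= 1 / (1 + C^2), valid for every admissible \<open>C\<close> and every cut; taking
  the infimum over the cuts and inverting gives C^2 >= 1 / c - 1 with c the graph Cheeger constant.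
  A graph with one vertex has no cut and gets the value 1 by convention, so there the kernel
  quotients have to be bounded by 1 directly.\<close>

abbreviation L2 :: "'b measure \<Rightarrow> ('b \<Rightarrow> complex) set" where
  "L2 M \<equiv> L2_space UNIV M"

text \<open>A real-valued norm, so that limits and subtraction can be handled in the reals. It is
  meaningful only on \<open>L2\<close>, since \<open>enn2real\<close> sends an infinite value to
  0.\<close>

definition l2norm :: "'b measure \<Rightarrow> ('b \<Rightarrow> complex) \<Rightarrow> real" where
  "l2norm M f = sqrt (enn2real (L2_norm_sq M f))"

lemma L2_iff: "f \<in> L2 M \<longleftrightarrow> f \<in> borel_measurable M \<and> L2_norm_sq M f < \<infinity>"
  by (simp add: L2_space_def)

lemma L2_measurable: "f \<in> L2 M \<Longrightarrow> f \<in> borel_measurable M"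
  by (simp add: L2_iff)

lemma L2_space_subset: "f \<in> L2_space F M \<Longrightarrow> f \<in> L2 M"
  by (auto simp: L2_space_def)

lemma L2_spaceI: "f \<in> L2 M \<Longrightarrow> (\<And>x. x \<in> space M \<Longrightarrow> f x \<in> F) \<Longrightarrow> f \<in> L2_space F M"
  by (auto simp: L2_space_def)

lemma L2_spaceD: "f \<in> L2_space F M \<Longrightarrow> x \<in> space M \<Longrightarrow> f x \<in> F"
  by (auto simp: L2_space_def)

lemma L2_norm_sq_eq: "f \<in> L2 M \<Longrightarrow> L2_norm_sq M f = ennreal ((l2norm M f)\<^sup>2)"
  by (simp add: L2_iff l2norm_def)

lemma L2_norm_eq: "f \<in> L2 M \<Longrightarrow> L2_norm M f = ennreal (l2norm M f)"
  by (auto simp: L2_iff l2norm_def L2_norm_def ennreal_sqrt_def)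

lemma l2norm_nonneg [simp]: "0 \<le> l2norm M f"
  by (simp add: l2norm_def)

lemma L2_norm_sq_cong_AE:
  assumes "AE x in M. norm (f x) = norm (g x)"
  shows "L2_norm_sq M f = L2_norm_sq M g"
  unfolding L2_norm_sq_def by (rule nn_integral_cong_AE) (use assms in auto)

lemma L2_norm_sq_cong:
  assumes "\<And>x. x \<in> space M \<Longrightarrow> norm (f x) = norm (g x)"
  shows "L2_norm_sq M f = L2_norm_sq M g"
  by (rule L2_norm_sq_cong_AE) (use assms in auto)

lemma L2_norm_sq_mono_AE:
  assumes "AE x in M. norm (f x) \<le> norm (g x)"
  shows "L2_norm_sq M f \<le> L2_norm_sq M g"
  unfolding L2_norm_sq_def
  by (rule nn_integral_mono_AE) (use assms in \<open>auto intro!: ennreal_leI power_mono\<close>)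

lemma L2_norm_sq_eq_0_iff:
  assumes "f \<in> borel_measurable M"
  shows "L2_norm_sq M f = 0 \<longleftrightarrow> (AE x in M. f x = 0)"
  unfolding L2_norm_sq_def using assms by (subst nn_integral_0_iff_AE) auto

lemma L2_norm_sq_scale: "L2_norm_sq M (\<lambda>x. c * f x) = ennreal ((norm c)\<^sup>2) * L2_norm_sq M f"
  if [measurable]: "f \<in> borel_measurable M" for c :: complex
  unfolding L2_norm_sq_def
  by (subst nn_integral_cmult[symmetric]) (auto simp: norm_mult power_mult_distrib ennreal_mult)

text \<open>The crude constant 2 from (a + b)^2 <= 2 a^2 + 2 b^2 is enough for closure of
  \<open>L2\<close> under addition; the sharp triangle inequality follows later from
  Cauchy-Schwarz.\<close>

lemma L2_norm_sq_add_le: 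
  assumes [measurable]: "f \<in> borel_measurable M" "g \<in> borel_measurable M"
  shows "L2_norm_sq M (\<lambda>x. f x + g x :: complex) \<le> 2 * L2_norm_sq M f + 2 * L2_norm_sq M g"
proof -
  have "ennreal ((norm (f x + g x))\<^sup>2) \<le> 2 * ennreal ((norm (f x))\<^sup>2) + 2 * ennreal ((norm (g x))\<^sup>2)" for x
  proof -
    have "(norm (f x + g x))\<^sup>2 \<le> (norm (f x) + norm (g x))\<^sup>2"
      by (intro power_mono norm_triangle_ineq) auto
    also have "\<dots> \<le> 2 * (norm (f x))\<^sup>2 + 2 * (norm (g x))\<^sup>2"
      using sum_squares_bound[of "norm (f x)" "norm (g x)"] by (simp add: power2_sum)
    finally have "ennreal ((norm (f x + g x))\<^sup>2) \<le> ennreal (2 * (norm (f x))\<^sup>2 + 2 * (norm (g x))\<^sup>2)"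
      by (rule ennreal_leI)
    then show ?thesis by (simp add: ennreal_mult)
  qed
  then have "L2_norm_sq M (\<lambda>x. f x + g x) \<le> (\<integral>\<^sup>+x. 2 * ennreal ((norm (f x))\<^sup>2) + 2 * ennreal ((norm (g x))\<^sup>2) \<partial>M)"
    unfolding L2_norm_sq_def by (intro nn_integral_mono)
  then show ?thesis by (simp add: nn_integral_add nn_integral_cmult L2_norm_sq_def)
qed

lemma L2_add: "f \<in> L2 M \<Longrightarrow> g \<in> L2 M \<Longrightarrow> (\<lambda>x. f x + g x) \<in> L2 M"
  unfolding L2_iff by (auto simp: ennreal_mult_less_top intro!: le_less_trans[OF L2_norm_sq_add_le])

lemma L2_scale: "f \<in> L2 M \<Longrightarrow> (\<lambda>x. c * f x) \<in> L2 M"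
  unfolding L2_iff by (auto simp: L2_norm_sq_scale ennreal_mult_less_top)

lemma L2_diff: "f \<in> L2 M \<Longrightarrow> g \<in> L2 M \<Longrightarrow> (\<lambda>x. f x - g x) \<in> L2 M"
  using L2_add[of f M "\<lambda>x. (-1) * g x"] L2_scale[of g M "-1"] by simp

lemma L2_zero: "(\<lambda>x. 0) \<in> L2 M"
  by (simp add: L2_iff L2_norm_sq_def)

lemma L2_dominated:
  assumes "f \<in> L2 M" "g \<in> borel_measurable M" "AE x in M. norm (g x) \<le> norm (f x)"
  shows "g \<in> L2 M"
  using assms L2_norm_sq_mono_AE[OF assms(3)] by (auto simp: L2_iff)

lemma L2_mult_bounded:
  assumes f: "f \<in> L2 M" and [measurable]: "g \<in> borel_measurable M" and b: "AE x in M. norm (g x) \<le> B"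
  shows "(\<lambda>x. f x * g x) \<in> L2 M"
proof (rule L2_dominated)
  show "(\<lambda>x. of_real B * f x) \<in> L2 M" using f by (rule L2_scale)
  show "(\<lambda>x. f x * g x) \<in> borel_measurable M" using L2_measurable[OF f] by simp
  show "AE x in M. norm (f x * g x) \<le> norm (of_real B * f x)"
    using b
  proof eventually_elim
    case (elim x)
    have "norm (g x) * norm (f x) \<le> \<bar>B\<bar> * norm (f x)"
      using elim by (intro mult_right_mono) auto
    then show ?case by (simp add: norm_mult mult.commute)
  qed
qed

text \<open>Cauchy-Schwarz for the nonnegative integral, a form that yields both integrability of
  the product and the bound on its integral.\<close>

lemma nn_integral_mult_le:
  assumes f: "f \<in> L2 M" and g: "g \<in> L2 M"
  shows "(\<integral>\<^sup>+x. ennreal (norm (f x) * norm (g x)) \<partial>M) \<le> ennreal (l2norm M f * l2norm M g)"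
proof -
  have [measurable]: "f \<in> borel_measurable M" "g \<in> borel_measurable M"
    using f g by (auto simp: L2_iff)
  have "(\<integral>\<^sup>+x. ennreal (norm (f x)) * ennreal (norm (g x)) \<partial>M)\<^sup>2 \<le> L2_norm_sq M f * L2_norm_sq M g"
    using Cauchy_Schwarz_nn_integral[of "\<lambda>x. ennreal (norm (f x))" M "\<lambda>x. ennreal (norm (g x))"]
    by (simp add: L2_norm_sq_def ennreal_power)
  also have "\<dots> = (ennreal (l2norm M f * l2norm M g))\<^sup>2"
    using f g by (simp add: L2_norm_sq_eq ennreal_mult ennreal_power[symmetric] power_mult_distrib)
  finally have "(\<integral>\<^sup>+x. ennreal (norm (f x) * norm (g x)) \<partial>M)\<^sup>2 \<le> (ennreal (l2norm M f * l2norm M g))\<^sup>2"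
    by (simp add: ennreal_mult)
  then show ?thesis
    by (cases "\<integral>\<^sup>+x. ennreal (norm (f x) * norm (g x)) \<partial>M") (auto simp: ennreal_power abs_le_square_iff[symmetric] top_unique)
qed

lemma integrable_mult_L2:
  assumes f: "f \<in> L2 M" and g: "g \<in> L2 M"
  shows "integrable M (\<lambda>x. f x * g x)"
proof (rule integrableI_bounded)
  show "(\<lambda>x. f x * g x) \<in> borel_measurable M" using f g by (auto simp: L2_iff)
  show "(\<integral>\<^sup>+ x. ennreal (norm (f x * g x)) \<partial>M) < \<infinity>"
    using nn_integral_mult_le[OF f g] by (simp add: norm_mult le_less_trans)
qed

lemma norm_integral_mult_le:
  assumes f: "f \<in> L2 M" and g: "g \<in> L2 M"
  shows "norm (LINT x|M. f x * g x) \<le> l2norm M f * l2norm M g"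
proof -
  have "ennreal (norm (LINT x|M. f x * g x)) \<le> (\<integral>\<^sup>+x. ennreal (norm (f x * g x)) \<partial>M)"
    by (rule integral_norm_bound_ennreal[OF integrable_mult_L2[OF f g]])
  also have "\<dots> \<le> ennreal (l2norm M f * l2norm M g)"
    using nn_integral_mult_le[OF f g] by (simp add: norm_mult)
  finally show ?thesis by simp
qed

lemma borel_measurable_cnj [measurable]:
  "f \<in> borel_measurable M \<Longrightarrow> (\<lambda>x. cnj (f x)) \<in> borel_measurable M"
  by (rule measurable_compose[OF _ borel_measurable_continuous_onI]) (auto intro: continuous_intros)

lemma L2_cnj: "f \<in> L2 M \<Longrightarrow> (\<lambda>x. cnj (f x)) \<in> L2 M"
  unfolding L2_iff by (auto simp: L2_norm_sq_def)

lemma l2norm_cnj [simp]: "l2norm M (\<lambda>x. cnj (f x)) = l2norm M f"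
  by (simp add: l2norm_def L2_norm_sq_def)

lemma integrable_inner_L2:
  "f \<in> L2 M \<Longrightarrow> g \<in> L2 M \<Longrightarrow> integrable M (\<lambda>x. f x * cnj (g x))"
  by (intro integrable_mult_L2 L2_cnj)

lemma l2norm_cong_AE: "AE x in M. norm (f x) = norm (g x) \<Longrightarrow> l2norm M f = l2norm M g"
  unfolding l2norm_def by (simp add: L2_norm_sq_cong_AE)

lemma l2norm_mono_AE:
  assumes "g \<in> L2 M" "AE x in M. norm (f x) \<le> norm (g x)" 
  shows "l2norm M f \<le> l2norm M g"
  unfolding l2norm_def using assms L2_norm_sq_mono_AE[OF assms(2)]
  by (intro real_sqrt_le_mono enn2real_mono) (auto simp: L2_iff)

lemma l2norm_scale: "f \<in> L2 M \<Longrightarrow> l2norm M (\<lambda>x. c * f x) = norm c * l2norm M f"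
  by (simp add: l2norm_def L2_norm_sq_scale L2_measurable enn2real_mult real_sqrt_mult)

lemma l2norm_eq_0_iff: "f \<in> L2 M \<Longrightarrow> l2norm M f = 0 \<longleftrightarrow> (AE x in M. f x = 0)"
  using L2_norm_sq_eq_0_iff[of f M] by (simp add: L2_norm_sq_eq L2_measurable)

text \<open>Integrate the expanded square and bound the cross term by Cauchy-Schwarz.\<close>

lemma l2norm_triangle:
  assumes f: "f \<in> L2 M" and g: "g \<in> L2 M"
  shows "l2norm M (\<lambda>x. f x + g x) \<le> l2norm M f + l2norm M g"
proof -
  have [measurable]: "f \<in> borel_measurable M" "g \<in> borel_measurable M"
    using f g by (auto simp: L2_iff)
  have "L2_norm_sq M (\<lambda>x. f x + g x) \<le> 
     (\<integral>\<^sup>+x. ennreal ((norm (f x))\<^sup>2) + 2 * ennreal (norm (f x) * norm (g x)) + ennreal ((norm (g x))\<^sup>2) \<partial>M)"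
    unfolding L2_norm_sq_def
  proof (rule nn_integral_mono)
    fix x
    have "(norm (f x + g x))\<^sup>2 \<le> (norm (f x) + norm (g x))\<^sup>2"
      by (intro power_mono norm_triangle_ineq) auto
    also have "\<dots> = (norm (f x))\<^sup>2 + 2 * (norm (f x) * norm (g x)) + (norm (g x))\<^sup>2"
      by (simp add: power2_sum)
    finally have "ennreal ((norm (f x + g x))\<^sup>2) \<le> ennreal \<dots>"
      by (rule ennreal_leI)
    then show "ennreal ((norm (f x + g x))\<^sup>2) \<le> ennreal ((norm (f x))\<^sup>2) + 2 * ennreal (norm (f x) * norm (g x)) + ennreal ((norm (g x))\<^sup>2)"
      by (simp add: ennreal_mult)
  qed
  also have "\<dots> = L2_norm_sq M f + 2 * (\<integral>\<^sup>+x. ennreal (norm (f x) * norm (g x)) \<partial>M) + L2_norm_sq M g"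
    by (simp add: nn_integral_add nn_integral_cmult L2_norm_sq_def)
  also have "\<dots> \<le> L2_norm_sq M f + 2 * ennreal (l2norm M f * l2norm M g) + L2_norm_sq M g"
    by (intro add_mono mult_left_mono nn_integral_mult_le f g) auto
  also have "\<dots> = ennreal ((l2norm M f + l2norm M g)\<^sup>2)"
  proof -
    have "2 * ennreal (l2norm M f * l2norm M g) = ennreal (2 * (l2norm M f * l2norm M g))"
      by (simp add: ennreal_mult)
    then show ?thesis
      using f g by (simp add: L2_norm_sq_eq power2_sum ennreal_plus[symmetric] algebra_simps del: ennreal_plus)
  qed
  finally have "ennreal ((l2norm M (\<lambda>x. f x + g x))\<^sup>2) \<le> ennreal ((l2norm M f + l2norm M g)\<^sup>2)"
    by (simp add: L2_norm_sq_eq[symmetric] L2_add f g)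
  then have "(l2norm M (\<lambda>x. f x + g x))\<^sup>2 \<le> (l2norm M f + l2norm M g)\<^sup>2"
    by (simp add: ennreal_le_iff)
  then show ?thesis by (rule power2_le_imp_le) simp
qed

lemma l2norm_diff_commute: "l2norm M (\<lambda>x. f x - g x) = l2norm M (\<lambda>x. g x - f x)"
  by (rule l2norm_cong_AE) (simp add: norm_minus_commute)

lemma l2norm_triangle_diff:
  assumes f: "f \<in> L2 M" and g: "g \<in> L2 M" and h: "h \<in> L2 M"
  shows "l2norm M (\<lambda>x. f x - h x) \<le> l2norm M (\<lambda>x. f x - g x) + l2norm M (\<lambda>x. g x - h x)"
  using l2norm_triangle[OF L2_diff[OF f g] L2_diff[OF g h]] by simp

lemma l2norm_reverse_triangle:
  assumes f: "f \<in> L2 M" and g: "g \<in> L2 M"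
  shows "\<bar>l2norm M f - l2norm M g\<bar> \<le> l2norm M (\<lambda>x. f x - g x)"
  using l2norm_triangle[OF L2_diff[OF f g] g] l2norm_triangle[OF L2_diff[OF g f] f] 
    l2norm_diff_commute[of M f g] by simp

section \<open>Convergence in mean square\<close>

definition l2_tendsto :: "'b measure \<Rightarrow> (nat \<Rightarrow> 'b \<Rightarrow> complex) \<Rightarrow> ('b \<Rightarrow> complex) \<Rightarrow> bool" where
  "l2_tendsto M f g \<longleftrightarrow> (\<lambda>n. l2norm M (\<lambda>x. f n x - g x)) \<longlonglongrightarrow> 0"

lemma L2_norm_tendsto_0_iff:
  assumes "\<And>n. f n \<in> L2 M" "g \<in> L2 M"
  shows "(\<lambda>n. L2_norm M (\<lambda>x. f n x - g x)) \<longlonglongrightarrow> 0 \<longleftrightarrow> l2_tendsto M f g"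
  unfolding l2_tendsto_def using assms
  by (subst L2_norm_eq) (auto intro!: L2_diff simp: tendsto_ennreal_iff simp flip: ennreal_0)

lemma l2_tendsto_norm:
  assumes "\<And>n. f n \<in> L2 M" "g \<in> L2 M" "l2_tendsto M f g"
  shows "(\<lambda>n. l2norm M (f n)) \<longlonglongrightarrow> l2norm M g"
proof -
  have "(\<lambda>n. l2norm M (f n) - l2norm M g) \<longlonglongrightarrow> 0"
    by (rule Lim_null_comparison[OF _ assms(3)[unfolded l2_tendsto_def]])
       (auto intro!: always_eventually l2norm_reverse_triangle assms(1,2))
  then show ?thesis by (simp add: LIM_zero_iff)
qed

text \<open>The common form of the continuity arguments: an operation whose increments are at most
  \<open>C\<close> times those of a convergent sequence preserves convergence. Scaling, convolution,
  involution and multiplication by a bounded function all pass through it.\<close>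

lemma l2_tendsto_comparison:
  assumes "\<And>n. l2norm M (\<lambda>x. f n x - g x) \<le> C * l2norm N (\<lambda>x. f' n x - g' x)"
    "l2_tendsto N f' g'"
  shows "l2_tendsto M f g"
  unfolding l2_tendsto_def
proof (rule Lim_null_comparison)
  show "(\<lambda>n. C * l2norm N (\<lambda>x. f' n x - g' x)) \<longlonglongrightarrow> 0"
    using assms(2) unfolding l2_tendsto_def by (rule tendsto_mult_right_zero)
qed (use assms in auto)

lemma l2_tendsto_add:
  assumes "\<And>n. f n \<in> L2 M" "g \<in> L2 M" "l2_tendsto M f g"
    "\<And>n. f' n \<in> L2 M" "g' \<in> L2 M" "l2_tendsto M f' g'"
  shows "l2_tendsto M (\<lambda>n x. f n x + f' n x) (\<lambda>x. g x + g' x)"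
  unfolding l2_tendsto_def
proof (rule Lim_null_comparison)
  show "(\<lambda>n. l2norm M (\<lambda>x. f n x - g x) + l2norm M (\<lambda>x. f' n x - g' x)) \<longlonglongrightarrow> 0"
    using assms(3,6) unfolding l2_tendsto_def by (rule tendsto_add_zero)
  show "\<forall>\<^sub>F n in sequentially. norm (l2norm M (\<lambda>x. f n x + f' n x - (g x + g' x))) \<le>
      l2norm M (\<lambda>x. f n x - g x) + l2norm M (\<lambda>x. f' n x - g' x)"
  proof (rule always_eventually, rule allI)
    fix n
    have "(\<lambda>x. f n x + f' n x - (g x + g' x)) = (\<lambda>x. (f n x - g x) + (f' n x - g' x))" 
      by (auto simp: algebra_simps)
    then show "norm (l2norm M (\<lambda>x. f n x + f' n x - (g x + g' x))) \<le>
      l2norm M (\<lambda>x. f n x - g x) + l2norm M (\<lambda>x. f' n x - g' x)"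
      using l2norm_triangle[OF L2_diff[OF assms(1,2)] L2_diff[OF assms(4,5)], of n] by simp
  qed
qed

lemma l2_tendsto_scale:
  assumes "\<And>n. f n \<in> L2 M" "g \<in> L2 M" "l2_tendsto M f g"
  shows "l2_tendsto M (\<lambda>n x. c * f n x) (\<lambda>x. c * g x)"
proof (rule l2_tendsto_comparison[OF _ assms(3)])
  fix n
  show "l2norm M (\<lambda>x. c * f n x - c * g x) \<le> norm c * l2norm M (\<lambda>x. f n x - g x)"
    using l2norm_scale[OF L2_diff[OF assms(1,2)], where c=c] by (simp add: algebra_simps)
qed

lemma l2_tendsto_AE_cong:
  assumes "AE x in M. g x = h x"
  shows "l2_tendsto M f g \<longleftrightarrow> l2_tendsto M f h"
proof -
  have "l2norm M (\<lambda>x. f n x - g x) = l2norm M (\<lambda>x. f n x - h x)" for n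
    by (rule l2norm_cong_AE) (use assms in auto)
  then show ?thesis by (simp add: l2_tendsto_def)
qed

text \<open>The dominating function bounds the differences rather than the functions, which suits
  truncations and partial sums: there the difference from the limit is at most the original
  function.\<close>

lemma l2_tendsto_dominated:
  assumes f: "\<And>n. f n \<in> L2 M" and g: "g \<in> L2 M" and w: "w \<in> L2 M"
    and lim: "AE x in M. (\<lambda>n. f n x) \<longlonglongrightarrow> g x"
    and dom: "\<And>n. AE x in M. norm (f n x - g x) \<le> norm (w x)"
  shows "l2_tendsto M f g"
proof -
  note [measurable] = L2_measurable[OF f] L2_measurable[OF g] L2_measurable[OF w]
  have "(\<lambda>n. \<integral>\<^sup>+x. ennreal ((norm (f n x - g x))\<^sup>2) \<partial>M) \<longlonglongrightarrow> (\<integral>\<^sup>+x. 0 \<partial>M)"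
  proof (rule nn_integral_dominated_convergence)
    show "(\<integral>\<^sup>+ x. ennreal ((norm (w x))\<^sup>2) \<partial>M) < \<infinity>" using w by (simp add: L2_iff L2_norm_sq_def)
    show "AE x in M. ennreal ((norm (f n x - g x))\<^sup>2) \<le> ennreal ((norm (w x))\<^sup>2)" for n
      using dom[of n] by eventually_elim (auto intro!: ennreal_leI power_mono)
    show "AE x in M. (\<lambda>n. ennreal ((norm (f n x - g x))\<^sup>2)) \<longlonglongrightarrow> 0"
      using lim
    proof eventually_elim
      case (elim x)
      have "(\<lambda>n. (norm (f n x - g x))\<^sup>2) \<longlonglongrightarrow> 0"
        using elim by (auto intro!: tendsto_eq_intros)
      then have "(\<lambda>n. ennreal ((norm (f n x - g x))\<^sup>2)) \<longlonglongrightarrow> ennreal 0" by (rule tendsto_ennrealI)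
      then show ?case by simp
    qed
  qed auto
  then have "(\<lambda>n. L2_norm_sq M (\<lambda>x. f n x - g x)) \<longlonglongrightarrow> ennreal 0"
    by (simp add: L2_norm_sq_def)
  then have "(\<lambda>n. (l2norm M (\<lambda>x. f n x - g x))\<^sup>2) \<longlonglongrightarrow> 0"
    using f g by (subst (asm) L2_norm_sq_eq) (auto intro!: L2_diff simp: tendsto_ennreal_iff simp del: ennreal_0)
  then have "(\<lambda>n. sqrt ((l2norm M (\<lambda>x. f n x - g x))\<^sup>2)) \<longlonglongrightarrow> sqrt 0"
    by (rule tendsto_real_sqrt)
  then show ?thesis by (simp add: l2_tendsto_def)
qed

text \<open>Lower semicontinuity of the norm under almost everywhere convergence. The bound is asked
  only from \<open>N\<close> on, so that a Cauchy estimate can be inserted with its own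
  threshold.\<close>

lemma L2_Fatou:
  assumes [measurable]: "\<And>n. f n \<in> borel_measurable M" "g \<in> borel_measurable M"
    and lim: "AE x in M. (\<lambda>n. f n x) \<longlonglongrightarrow> (g x :: complex)"
    and B: "\<And>n. n \<ge> N \<Longrightarrow> L2_norm_sq M (f n) \<le> B"
  shows "L2_norm_sq M g \<le> B"
proof -
  have "L2_norm_sq M g = (\<integral>\<^sup>+x. liminf (\<lambda>n. ennreal ((norm (f n x))\<^sup>2)) \<partial>M)"
    unfolding L2_norm_sq_def
  proof (rule nn_integral_cong_AE)
    show "AE x in M. ennreal ((norm (g x))\<^sup>2) = liminf (\<lambda>n. ennreal ((norm (f n x))\<^sup>2))"
      using lim
    proof eventually_elim
      case (elim x)
      then have "(\<lambda>n. ennreal ((norm (f n x))\<^sup>2)) \<longlonglongrightarrow> ennreal ((norm (g x))\<^sup>2)"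
        by (intro tendsto_intros)
      then show ?case by (rule lim_imp_Liminf[OF sequentially_bot, symmetric])
    qed
  qed
  also have "\<dots> \<le> liminf (\<lambda>n. L2_norm_sq M (f n))"
    unfolding L2_norm_sq_def by (rule nn_integral_liminf) simp
  also have "\<dots> \<le> liminf (\<lambda>n::nat. B)"
    by (rule Liminf_mono) (use B in \<open>auto simp: eventually_sequentially\<close>)
  finally show ?thesis by (simp add: Liminf_const)
qed

text \<open>If the weighted sum is \<open>C\<close>, each single term is at most \<open>C\<close>,
  so the k-th increment is at most sqrt C / 2^k; the increments are then dominated by a geometric
  series.\<close>

lemma convergent_if_weighted_increments_summable:
  fixes a :: "nat \<Rightarrow> complex"
  assumes fin: "(\<Sum>k. ennreal (4 ^ k * (norm (a (Suc k) - a k))\<^sup>2)) < \<infinity>"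
  shows "convergent a"
proof -
  define b where "b k = ennreal (4 ^ k * (norm (a (Suc k) - a k))\<^sup>2)" for k
  define C where "C = enn2real (suminf b)"
  have fin: "suminf b < \<infinity>" using assms by (simp only: b_def[abs_def])
  have "norm (a (Suc k) - a k) \<le> sqrt C * (1/2) ^ k" for k
  proof -
    have "sum b {k} \<le> suminf b" by (rule sum_le_suminf) auto
    also have "\<dots> = ennreal C" using fin by (simp add: C_def)
    finally have "4 ^ k * (norm (a (Suc k) - a k))\<^sup>2 \<le> C" by (simp add: b_def C_def)
    moreover have "(4 :: real) ^ k = (2 ^ k)\<^sup>2"
      by (simp add: power2_eq_square flip: power_mult_distrib)
    ultimately have "(2 ^ k * norm (a (Suc k) - a k))\<^sup>2 \<le> C"
      by (simp only: power_mult_distrib)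
    then have "2 ^ k * norm (a (Suc k) - a k) \<le> sqrt C" by (rule real_le_rsqrt)
    then show ?thesis by (simp add: field_simps)
  qed
  then have "summable (\<lambda>k. norm (a (Suc k) - a k))"
    by (intro summable_comparison_test'[where N=0 and g="\<lambda>k. sqrt C * (1/2) ^ k",
          OF summable_mult[OF summable_geometric]]) auto
  then have "summable (\<lambda>k. a (Suc k) - a k)" by (rule summable_norm_cancel)
  then have "convergent (\<lambda>n. \<Sum>k<n. a (Suc k) - a k)" by (simp add: summable_iff_convergent)
  then have "convergent (\<lambda>n. (a n - a 0) + a 0)"
    unfolding sum_lessThan_telescope by (rule convergent_add[OF _ convergent_const])
  then show ?thesis by simp
qed

text \<open>
  Along a subsequence the sum of \<open>4 ^ k * \<bar>f (r (k + 1)) - f (r k)\<bar>\<^sup>2\<close> has finite integral, which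
  forces geometric decay of the increments almost everywhere.
\<close>
theorem L2_complete:
  assumes f: "\<And>n. f n \<in> L2_space F M" and F: "closed F" "0 \<in> F"
    and Cauchy: "\<And>e. e > 0 \<Longrightarrow> \<exists>N. \<forall>m\<ge>N. \<forall>n\<ge>N. l2norm M (\<lambda>x. f m x - f n x) < e"
  obtains g where "g \<in> L2_space F M" "l2_tendsto M f g"
proof -
  have fL: "f n \<in> L2 M" for n using f L2_space_subset by auto
  note [measurable] = L2_measurable[OF fL]
  \<comment> \<open>After squaring, the increments are at most 1 / 8^k, and the weight 4^k still
    leaves the summable sequence 1 / 2^k.\<close>
  have "\<forall>k. \<exists>N. \<forall>m\<ge>N. \<forall>n\<ge>N. l2norm M (\<lambda>x. f m x - f n x) < sqrt (1 / 8 ^ k)"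
    using Cauchy by auto
  then obtain N where N: "\<And>k m n. m \<ge> N k \<Longrightarrow> n \<ge> N k \<Longrightarrow> l2norm M (\<lambda>x. f m x - f n x) < sqrt (1 / 8 ^ k)"
    by metis
  \<comment> \<open>The index is monotone, lies above every threshold \<open>N k\<close>, and the
    extra summand \<open>k\<close> makes it tend to infinity.\<close>
  define r where "r k = k + (\<Sum>j\<le>k. N j)" for k
  have r_mono: "mono r" unfolding r_def by (intro monoI add_mono sum_mono2) auto
  have r_ge: "N k \<le> r k" for k 
    using member_le_sum[of k "{..k}" N] by (auto simp: r_def)
  have incr: "L2_norm_sq M (\<lambda>x. f (r (Suc k)) x - f (r k) x) \<le> ennreal (1 / 8 ^ k)" for k
  proof -
    have "l2norm M (\<lambda>x. f (r (Suc k)) x - f (r k) x) < sqrt (1 / 8 ^ k)"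
      using r_ge[of k] monoD[OF r_mono, of k "Suc k"] by (intro N) auto
    then have "(l2norm M (\<lambda>x. f (r (Suc k)) x - f (r k) x))\<^sup>2 \<le> (sqrt (1 / 8 ^ k))\<^sup>2"
      by (intro power_mono) auto
    then show ?thesis by (simp add: L2_norm_sq_eq L2_diff fL ennreal_leI)
  qed
  have "(\<integral>\<^sup>+x. (\<Sum>k. ennreal (4 ^ k * (norm (f (r (Suc k)) x - f (r k) x))\<^sup>2)) \<partial>M) =
        (\<Sum>k. ennreal (4 ^ k) * L2_norm_sq M (\<lambda>x. f (r (Suc k)) x - f (r k) x))"
    unfolding L2_norm_sq_def
    by (subst nn_integral_suminf) (auto simp: ennreal_mult nn_integral_cmult)
  also have "\<dots> \<le> (\<Sum>k. ennreal ((1/2) ^ k))"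
  proof (intro suminf_le)
    fix k
    have "ennreal (4 ^ k) * L2_norm_sq M (\<lambda>x. f (r (Suc k)) x - f (r k) x) \<le> ennreal (4 ^ k) * ennreal (1 / 8 ^ k)"
      by (intro mult_left_mono incr) auto
    also have "\<dots> = ennreal (4 ^ k * (1 / 8 ^ k))" by (subst ennreal_mult) auto
    also have "4 ^ k * (1 / 8 ^ k) = (1/2 :: real) ^ k"
      using power_mult_distrib[of "1/8 :: real" 4 k] by (simp add: power_one_over mult.commute)
    finally show "ennreal (4 ^ k) * L2_norm_sq M (\<lambda>x. f (r (Suc k)) x - f (r k) x) \<le> ennreal ((1/2) ^ k)" .
  qed auto
  also have "\<dots> = ennreal (\<Sum>k. (1/2) ^ k)"
    by (rule suminf_ennreal2) (simp_all add: summable_geometric)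
  also have "\<dots> < \<infinity>" by simp
  finally have int: "(\<integral>\<^sup>+x. (\<Sum>k. ennreal (4 ^ k * (norm (f (r (Suc k)) x - f (r k) x))\<^sup>2)) \<partial>M) \<noteq> \<infinity>"
    by (rule less_imp_neq)
  have "AE x in M. (\<Sum>k. ennreal (4 ^ k * (norm (f (r (Suc k)) x - f (r k) x))\<^sup>2)) \<noteq> \<infinity>"
    by (rule nn_integral_noteq_infinite[OF _ int]) measurable
  then have conv: "AE x in M. convergent (\<lambda>k. f (r k) x)"
    by eventually_elim (rule convergent_if_weighted_increments_summable, simp only: less_top top.not_eq_extremum infinity_ennreal_def)
  \<comment> \<open>The value 0 off the set of convergence keeps \<open>g\<close> in
    \<open>F\<close> at every point, not only almost everywhere.\<close>
  define g where "g x = (if convergent (\<lambda>k. f (r k) x) then lim (\<lambda>k. f (r k) x) else 0)" for x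
  have [measurable]: "g \<in> borel_measurable M"
    unfolding g_def Cauchy_convergent_iff[symmetric] by measurable
  have lim: "AE x in M. (\<lambda>k. f (r k) x) \<longlonglongrightarrow> g x"
    using conv by eventually_elim (simp add: g_def convergent_LIMSEQ_iff)
  have gF: "g x \<in> F" if "x \<in> space M" for x
  proof (cases "convergent (\<lambda>k. f (r k) x)")
    case True
    then have "(\<lambda>k. f (r k) x) \<longlonglongrightarrow> g x" by (simp add: g_def convergent_LIMSEQ_iff)
    then show ?thesis
      by (rule closed_sequentially[OF F(1), rotated]) (use f that in \<open>auto simp: L2_space_def\<close>)
  next
    case False
    then show ?thesis using F(2) by (simp add: g_def)
  qed
  \<comment> \<open>Fatou along the subsequence against a fixed \<open>f n\<close>: the Cauchy
    property turns convergence of the subsequence into convergence of the whole sequence.\<close>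
  have bound: "L2_norm_sq M (\<lambda>x. g x - f n x) \<le> ennreal (e\<^sup>2)"
    if N0: "\<forall>m\<ge>N0. \<forall>n\<ge>N0. l2norm M (\<lambda>x. f m x - f n x) < e" and n: "n \<ge> N0" for e n N0
  proof (rule L2_Fatou[where f="\<lambda>k x. f (r k) x - f n x" and N=N0])
    show "AE x in M. (\<lambda>k. f (r k) x - f n x) \<longlonglongrightarrow> g x - f n x"
      using lim by eventually_elim (intro tendsto_intros)
    fix k assume "N0 \<le> k"
    then have "N0 \<le> r k" by (simp add: r_def)
    then have "l2norm M (\<lambda>x. f (r k) x - f n x) \<le> e" using N0 n by (meson less_imp_le)
    then have "(l2norm M (\<lambda>x. f (r k) x - f n x))\<^sup>2 \<le> e\<^sup>2" by (intro power_mono) auto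
    then show "L2_norm_sq M (\<lambda>x. f (r k) x - f n x) \<le> ennreal (e\<^sup>2)"
      by (simp add: L2_norm_sq_eq L2_diff fL ennreal_leI)
  qed auto
  obtain N1 where N1: "\<forall>m\<ge>N1. \<forall>n\<ge>N1. l2norm M (\<lambda>x. f m x - f n x) < 1"
    using Cauchy[of 1] by auto
  have "(\<lambda>x. g x - f N1 x) \<in> L2 M"
    using bound[OF N1 order_refl] by (simp add: L2_iff le_less_trans)
  from L2_add[OF this fL[of N1]] have gL: "g \<in> L2 M" by simp
  have "l2_tendsto M f g"
    unfolding l2_tendsto_def
  proof (rule LIMSEQ_I)
    fix e :: real assume e: "e > 0"
    obtain N0 where N0: "\<forall>m\<ge>N0. \<forall>n\<ge>N0. l2norm M (\<lambda>x. f m x - f n x) < e / 2"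
      using Cauchy[of "e / 2"] e by auto
    have "l2norm M (\<lambda>x. f n x - g x) < e" if n: "n \<ge> N0" for n
    proof -
      have "(l2norm M (\<lambda>x. g x - f n x))\<^sup>2 \<le> (e / 2)\<^sup>2"
        using bound[OF N0 n] by (simp add: L2_norm_sq_eq L2_diff gL fL)
      then have "l2norm M (\<lambda>x. g x - f n x) \<le> e / 2"
        by (rule power2_le_imp_le) (use e in simp)
      then show ?thesis using e by (simp add: l2norm_diff_commute[of M "f n"])
    qed
    then show "\<exists>no. \<forall>n\<ge>no. norm (l2norm M (\<lambda>x. f n x - g x) - 0) < e" by auto
  qed
  moreover have "g \<in> L2_space F M" using gL gF by (rule L2_spaceI)
  ultimately show ?thesis by (rule that[rotated])
qed

section \<open>Polarization, identification of limits, and truncation\<close>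

lemma complex_polarization:
  fixes z w :: complex
  shows "4 * (z * cnj w) = of_real ((norm (z + w))\<^sup>2) - of_real ((norm (z + (-1) * w))\<^sup>2)
     + \<i> * of_real ((norm (z + \<i> * w))\<^sup>2) - \<i> * of_real ((norm (z + (-\<i>) * w))\<^sup>2)"
  by (simp add: complex_eq_iff cmod_power2) (simp add: power2_eq_square algebra_simps)

lemma L2_norm_sq_integral:
  assumes "f \<in> L2 M"
  shows "integrable M (\<lambda>x. (norm (f x))\<^sup>2)" "(LINT x|M. (norm (f x))\<^sup>2) = enn2real (L2_norm_sq M f)"
proof -
  show "integrable M (\<lambda>x. (norm (f x))\<^sup>2)"
    using assms by (intro integrableI_bounded) (auto simp: L2_iff L2_norm_sq_def)
  show "(LINT x|M. (norm (f x))\<^sup>2) = enn2real (L2_norm_sq M f)"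
    using assms by (subst integral_eq_nn_integral) (auto simp: L2_iff L2_norm_sq_def)
qed

lemma L2_inner_polarization:
  assumes f: "f \<in> L2 M" and g: "g \<in> L2 M"
  defines "N c \<equiv> complex_of_real (enn2real (L2_norm_sq M (\<lambda>x. f x + c * g x)))"
  shows "4 * L2_inner M f g = N 1 - N (-1) + \<i> * N \<i> - \<i> * N (-\<i>)"
proof -
  have L: "(\<lambda>x. f x + c * g x) \<in> L2 M" for c
    by (intro L2_add L2_scale f g)
  have N: "N c = (LINT x|M. complex_of_real ((norm (f x + c * g x))\<^sup>2))" for c
    unfolding N_def integral_complex_of_real L2_norm_sq_integral(2)[OF L] ..
  have I: "integrable M (\<lambda>x. complex_of_real ((norm (f x + c * g x))\<^sup>2))" for c
    by (intro integrable_of_real L2_norm_sq_integral(1)[OF L])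
  have "4 * L2_inner M f g = (LINT x|M. 4 * (f x * cnj (g x)))"
    by (simp add: L2_inner_def)
  also have "\<dots> = (LINT x|M. of_real ((norm (f x + 1 * g x))\<^sup>2) - of_real ((norm (f x + (-1) * g x))\<^sup>2)
     + \<i> * of_real ((norm (f x + \<i> * g x))\<^sup>2) - \<i> * of_real ((norm (f x + (-\<i>) * g x))\<^sup>2))"
    unfolding complex_polarization by simp
  also have "\<dots> = N 1 - N (-1) + \<i> * N \<i> - \<i> * N (-\<i>)"
    unfolding N using I 
    by (simp only: Bochner_Integration.integral_diff Bochner_Integration.integral_add
        Bochner_Integration.integrable_diff Bochner_Integration.integrable_add
        integrable_mult_right integral_mult_right_zero)
  finally show ?thesis .
qed

text \<open>Transfers an inner product between two measure spaces when only squared norms can be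
  computed. The scalar \<open>c\<close> runs over all complex numbers, also for real signals,
  because polarization uses c = 1, -1, i and -i.\<close>

lemma L2_inner_eqI:
  assumes "f \<in> L2 M" "g \<in> L2 M" "f' \<in> L2 N" "g' \<in> L2 N"
    and "\<And>c. L2_norm_sq M (\<lambda>x. f x + c * g x) = L2_norm_sq N (\<lambda>x. f' x + c * g' x)"
  shows "L2_inner M f g = L2_inner N f' g'"
proof -
  have "4 * L2_inner M f g = 4 * L2_inner N f' g'"
    unfolding L2_inner_polarization[OF assms(1,2)] L2_inner_polarization[OF assms(3,4)] assms(5) ..
  then show ?thesis by simp
qed

text \<open>Test against the difference \<open>f - g\<close>, which is again
  \<open>F\<close>-valued.\<close>

lemma L2_inner_eq_imp_AE_eq:
  assumes F: "F = \<real> \<or> F = UNIV" and f: "f \<in> L2_space F M" and g: "g \<in> L2_space F M"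
    and eq: "\<And>h. h \<in> L2_space F M \<Longrightarrow> L2_inner M f h = L2_inner M g h"
  shows "AE x in M. f x = g x"
proof -
  define d where "d x = f x - g x" for x
  have L: "f \<in> L2 M" "g \<in> L2 M" using f g L2_space_subset by auto
  then have dL: "d \<in> L2 M" unfolding d_def by (rule L2_diff)
  have dF: "d \<in> L2_space F M"
    using F L2_spaceD[OF f] L2_spaceD[OF g] by (auto intro!: L2_spaceI[OF dL] simp: d_def)
  have "L2_inner M d d = (LINT x|M. f x * cnj (d x) - g x * cnj (d x))"
    unfolding L2_inner_def by (simp add: d_def left_diff_distrib)
  also have "\<dots> = L2_inner M f d - L2_inner M g d"
    unfolding L2_inner_def
    by (intro Bochner_Integration.integral_diff integrable_inner_L2 L dL)
  also have "\<dots> = 0" using eq[OF dF] by simp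
  finally have "of_real (LINT x|M. (norm (d x))\<^sup>2) = (0::complex)"
    unfolding L2_inner_def complex_norm_square[symmetric] of_real_power[symmetric] integral_complex_of_real
    by simp
  then have "l2norm M d = 0"
    unfolding L2_norm_sq_integral(2)[OF dL] l2norm_def by simp
  then show ?thesis using dL by (simp add: l2norm_eq_0_iff d_def)
qed

lemma l2_tendsto_Cauchy:
  assumes f: "\<And>n. f n \<in> L2 M" and g: "g \<in> L2 M" and lim: "l2_tendsto M f g" and e: "e > 0"
  shows "\<exists>N. \<forall>m\<ge>N. \<forall>n\<ge>N. l2norm M (\<lambda>x. f m x - f n x) < e"
proof -
  obtain N where N: "\<And>n. n \<ge> N \<Longrightarrow> l2norm M (\<lambda>x. f n x - g x) < e / 2"
    using LIMSEQ_D[OF lim[unfolded l2_tendsto_def], of "e / 2"] e by auto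
  have "l2norm M (\<lambda>x. f m x - f n x) < e" if "m \<ge> N" "n \<ge> N" for m n
    using N[OF that(1)] N[OF that(2)] l2norm_triangle_diff[OF f g f, of m n]
    by (simp add: l2norm_diff_commute[of M g])
  then show ?thesis by blast
qed

text \<open>A sequence converging both pointwise and in mean square has one limit: by Fatou the
  squared norm of the difference of the two limits is below every positive \<open>e\<close>.\<close>

lemma l2_tendsto_AE_lim:
  assumes f: "\<And>n. f n \<in> L2 M" and u: "u \<in> L2 M" and lim: "l2_tendsto M f u"
    and v: "v \<in> borel_measurable M" and pt: "AE x in M. (\<lambda>n. f n x) \<longlonglongrightarrow> v x"
  shows "AE x in M. v x = u x"
proof -
  have [measurable]: "f n \<in> borel_measurable M" "u \<in> borel_measurable M" "v \<in> borel_measurable M" for n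
    using f u v by (auto simp: L2_iff)
  have eps: "L2_norm_sq M (\<lambda>x. v x - u x) \<le> 0 + ennreal e" if e: "e > 0" for e :: real
  proof -
    obtain N where N: "\<And>n. n \<ge> N \<Longrightarrow> l2norm M (\<lambda>x. f n x - u x) < sqrt e"
      using LIMSEQ_D[OF lim[unfolded l2_tendsto_def], of "sqrt e"] e by auto
    show ?thesis
    proof (rule L2_Fatou[where f="\<lambda>n x. f n x - u x" and N=N])
      show "AE x in M. (\<lambda>n. f n x - u x) \<longlonglongrightarrow> v x - u x"
        using pt by eventually_elim (intro tendsto_intros)
      fix n assume "N \<le> n"
      then have "(l2norm M (\<lambda>x. f n x - u x))\<^sup>2 \<le> (sqrt e)\<^sup>2"
        using N[of n] by (intro power_mono) auto
      then show "L2_norm_sq M (\<lambda>x. f n x - u x) \<le> 0 + ennreal e"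
        using e by (simp add: L2_norm_sq_eq L2_diff f u ennreal_leI)
    qed auto
  qed
  have "L2_norm_sq M (\<lambda>x. v x - u x) \<le> 0"
    by (rule ennreal_le_epsilon) (rule eps)
  then have "L2_norm_sq M (\<lambda>x. v x - u x) = 0" by simp
  then show ?thesis by (subst (asm) L2_norm_sq_eq_0_iff) auto
qed

text \<open>Small values are cut off, not large ones: where |f| >= 1 / (n + 1) one has |f| <= (n +
  1) |f|^2, which is integrable. No exhaustion of the space enters.\<close>

lemma L2_truncation:
  assumes f: "f \<in> L2 M"
  obtains h where "\<And>n. h n \<in> L2 M" "\<And>n. integrable M (h n)" "l2_tendsto M h f"
proof -
  have [measurable]: "f \<in> borel_measurable M" using f by (auto simp: L2_iff)
  define h where "h n x = (if norm (f x) \<ge> inverse (real (Suc n)) then f x else 0)" for n :: nat and x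
  have [measurable]: "h n \<in> borel_measurable M" for n unfolding h_def by measurable
  have hL: "h n \<in> L2 M" for n
    by (rule L2_dominated[OF f]) (auto simp: h_def)
  show ?thesis
  proof
    show "h n \<in> L2 M" for n by (rule hL)
    show "integrable M (h n)" for n
    proof (rule Bochner_Integration.integrable_bound)
      show "integrable M (\<lambda>x. real (Suc n) * (norm (f x))\<^sup>2)"
        by (intro integrable_mult_right L2_norm_sq_integral(1) f)
      have "norm (f x) \<le> real (Suc n) * (norm (f x))\<^sup>2" if "norm (f x) \<ge> inverse (real (Suc n))" for x
      proof -
        have "1 \<le> real (Suc n) * norm (f x)" using that by (simp add: field_simps)
        then have "1 * norm (f x) \<le> (real (Suc n) * norm (f x)) * norm (f x)"
          by (rule mult_right_mono) simp
        then show ?thesis by (simp add: power2_eq_square mult.assoc)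
      qed
      then show "AE x in M. norm (h n x) \<le> norm (real (Suc n) * (norm (f x))\<^sup>2)"
        by (auto simp: h_def)
    qed simp
    show "l2_tendsto M h f"
    proof (rule l2_tendsto_dominated[OF hL f f])
      show "AE x in M. (\<lambda>n. h n x) \<longlonglongrightarrow> f x"
      proof (rule AE_I2)
        fix x
        show "(\<lambda>n. h n x) \<longlonglongrightarrow> f x"
        proof (cases "f x = 0")
          case True
          then show ?thesis by (simp add: h_def)
        next
          case False
          then have "eventually (\<lambda>n. inverse (real (Suc n)) < norm (f x)) sequentially"
            using LIMSEQ_inverse_real_of_nat by (intro order_tendstoD(2)) auto
          then have "eventually (\<lambda>n. f x = h n x) sequentially"
            by eventually_elim (simp add: h_def)
          then show ?thesis by (rule Lim_transform_eventually[OF tendsto_const])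
        qed
      qed
      show "AE x in M. norm (h n x - f x) \<le> norm (f x)" for n by (auto simp: h_def)
    qed
  qed
qed

lemma l2norm_cong: "(\<And>x. x \<in> space M \<Longrightarrow> f x = g x) \<Longrightarrow> l2norm M f = l2norm M g"
  by (rule l2norm_cong_AE) auto

lemma L2_norm_pos_iff: "0 < L2_norm M f \<longleftrightarrow> 0 < L2_norm_sq M f"
proof (cases "L2_norm_sq M f")
  case (real r)
  then show ?thesis by (simp add: L2_norm_def ennreal_sqrt_def)
next
  case top
  then show ?thesis by (simp add: L2_norm_def ennreal_sqrt_def)
qed

lemma ennreal_sqrt_le:
  assumes "x \<le> ennreal r" "r \<ge> 0"
  shows "ennreal_sqrt x \<le> ennreal (sqrt r)"
proof -
  have "x \<noteq> \<infinity>" using assms by (auto simp: top_unique)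
  moreover have "enn2real x \<le> r" using enn2real_mono[OF assms(1)] assms(2) by simp
  ultimately show ?thesis by (simp add: ennreal_sqrt_def ennreal_leI)
qed

lemma L2_inner_cong:
  assumes "\<And>p. p \<in> space M \<Longrightarrow> f p = f' p" "\<And>p. p \<in> space M \<Longrightarrow> g p = g' p"
  shows "L2_inner M f g = L2_inner M f' g'"
  unfolding L2_inner_def by (rule Bochner_Integration.integral_cong) (use assms in auto)

section \<open>Haar measure and convolution\<close>

locale haar_group =
  fixes \<mu> :: "'a::{topological_ab_group_add, t2_space, second_countable_topology} measure"
  assumes locally_compact: "locally_compact_space (euclidean :: 'a topology)"
    and haar: "haar_measure euclidean (+) \<mu>"
begin

lemma space_haar [simp]: "space \<mu> = UNIV"
  using haar by (simp add: haar_measure_def)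

lemma sets_haar [measurable_cong, simp]: "sets \<mu> = sets borel"
proof -
  have "sets \<mu> = sigma_sets UNIV {U :: 'a set. open U}"
    using haar by (simp add: haar_measure_def flip: open_openin)
  then show ?thesis unfolding borel_def by simp
qed

lemma emeasure_translate: "B \<in> sets borel \<Longrightarrow> emeasure \<mu> ((+) a ` B) = emeasure \<mu> B"
  using haar by (simp add: haar_measure_def)

lemma emeasure_compact: "compact K \<Longrightarrow> emeasure \<mu> K < \<infinity>"
  using haar by (auto simp: haar_measure_def compact_imp_closed)

lemma emeasure_open_pos: "open U \<Longrightarrow> U \<noteq> {} \<Longrightarrow> 0 < emeasure \<mu> U"
  using haar by (simp add: haar_measure_def flip: open_openin)

text \<open>Local compactness supplies compact neighbourhoods, and the Lindelof property makes
  countably many of them suffice. The exhaustion yields sigma-finiteness and later reduces Fourier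
  integrals to compact supports.\<close>

lemma compact_exhaustion:
  obtains K :: "nat \<Rightarrow> 'a set" where "\<And>n. compact (K n)" "incseq K" "(\<Union>n. K n) = UNIV"
proof -
  have "\<exists>U K. open U \<and> compact K \<and> x \<in> U \<and> U \<subseteq> K" for x :: 'a
    using locally_compact by (auto simp: locally_compact_space_def simp flip: open_openin)
  then obtain U C where UC: "\<And>x::'a. open (U x)" "\<And>x. compact (C x)" "\<And>x. x \<in> U x" "\<And>x. U x \<subseteq> C x"
    by metis
  obtain \<F>' where F: "\<F>' \<subseteq> range U" "countable \<F>'" "\<Union>\<F>' = \<Union>(range U)"
    using Lindelof[of "range U"] UC(1) by auto
  then obtain X where X: "countable X" "\<F>' = U ` X"
    using countable_subset_image[of \<F>' U UNIV] by auto
  have "(\<Union>x\<in>X. U x) = UNIV" using F(3) X(2) UC(3) by auto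
  then have cov: "(\<Union>x\<in>X. C x) = UNIV" using UC(4) by blast
  then have "X \<noteq> {}" by auto
  define K where "K n = (\<Union>k\<le>n. C (from_nat_into X k))" for n :: nat
  show ?thesis
  proof
    show "compact (K n)" for n unfolding K_def by (intro compact_UN UC) auto
    show "incseq K" unfolding K_def by (intro monoI UN_mono) auto
    show "(\<Union>n. K n) = UNIV"
    proof (intro equalityI subset_UNIV subsetI)
      fix y
      obtain x where x: "x \<in> X" "y \<in> C x" using cov by auto
      then obtain k where "x = from_nat_into X k" using X(1) from_nat_into_surj by metis
      then show "y \<in> (\<Union>n. K n)" using x by (auto simp: K_def)
    qed
  qed
qed

sublocale sigma_finite_measure \<mu>
proof
  obtain K :: "nat \<Rightarrow> 'a set" where K: "\<And>n. compact (K n)" "incseq K" "(\<Union>n. K n) = UNIV"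
    using compact_exhaustion by blast
  show "\<exists>A. countable A \<and> A \<subseteq> sets \<mu> \<and> \<Union> A = space \<mu> \<and> (\<forall>a\<in>A. emeasure \<mu> a \<noteq> \<infinity>)"
    by (rule exI[of _ "range K"]) (use K emeasure_compact in \<open>auto simp: compact_imp_closed less_top\<close>)
qed

sublocale pair_sigma_finite \<mu> \<mu> ..

lemma measurable_uminus [measurable]: "(\<lambda>x. - x) \<in> \<mu> \<rightarrow>\<^sub>M \<mu>"
proof -
  have "(\<lambda>x::'a. - x) \<in> borel_measurable borel"
    by (intro borel_measurable_continuous_onI continuous_intros)
  then show ?thesis by (simp cong: measurable_cong_sets)
qed

text \<open>Second countability enters here: addition is measurable for the product of the two Borel
  algebras, which is what the Tonelli arguments for convolutions require.\<close>

lemma measurable_plus [measurable]: "(\<lambda>(x, y). x + y) \<in> \<mu> \<Otimes>\<^sub>M \<mu> \<rightarrow>\<^sub>M \<mu>"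
proof -
  have "(\<lambda>z::'a \<times> 'a. fst z + snd z) \<in> borel_measurable (borel \<Otimes>\<^sub>M borel)"
    by measurable
  moreover have "sets (\<mu> \<Otimes>\<^sub>M \<mu>) = sets (borel \<Otimes>\<^sub>M borel :: ('a \<times> 'a) measure)"
    by (intro sets_pair_measure_cong) auto
  ultimately show ?thesis by (simp add: case_prod_beta cong: measurable_cong_sets)
qed

lemma measurable_minus [measurable]: "(\<lambda>(x, y). x - y) \<in> \<mu> \<Otimes>\<^sub>M \<mu> \<rightarrow>\<^sub>M \<mu>"
proof -
  have "(\<lambda>z. (fst z, - snd z)) \<in> \<mu> \<Otimes>\<^sub>M \<mu> \<rightarrow>\<^sub>M \<mu> \<Otimes>\<^sub>M \<mu>" by measurable
  from measurable_compose[OF this measurable_plus] show ?thesis by (simp add: case_prod_beta)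
qed

lemma measurable_minus_right [measurable]: "(\<lambda>y. x - y) \<in> \<mu> \<rightarrow>\<^sub>M \<mu>"
  using measurable_compose[OF measurable_Pair1'[of x \<mu> \<mu>] measurable_minus] by simp

lemma measurable_plus_right [measurable]: "(\<lambda>y. x + y) \<in> \<mu> \<rightarrow>\<^sub>M \<mu>"
  using measurable_compose[OF measurable_Pair1'[of x \<mu> \<mu>] measurable_plus] by simp

section \<open>Invariance of the Haar integral under translation and reflection\<close>

lemma distr_translate: "distr \<mu> \<mu> (\<lambda>x. a + x) = \<mu>"
proof (rule measure_eqI)
  fix B assume "B \<in> sets (distr \<mu> \<mu> (\<lambda>x. a + x))"
  then have B: "B \<in> sets borel" by simp
  have "(\<lambda>x. a + x) -` B = (+) (- a) ` B"
    by (force simp: image_iff)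
  then show "emeasure (distr \<mu> \<mu> (\<lambda>x. a + x)) B = emeasure \<mu> B"
    using B emeasure_translate[OF B, of "- a"] by (simp add: emeasure_distr)
qed simp

lemma nn_integral_translate:
  assumes "f \<in> borel_measurable \<mu>"
  shows "(\<integral>\<^sup>+x. f (a + x) \<partial>\<mu>) = (\<integral>\<^sup>+x. f x \<partial>\<mu>)"
  using nn_integral_distr[OF measurable_plus_right, of f a] assms by (simp add: distr_translate)

text \<open>
  Evaluating \<open>\<integral>\<integral> f(x) g(x - y)\<close> in both orders gives \<open>(\<integral>f) (\<integral>g(-y)) = (\<integral>g) (\<integral>f)\<close>, so in the abelian case
  inversion invariance does not need the uniqueness of Haar measure.
\<close>
lemma nn_integral_uminus:
  assumes [measurable]: "g \<in> borel_measurable \<mu>"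
  shows "(\<integral>\<^sup>+x. g (- x) \<partial>\<mu>) = (\<integral>\<^sup>+x. g x \<partial>\<mu>)"
proof -
  \<comment> \<open>A compact neighbourhood of 0 has positive and finite measure; its indicator is
    the integrable function in the double integral, and its measure is cancelled at the end.\<close>
  have "\<exists>U K. open U \<and> compact K \<and> (0::'a) \<in> U \<and> U \<subseteq> K"
    using locally_compact by (auto simp: locally_compact_space_def simp flip: open_openin)
  then obtain U K where UK: "open U" "compact K" "(0::'a) \<in> U" "U \<subseteq> K"
    by blast
  have K [measurable]: "K \<in> sets \<mu>" using UK by (simp add: compact_imp_closed)
  have "0 < emeasure \<mu> U" using UK by (intro emeasure_open_pos) auto
  also have "\<dots> \<le> emeasure \<mu> K" using UK by (intro emeasure_mono) (auto simp: compact_imp_closed)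
  finally have pos: "emeasure \<mu> K > 0" .
  let ?f = "indicator K :: 'a \<Rightarrow> ennreal"
  have minus_swap: "g (- y + x) = g (x - y)" for x y by simp
  have "(\<integral>\<^sup>+y. g (- y) \<partial>\<mu>) * emeasure \<mu> K = (\<integral>\<^sup>+x. ?f x * (\<integral>\<^sup>+y. g (- y) \<partial>\<mu>) \<partial>\<mu>)"
    using K by (simp add: nn_integral_multc mult.commute)
  also have "\<dots> = (\<integral>\<^sup>+x. ?f x * (\<integral>\<^sup>+y. g (x - y) \<partial>\<mu>) \<partial>\<mu>)"
  proof -
    have "(\<integral>\<^sup>+y. g (- y) \<partial>\<mu>) = (\<integral>\<^sup>+y. g (x - y) \<partial>\<mu>)" for x
      using nn_integral_translate[of "\<lambda>y. g (- y)" "- x"] by simp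
    then show ?thesis by presburger
  qed
  also have "\<dots> = (\<integral>\<^sup>+x. (\<integral>\<^sup>+y. ?f x * g (x - y) \<partial>\<mu>) \<partial>\<mu>)"
    by (simp add: nn_integral_cmult)
  also have "\<dots> = (\<integral>\<^sup>+y. (\<integral>\<^sup>+x. ?f x * g (x - y) \<partial>\<mu>) \<partial>\<mu>)"
    by (rule Fubini') measurable
  also have "\<dots> = (\<integral>\<^sup>+y. (\<integral>\<^sup>+x. ?f (y + x) * g x \<partial>\<mu>) \<partial>\<mu>)"
  proof (rule nn_integral_cong)
    fix y
    show "(\<integral>\<^sup>+x. ?f x * g (x - y) \<partial>\<mu>) = (\<integral>\<^sup>+x. ?f (y + x) * g x \<partial>\<mu>)"
      using nn_integral_translate[of "\<lambda>x. ?f x * g (- y + x)" y] by (simp add: minus_swap)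
  qed
  also have "\<dots> = (\<integral>\<^sup>+x. (\<integral>\<^sup>+y. ?f (y + x) * g x \<partial>\<mu>) \<partial>\<mu>)"
    by (rule Fubini') measurable
  also have "\<dots> = (\<integral>\<^sup>+x. (\<integral>\<^sup>+y. ?f (x + y) \<partial>\<mu>) * g x \<partial>\<mu>)"
    by (simp add: nn_integral_multc add.commute)
  also have "\<dots> = (\<integral>\<^sup>+x. emeasure \<mu> K * g x \<partial>\<mu>)"
    using K by (simp add: nn_integral_translate)
  also have "\<dots> = (\<integral>\<^sup>+x. g x \<partial>\<mu>) * emeasure \<mu> K"
    by (simp add: nn_integral_cmult mult.commute[of _ "emeasure \<mu> K"])
  finally show ?thesis
    using pos emeasure_compact[OF UK(2)]
    by (auto simp: mult.commute[of _ "emeasure \<mu> K"] ennreal_mult_cancel_left)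
qed

lemma distr_uminus: "distr \<mu> \<mu> (\<lambda>x. - x) = \<mu>"
proof (rule measure_eqI)
  fix B assume "B \<in> sets (distr \<mu> \<mu> (\<lambda>x. - x))"
  then have B: "B \<in> sets borel" and [measurable]: "B \<in> sets \<mu>" by simp_all
  have "emeasure (distr \<mu> \<mu> (\<lambda>x. - x)) B = (\<integral>\<^sup>+x. indicator B x \<partial>distr \<mu> \<mu> (\<lambda>x. - x))"
    by (rule nn_integral_indicator[symmetric]) (use \<open>B \<in> sets \<mu>\<close> in simp)
  also have "\<dots> = (\<integral>\<^sup>+x. indicator B (- x) \<partial>\<mu>)"
    by (rule nn_integral_distr) measurable
  also have "\<dots> = emeasure \<mu> B" by (subst nn_integral_uminus) (use B in auto)
  finally show "emeasure (distr \<mu> \<mu> (\<lambda>x. - x)) B = emeasure \<mu> B" .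
qed simp

lemma distr_minus: "distr \<mu> \<mu> (\<lambda>y. x - y) = \<mu>"
proof -
  have "distr \<mu> \<mu> (\<lambda>y. x - y) = distr (distr \<mu> \<mu> (\<lambda>y. - y)) \<mu> (\<lambda>y. x + y)"
    by (subst distr_distr) (auto simp: comp_def)
  then show ?thesis by (simp add: distr_uminus distr_translate)
qed

lemma nn_integral_minus:
  "f \<in> borel_measurable \<mu> \<Longrightarrow> (\<integral>\<^sup>+y. f (x - y) \<partial>\<mu>) = (\<integral>\<^sup>+y. f y \<partial>\<mu>)"
  using nn_integral_distr[OF measurable_minus_right, of f x] by (simp add: distr_minus)

lemma distr_minus_left: "distr \<mu> \<mu> (\<lambda>x. x - y) = \<mu>"
  using distr_translate[of "- y"] by simp

lemma measurable_minus_left [measurable]: "(\<lambda>x. x - y) \<in> \<mu> \<rightarrow>\<^sub>M \<mu>"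
  using measurable_plus_right[of "- y"] by simp

lemma nn_integral_minus_left:
  "f \<in> borel_measurable \<mu> \<Longrightarrow> (\<integral>\<^sup>+x. f (x - y) \<partial>\<mu>) = (\<integral>\<^sup>+x. f x \<partial>\<mu>)"
  using nn_integral_translate[of f "- y"] by simp

lemma integral_minus_left:
  fixes f :: "'a \<Rightarrow> complex"
  shows "f \<in> borel_measurable \<mu> \<Longrightarrow> (LINT x|\<mu>. f (x - y)) = (LINT x|\<mu>. f x)"
  using integral_distr[OF measurable_minus_left, of f y] by (simp add: distr_minus_left)

lemma integral_uminus:
  fixes f :: "'a \<Rightarrow> complex"
  shows "f \<in> borel_measurable \<mu> \<Longrightarrow> (LINT x|\<mu>. f (- x)) = (LINT x|\<mu>. f x)"
  using integral_distr[OF measurable_uminus, of f] by (simp add: distr_uminus)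

lemma L2_reflect:
  assumes "f \<in> L2 \<mu>"
  shows "(\<lambda>y. f (x - y)) \<in> L2 \<mu>" and "l2norm \<mu> (\<lambda>y. f (x - y)) = l2norm \<mu> f"
proof -
  have [measurable]: "f \<in> borel_measurable \<mu>" using assms by (simp add: L2_iff)
  have "L2_norm_sq \<mu> (\<lambda>y. f (x - y)) = L2_norm_sq \<mu> f"
    unfolding L2_norm_sq_def by (rule nn_integral_minus) measurable
  then show "(\<lambda>y. f (x - y)) \<in> L2 \<mu>" "l2norm \<mu> (\<lambda>y. f (x - y)) = l2norm \<mu> f"
    using assms by (simp_all add: L2_iff l2norm_def)
qed

lemma involution_L2:
  assumes "f \<in> L2 \<mu>"
  shows "involution f \<in> L2 \<mu>" and "l2norm \<mu> (involution f) = l2norm \<mu> f"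
  using L2_cnj[OF L2_reflect(1)[OF assms, of 0]] L2_reflect(2)[OF assms, of 0]
  by (simp_all add: involution_def[abs_def])

section \<open>Convolution\<close>

lemma conv_integrable:
  "f \<in> L2 \<mu> \<Longrightarrow> g \<in> L2 \<mu> \<Longrightarrow> integrable \<mu> (\<lambda>y. f y * g (x - y))"
  by (intro integrable_mult_L2 L2_reflect)

lemma norm_conv_le:
  "f \<in> L2 \<mu> \<Longrightarrow> g \<in> L2 \<mu> \<Longrightarrow> norm (conv \<mu> f g x) \<le> l2norm \<mu> f * l2norm \<mu> g"
  unfolding conv_def
  by (rule order_trans[OF norm_integral_mult_le[OF _ L2_reflect(1)]]) (simp_all add: L2_reflect(2))

lemma conv_cong_AE:
  assumes [measurable]: "f \<in> borel_measurable \<mu>" "f' \<in> borel_measurable \<mu>" "g \<in> borel_measurable \<mu>"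
    and "AE y in \<mu>. f y = f' y"
  shows "conv \<mu> f g x = conv \<mu> f' g x"
  unfolding conv_def by (rule integral_cong_AE) (use assms in auto)

lemma conv_add_left:
  assumes "f \<in> L2 \<mu>" "f' \<in> L2 \<mu>" "g \<in> L2 \<mu>"
  shows "conv \<mu> (\<lambda>y. f y + f' y) g x = conv \<mu> f g x + conv \<mu> f' g x"
  unfolding conv_def distrib_right
  by (intro Bochner_Integration.integral_add conv_integrable assms)

lemma conv_scale_left: "conv \<mu> (\<lambda>y. c * f y) g x = c * conv \<mu> f g x"
  unfolding conv_def by (simp add: mult.assoc)

lemma conv_diff_left:
  assumes "f \<in> L2 \<mu>" "f' \<in> L2 \<mu>" "g \<in> L2 \<mu>"
  shows "conv \<mu> (\<lambda>y. f y - f' y) g x = conv \<mu> f g x - conv \<mu> f' g x"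
  unfolding conv_def left_diff_distrib
  by (intro Bochner_Integration.integral_diff conv_integrable assms)

lemma conv_diff_right:
  assumes "f \<in> L2 \<mu>" "g \<in> L2 \<mu>" "g' \<in> L2 \<mu>"
  shows "conv \<mu> f (\<lambda>y. g y - g' y) x = conv \<mu> f g x - conv \<mu> f g' x"
  unfolding conv_def right_diff_distrib
  by (intro Bochner_Integration.integral_diff conv_integrable assms)

lemma conv_measurable [measurable]:
  assumes [measurable]: "f \<in> borel_measurable \<mu>" "g \<in> borel_measurable \<mu>"
  shows "conv \<mu> f g \<in> borel_measurable \<mu>"
  unfolding conv_def[abs_def] by measurable

lemma conv_real:
  assumes "\<And>x. f x \<in> \<real>" "\<And>x. g x \<in> \<real>"
  shows "conv \<mu> f g x \<in> \<real>"
proof -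
  have "f y * g (x - y) = complex_of_real (Re (f y) * Re (g (x - y)))" for y
    using assms by (simp add: of_real_Re)
  then show ?thesis unfolding conv_def by (simp only: integral_complex_of_real Reals_of_real)
qed

text \<open>Split |f| into two square roots, apply Cauchy-Schwarz to the inner integral, and finish
  by Tonelli and translation invariance.\<close>

lemma Young_L1_L2:
  assumes f: "integrable \<mu> f" and g: "g \<in> L2 \<mu>"
  shows "L2_norm_sq \<mu> (conv \<mu> f g) \<le> (\<integral>\<^sup>+y. norm (f y) \<partial>\<mu>)\<^sup>2 * L2_norm_sq \<mu> g"
proof -
  have [measurable]: "f \<in> borel_measurable \<mu>" "g \<in> borel_measurable \<mu>"
    using f g by (auto simp: L2_iff)
  define I where "I = (\<integral>\<^sup>+y. ennreal (norm (f y)) \<partial>\<mu>)"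
  have pt: "ennreal ((norm (conv \<mu> f g x))\<^sup>2) \<le> I * (\<integral>\<^sup>+y. ennreal (norm (f y)) * ennreal ((norm (g (x - y)))\<^sup>2) \<partial>\<mu>)" for x
  \<comment> \<open>At a point where the integrand is not integrable, the integral takes the default
    value 0 and the bound is trivial.\<close>
  proof (cases "integrable \<mu> (\<lambda>y. f y * g (x - y))")
    case True
    let ?s = "\<lambda>y. sqrt (norm (f y))"
    have "ennreal (norm (conv \<mu> f g x)) \<le> (\<integral>\<^sup>+y. ennreal (norm (f y * g (x - y))) \<partial>\<mu>)"
      unfolding conv_def by (rule integral_norm_bound_ennreal[OF True])
    also have "\<dots> = (\<integral>\<^sup>+y. ennreal (?s y) * ennreal (?s y * norm (g (x - y))) \<partial>\<mu>)"
      by (intro nn_integral_cong) (simp add: norm_mult flip: ennreal_mult mult.assoc)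
    finally have "(ennreal (norm (conv \<mu> f g x)))\<^sup>2 \<le> (\<integral>\<^sup>+y. ennreal (?s y) * ennreal (?s y * norm (g (x - y))) \<partial>\<mu>)\<^sup>2"
      by (rule power_mono) simp
    also have "\<dots> \<le> (\<integral>\<^sup>+y. (ennreal (?s y))\<^sup>2 \<partial>\<mu>) * (\<integral>\<^sup>+y. (ennreal (?s y * norm (g (x - y))))\<^sup>2 \<partial>\<mu>)"
      by (rule Cauchy_Schwarz_nn_integral) measurable
    also have "\<dots> = I * (\<integral>\<^sup>+y. ennreal (norm (f y)) * ennreal ((norm (g (x - y)))\<^sup>2) \<partial>\<mu>)"
      by (simp add: I_def ennreal_power power_mult_distrib ennreal_mult)
    finally show ?thesis by (simp add: ennreal_power)
  qed (simp add: conv_def not_integrable_integral_eq)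
  have "L2_norm_sq \<mu> (conv \<mu> f g) \<le> (\<integral>\<^sup>+x. I * (\<integral>\<^sup>+y. ennreal (norm (f y)) * ennreal ((norm (g (x - y)))\<^sup>2) \<partial>\<mu>) \<partial>\<mu>)"
    unfolding L2_norm_sq_def by (intro nn_integral_mono pt)
  also have "\<dots> = I * (\<integral>\<^sup>+x. (\<integral>\<^sup>+y. ennreal (norm (f y)) * ennreal ((norm (g (x - y)))\<^sup>2) \<partial>\<mu>) \<partial>\<mu>)"
    by (rule nn_integral_cmult) measurable
  also have "(\<integral>\<^sup>+x. (\<integral>\<^sup>+y. ennreal (norm (f y)) * ennreal ((norm (g (x - y)))\<^sup>2) \<partial>\<mu>) \<partial>\<mu>) =
             (\<integral>\<^sup>+y. (\<integral>\<^sup>+x. ennreal (norm (f y)) * ennreal ((norm (g (x - y)))\<^sup>2) \<partial>\<mu>) \<partial>\<mu>)"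
    by (rule Fubini') measurable
  also have "\<dots> = (\<integral>\<^sup>+y. ennreal (norm (f y)) * L2_norm_sq \<mu> g \<partial>\<mu>)"
  proof (rule nn_integral_cong)
    fix y
    have "(\<integral>\<^sup>+x. ennreal (norm (f y)) * ennreal ((norm (g (x - y)))\<^sup>2) \<partial>\<mu>) =
      ennreal (norm (f y)) * (\<integral>\<^sup>+x. ennreal ((norm (g (x - y)))\<^sup>2) \<partial>\<mu>)"
      by (rule nn_integral_cmult) measurable
    also have "(\<integral>\<^sup>+x. ennreal ((norm (g (x - y)))\<^sup>2) \<partial>\<mu>) = L2_norm_sq \<mu> g"
      unfolding L2_norm_sq_def by (rule nn_integral_minus_left) measurable
    finally show "(\<integral>\<^sup>+x. ennreal (norm (f y)) * ennreal ((norm (g (x - y)))\<^sup>2) \<partial>\<mu>) =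
      ennreal (norm (f y)) * L2_norm_sq \<mu> g" .
  qed
  also have "\<dots> = I * L2_norm_sq \<mu> g"
    unfolding I_def by (rule nn_integral_multc) measurable
  finally show ?thesis by (simp add: I_def power2_eq_square mult.assoc)
qed

lemma conv_L1_L2:
  assumes f: "integrable \<mu> f" and g: "g \<in> L2 \<mu>"
  shows "conv \<mu> f g \<in> L2 \<mu>" "l2norm \<mu> (conv \<mu> f g) \<le> (LINT y|\<mu>. norm (f y)) * l2norm \<mu> g"
proof -
  have "(\<integral>\<^sup>+y. norm (f y) \<partial>\<mu>)\<^sup>2 * L2_norm_sq \<mu> g = ennreal (((LINT y|\<mu>. norm (f y)) * l2norm \<mu> g)\<^sup>2)"
    using f by (simp add: nn_integral_eq_integral L2_norm_sq_eq[OF g] ennreal_power power_mult_distrib ennreal_mult)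
  with Young_L1_L2[OF f g] have *: "L2_norm_sq \<mu> (conv \<mu> f g) \<le> ennreal (((LINT y|\<mu>. norm (f y)) * l2norm \<mu> g)\<^sup>2)"
    by simp
  then show L: "conv \<mu> f g \<in> L2 \<mu>"
    using f g by (auto simp: L2_iff le_less_trans)
  from * have "(l2norm \<mu> (conv \<mu> f g))\<^sup>2 \<le> ((LINT y|\<mu>. norm (f y)) * l2norm \<mu> g)\<^sup>2"
    by (simp add: L2_norm_sq_eq[OF L])
  then show "l2norm \<mu> (conv \<mu> f g) \<le> (LINT y|\<mu>. norm (f y)) * l2norm \<mu> g"
    by (rule power2_le_imp_le) simp
qed

lemma integrable_conv_pair:
  fixes f g :: "'a \<Rightarrow> complex"
  assumes f: "integrable \<mu> f" and g: "integrable \<mu> g"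
  shows "integrable (\<mu> \<Otimes>\<^sub>M \<mu>) (\<lambda>(x, y). f y * g (x - y))"
proof (rule integrableI_bounded)
  note [measurable] = borel_measurable_integrable[OF f] borel_measurable_integrable[OF g]
  show "(\<lambda>(x, y). f y * g (x - y)) \<in> borel_measurable (\<mu> \<Otimes>\<^sub>M \<mu>)" by measurable
  have "(\<integral>\<^sup>+z. ennreal (norm (case z of (x, y) \<Rightarrow> f y * g (x - y))) \<partial>(\<mu> \<Otimes>\<^sub>M \<mu>)) =
    (\<integral>\<^sup>+y. \<integral>\<^sup>+x. ennreal (norm (f y)) * ennreal (norm (g (x - y))) \<partial>\<mu> \<partial>\<mu>)"
    by (subst nn_integral_snd[symmetric]) (auto simp: norm_mult ennreal_mult case_prod_beta)
  also have "\<dots> = (\<integral>\<^sup>+y. ennreal (norm (f y)) * (\<integral>\<^sup>+x. ennreal (norm (g x)) \<partial>\<mu>) \<partial>\<mu>)"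
  proof (rule nn_integral_cong)
    fix y
    show "(\<integral>\<^sup>+x. ennreal (norm (f y)) * ennreal (norm (g (x - y))) \<partial>\<mu>) =
      ennreal (norm (f y)) * (\<integral>\<^sup>+x. ennreal (norm (g x)) \<partial>\<mu>)"
      using nn_integral_minus_left[of "\<lambda>x. ennreal (norm (g x))" y] by (simp add: nn_integral_cmult)
  qed
  also have "\<dots> = (\<integral>\<^sup>+y. ennreal (norm (f y)) \<partial>\<mu>) * (\<integral>\<^sup>+x. ennreal (norm (g x)) \<partial>\<mu>)"
    by (rule nn_integral_multc) measurable
  also have "\<dots> < \<infinity>"
    using f g by (simp add: integrable_iff_bounded ennreal_mult_less_top)
  finally show "(\<integral>\<^sup>+z. ennreal (norm (case z of (x, y) \<Rightarrow> f y * g (x - y))) \<partial>(\<mu> \<Otimes>\<^sub>M \<mu>)) < \<infinity>" .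
qed

lemma conv_integrable_L1:
  assumes "integrable \<mu> f" "integrable \<mu> g"
  shows "integrable \<mu> (conv \<mu> f g)"
  using integrable_fst[OF integrable_conv_pair[OF assms]] by (simp add: conv_def[abs_def])

text \<open>A character splits as \<open>\<xi> x = \<xi> y * \<xi> (x - y)\<close>, so after Fubini
  the inner integral is a translate of the transform of \<open>g\<close>.\<close>

lemma fourier_L1_conv:
  assumes f: "integrable \<mu> f" and g: "integrable \<mu> g" and \<xi>: "\<xi> \<in> characters"
  shows "fourier_L1 \<mu> (conv \<mu> f g) \<xi> = fourier_L1 \<mu> f \<xi> * fourier_L1 \<mu> g \<xi>"
proof -
  have [measurable]: "\<xi> \<in> borel_measurable \<mu>"
    using \<xi> borel_measurable_continuous_onI[of \<xi>] by (simp add: characters_def cong: measurable_cong_sets)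
  note [measurable] = borel_measurable_integrable[OF f] borel_measurable_integrable[OF g]
  have norm: "norm (\<xi> x) = 1" for x using \<xi> by (simp add: characters_def)
  have mult: "\<xi> x = \<xi> y * \<xi> (x - y)" for x y
  proof -
    have "\<xi> (y + (x - y)) = \<xi> y * \<xi> (x - y)" using \<xi> unfolding characters_def by blast
    then show ?thesis by simp
  qed
  have int: "integrable (\<mu> \<Otimes>\<^sub>M \<mu>) (\<lambda>(x, y). f y * g (x - y) * cnj (\<xi> x))"
  proof (rule Bochner_Integration.integrable_bound[OF integrable_conv_pair[OF f g]])
    show "(\<lambda>(x, y). f y * g (x - y) * cnj (\<xi> x)) \<in> borel_measurable (\<mu> \<Otimes>\<^sub>M \<mu>)" by measurable
  qed (auto simp: norm_mult norm)
  have "fourier_L1 \<mu> (conv \<mu> f g) \<xi> = (LINT x|\<mu>. LINT y|\<mu>. f y * g (x - y) * cnj (\<xi> x))"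
    unfolding fourier_L1_def conv_def by simp
  also have "\<dots> = (LINT y|\<mu>. LINT x|\<mu>. f y * g (x - y) * cnj (\<xi> x))"
    using Fubini_integral[OF int] by simp
  also have "\<dots> = (LINT y|\<mu>. f y * cnj (\<xi> y) * fourier_L1 \<mu> g \<xi>)"
  proof (rule Bochner_Integration.integral_cong[OF refl])
    fix y
    have "(LINT x|\<mu>. f y * g (x - y) * cnj (\<xi> x)) = (LINT x|\<mu>. f y * cnj (\<xi> y) * (g (x - y) * cnj (\<xi> (x - y))))"
      by (rule Bochner_Integration.integral_cong[OF refl]) (subst mult[of _ y], simp)
    also have "\<dots> = f y * cnj (\<xi> y) * (LINT x|\<mu>. g (x - y) * cnj (\<xi> (x - y)))"
      by simp
    also have "(LINT x|\<mu>. g (x - y) * cnj (\<xi> (x - y))) = fourier_L1 \<mu> g \<xi>"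
      unfolding fourier_L1_def by (rule integral_minus_left[of "\<lambda>x. g x * cnj (\<xi> x)"]) measurable
    finally show "(LINT x|\<mu>. f y * g (x - y) * cnj (\<xi> x)) = f y * cnj (\<xi> y) * fourier_L1 \<mu> g \<xi>" .
  qed
  also have "\<dots> = fourier_L1 \<mu> f \<xi> * fourier_L1 \<mu> g \<xi>"
    by (simp add: fourier_L1_def)
  finally show ?thesis .
qed

text \<open>On the unit circle the inverse is the conjugate, hence
  \<open>\<xi> (- x) = cnj (\<xi> x)\<close>; the rest is reflection invariance of the Haar
  integral.\<close>

lemma fourier_L1_involution:
  assumes f: "f \<in> borel_measurable \<mu>" and \<xi>: "\<xi> \<in> characters"
  shows "fourier_L1 \<mu> (involution f) \<xi> = cnj (fourier_L1 \<mu> f \<xi>)"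
proof -
  have [measurable]: "\<xi> \<in> borel_measurable \<mu>"
    using \<xi> borel_measurable_continuous_onI[of \<xi>] by (simp add: characters_def cong: measurable_cong_sets)
  note [measurable] = f
  have norm: "norm (\<xi> x) = 1" and mult: "\<xi> (x + y) = \<xi> x * \<xi> y" for x y 
    using \<xi> by (auto simp: characters_def)
  have "\<xi> 0 = 1" using mult[of 0 0] norm[of 0] by auto
  then have "\<xi> x * \<xi> (- x) = 1" for x using mult[of x "- x"] by simp
  then have inv: "\<xi> (- x) = cnj (\<xi> x)" for x
    using norm[of x] complex_norm_square[of "\<xi> x"]
    by (metis mult_cancel_left mult_zero_left norm_zero of_real_1 one_power2 zero_neq_one)
  have "fourier_L1 \<mu> (involution f) \<xi> = (LINT x|\<mu>. cnj (f (- x) * cnj (\<xi> (- x))))"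
    unfolding fourier_L1_def involution_def by (simp add: inv)
  also have "\<dots> = cnj (LINT x|\<mu>. f (- x) * cnj (\<xi> (- x)))"
    by (rule Bochner_Integration.integral_cnj)
  also have "(LINT x|\<mu>. f (- x) * cnj (\<xi> (- x))) = (LINT x|\<mu>. f x * cnj (\<xi> x))"
    by (rule integral_uminus[of "\<lambda>x. f x * cnj (\<xi> x)"]) measurable
  finally show ?thesis by (simp add: fourier_L1_def)
qed

end

section \<open>The Fourier transform on square-integrable functions\<close>

lemma topspace_dual [simp]: "topspace (dual_topology :: ('a::topological_ab_group_add \<Rightarrow> complex) topology) = characters"
proof -
  \<comment> \<open>The subbasic set with empty \<open>K\<close> is the whole dual group.\<close>
  have "characters \<in> {{\<xi> \<in> characters. \<xi> ` K \<subseteq> U} | (K::'a set) U. compact K \<and> open U}"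
    by (rule CollectI, rule exI[of _ "{}"], rule exI[of _ UNIV]) auto
  then show ?thesis unfolding dual_topology_def by auto
qed

text \<open>Subbasic sets control a character on one compact set by one open target. Cutting
  \<open>K\<close> into finitely many compact pieces on which \<xi>0 is nearly constant turns this
  into uniform closeness on \<open>K\<close>.\<close>

lemma dual_topology_uniform_nbhd:
  fixes K :: "'a::topological_ab_group_add set"
  assumes K: "compact K" and \<xi>0: "\<xi>0 \<in> characters" and d: "d > 0"
  obtains N where "openin dual_topology N" "\<xi>0 \<in> N" "\<And>\<xi> x. \<xi> \<in> N \<Longrightarrow> x \<in> K \<Longrightarrow> norm (\<xi> x - \<xi>0 x) < d"
proof -
  have cont: "continuous_on UNIV \<xi>0" using \<xi>0 by (simp add: characters_def)
  then have "compact (\<xi>0 ` K)" by (intro compact_continuous_image K) (auto intro: continuous_on_subset)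
  moreover have "\<xi>0 ` K \<subseteq> (\<Union>z\<in>UNIV. ball z (d/3))"
  proof
    fix y assume "y \<in> \<xi>0 ` K"
    show "y \<in> (\<Union>z\<in>UNIV. ball z (d/3))" using d by (intro UN_I[of y]) auto
  qed
  ultimately obtain Z where Z: "finite Z" "\<xi>0 ` K \<subseteq> (\<Union>z\<in>Z. ball z (d/3))"
    using compactE_image[of "\<xi>0 ` K" UNIV "\<lambda>z. ball z (d/3)"] by auto
  \<comment> \<open>The piece of \<open>K\<close> on which \<xi>0 stays within d/3 of
    \<open>z\<close>. Members of \<open>N\<close> stay within d/2 of \<open>z\<close> there, and d/2
    + d/3 < d.\<close>
  define C where "C z = K \<inter> \<xi>0 -` cball z (d/3)" for z
  have C: "compact (C z)" for z
    unfolding C_def using cont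
    by (intro compact_Int_closed K closed_vimage) auto
  \<comment> \<open>The intersection with \<open>topspace\<close> confines \<open>N\<close> to
    characters even if \<open>Z\<close> is empty.\<close>
  define N where "N = (\<Inter>z\<in>Z. {\<xi> \<in> characters. \<xi> ` C z \<subseteq> ball z (d/2)}) \<inter> topspace dual_topology"
  show ?thesis
  proof
    show "openin dual_topology N"
      unfolding N_def
    proof (rule openin_INT[OF Z(1)])
      fix z assume "z \<in> Z"
      show "openin dual_topology {\<xi> \<in> characters. \<xi> ` C z \<subseteq> ball z (d/2)}"
        unfolding dual_topology_def by (rule topology_generated_by_Basis) (use C in blast)
    qed
    show "\<xi>0 \<in> N" using \<xi>0 d by (auto simp: N_def C_def)
    fix \<xi> x assume \<xi>: "\<xi> \<in> N" and x: "x \<in> K"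
    obtain z where z: "z \<in> Z" "\<xi>0 x \<in> ball z (d/3)" using Z(2) x by auto
    then have "x \<in> C z" using x by (auto simp: C_def)
    moreover have "\<xi> ` C z \<subseteq> ball z (d/2)" using \<xi> z(1) by (auto simp: N_def)
    ultimately have "\<xi> x \<in> ball z (d/2)" by blast
    then have "dist (\<xi> x) (\<xi>0 x) < d/2 + d/3"
      using z(2) dist_triangle2[of "\<xi> x" "\<xi>0 x" z] by (simp add: dist_commute)
    then show "norm (\<xi> x - \<xi>0 x) < d" using d by (simp add: dist_norm)
  qed
qed

locale haar_dual = haar_group \<mu>
  for \<mu> :: "'a::{topological_ab_group_add, t2_space, second_countable_topology} measure" +
  fixes \<nu> :: "('a \<Rightarrow> complex) measure"
  assumes haar_dual: "haar_measure dual_topology dual_mult \<nu>"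
    and plancherel: "plancherel_normalized \<mu> \<nu>"
begin

lemma space_dual [simp]: "space \<nu> = characters"
  using haar_dual by (simp add: haar_measure_def)

lemma openin_dual_sets: "openin dual_topology U \<Longrightarrow> U \<in> sets \<nu>"
  using haar_dual by (auto simp: haar_measure_def)

lemma character_measurable: "\<xi> \<in> characters \<Longrightarrow> \<xi> \<in> borel_measurable \<mu>"
  using borel_measurable_continuous_onI[of \<xi>] by (simp add: characters_def cong: measurable_cong_sets)

lemma integrable_character:
  assumes "integrable \<mu> f" "\<xi> \<in> characters"
  shows "integrable \<mu> (\<lambda>x. f x * cnj (\<xi> x))"
proof (rule Bochner_Integration.integrable_bound[OF assms(1)])
  show "(\<lambda>x. f x * cnj (\<xi> x)) \<in> borel_measurable \<mu>"
    using character_measurable[OF assms(2)] borel_measurable_integrable[OF assms(1)] by measurable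
  show "AE x in \<mu>. norm (f x * cnj (\<xi> x)) \<le> norm (f x)"
    using assms(2) by (simp add: characters_def norm_mult)
qed

lemma norm_fourier_L1_le:
  assumes "integrable \<mu> f" "\<xi> \<in> characters"
  shows "norm (fourier_L1 \<mu> f \<xi>) \<le> (LINT x|\<mu>. norm (f x))"
proof -
  have "norm (fourier_L1 \<mu> f \<xi>) \<le> (LINT x|\<mu>. norm (f x * cnj (\<xi> x)))"
    unfolding fourier_L1_def by (rule integral_norm_bound)
  also have "\<dots> = (LINT x|\<mu>. norm (f x))"
    using assms(2) by (simp add: characters_def norm_mult)
  finally show ?thesis .
qed

text \<open>For compact support the transform is continuous on the dual: characters uniformly close
  on \<open>K\<close> give integrals that differ by at most d times the L1 norm. Continuity gives
  measurability, as open sets are measurable.\<close>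

lemma fourier_L1_measurable_compact_support:
  assumes f: "integrable \<mu> f" and K: "compact K" and supp: "\<And>x. x \<notin> K \<Longrightarrow> f x = 0"
  shows "fourier_L1 \<mu> f \<in> borel_measurable \<nu>"
proof (rule borel_measurableI)
  fix S :: "complex set" assume S: "open S"
  define B where "B = (LINT x|\<mu>. norm (f x))"
  have B: "B \<ge> 0" by (simp add: B_def)
  have "openin dual_topology (fourier_L1 \<mu> f -` S \<inter> characters)"
  proof (subst openin_subopen, intro ballI)
    fix \<xi>0 assume \<xi>0: "\<xi>0 \<in> fourier_L1 \<mu> f -` S \<inter> characters"
    then obtain e where e: "e > 0" "ball (fourier_L1 \<mu> f \<xi>0) e \<subseteq> S"
      using S by (auto simp: open_contains_ball)
    \<comment> \<open>Adding 1 to \<open>B\<close> covers the case of a vanishing L1 norm.\<close>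
    define d where "d = e / (B + 1)"
    have d: "d > 0" "d * B < e" using e B by (auto simp: d_def field_simps)
    obtain N where N: "openin dual_topology N" "\<xi>0 \<in> N" "\<And>\<xi> x. \<xi> \<in> N \<Longrightarrow> x \<in> K \<Longrightarrow> norm (\<xi> x - \<xi>0 x) < d"
      using dual_topology_uniform_nbhd[OF K _ d(1), of \<xi>0] \<xi>0 by blast
    have "fourier_L1 \<mu> f \<xi> \<in> S" if \<xi>: "\<xi> \<in> N" for \<xi>
    proof -
      have ch: "\<xi> \<in> characters" "\<xi>0 \<in> characters"
        using openin_subset[OF N(1)] \<xi> \<xi>0 by auto
      have "fourier_L1 \<mu> f \<xi> - fourier_L1 \<mu> f \<xi>0 = (LINT x|\<mu>. f x * cnj (\<xi> x) - f x * cnj (\<xi>0 x))"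
        unfolding fourier_L1_def
        by (rule Bochner_Integration.integral_diff[symmetric]) (intro integrable_character f ch)+
      then have "norm (fourier_L1 \<mu> f \<xi> - fourier_L1 \<mu> f \<xi>0) \<le> (LINT x|\<mu>. norm (f x * cnj (\<xi> x) - f x * cnj (\<xi>0 x)))"
        by (simp only: integral_norm_bound)
      also have "\<dots> \<le> (LINT x|\<mu>. d * norm (f x))"
      proof (rule integral_mono)
        show "integrable \<mu> (\<lambda>x. norm (f x * cnj (\<xi> x) - f x * cnj (\<xi>0 x)))"
          by (intro integrable_norm Bochner_Integration.integrable_diff integrable_character f ch)
        show "integrable \<mu> (\<lambda>x. d * norm (f x))" using f by auto
        fix x
        have "norm (f x * cnj (\<xi> x) - f x * cnj (\<xi>0 x)) = norm (f x) * norm (\<xi> x - \<xi>0 x)"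
          by (metis complex_cnj_diff complex_mod_cnj norm_mult right_diff_distrib)
        also have "\<dots> \<le> norm (f x) * d"
        proof (cases "x \<in> K")
          case True
          then show ?thesis using N(3)[OF \<xi>] by (intro mult_left_mono) (auto intro: less_imp_le)
        next
          case False
          then show ?thesis using supp by simp
        qed
        finally show "norm (f x * cnj (\<xi> x) - f x * cnj (\<xi>0 x)) \<le> d * norm (f x)"
          by (simp add: mult.commute)
      qed
      also have "\<dots> = d * B" by (simp add: B_def)
      finally have "fourier_L1 \<mu> f \<xi> \<in> ball (fourier_L1 \<mu> f \<xi>0) e"
        using d(2) by (simp add: dist_norm norm_minus_commute)
      then show ?thesis using e(2) by blast
    qed
    then show "\<exists>T. openin dual_topology T \<and> \<xi>0 \<in> T \<and> T \<subseteq> fourier_L1 \<mu> f -` S \<inter> characters"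
      using N(1,2) openin_subset[OF N(1)] by (intro exI[of _ N]) auto
  qed
  then show "fourier_L1 \<mu> f -` S \<inter> space \<nu> \<in> sets \<nu>"
    by (simp add: openin_dual_sets)
qed

text \<open>Pointwise limit of the compactly supported case along a compact exhaustion, by dominated
  convergence for each fixed character.\<close>

lemma fourier_L1_measurable:
  assumes f: "integrable \<mu> f"
  shows "fourier_L1 \<mu> f \<in> borel_measurable \<nu>"
proof -
  obtain K :: "nat \<Rightarrow> 'a set" where K: "\<And>n. compact (K n)" "incseq K" "(\<Union>n. K n) = UNIV"
    using compact_exhaustion by blast
  define h where "h n x = indicator (K n) x * f x" for n x
  have [measurable]: "K n \<in> sets \<mu>" for n using K(1) by (simp add: compact_imp_closed)
  note [measurable] = borel_measurable_integrable[OF f]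
  have [measurable]: "h n \<in> borel_measurable \<mu>" for n unfolding h_def by measurable
  have h: "integrable \<mu> (h n)" for n
    by (rule Bochner_Integration.integrable_bound[OF f]) (auto simp: h_def indicator_def)
  show ?thesis
  proof (rule borel_measurable_LIMSEQ_metric)
    show "fourier_L1 \<mu> (h n) \<in> borel_measurable \<nu>" for n
      by (rule fourier_L1_measurable_compact_support[OF h K(1)[of n]]) (simp add: h_def)
    fix \<xi> assume "\<xi> \<in> space \<nu>"
    then have \<xi>: "\<xi> \<in> characters" by simp
    note [measurable] = character_measurable[OF \<xi>]
    show "(\<lambda>n. fourier_L1 \<mu> (h n) \<xi>) \<longlonglongrightarrow> fourier_L1 \<mu> f \<xi>"
      unfolding fourier_L1_def
    proof (rule integral_dominated_convergence)
      show "integrable \<mu> (\<lambda>x. norm (f x))" using f by auto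
      show "AE x in \<mu>. norm (h n x * cnj (\<xi> x)) \<le> norm (f x)" for n
        using \<xi> by (auto simp: h_def indicator_def characters_def norm_mult)
      show "(\<lambda>x. h n x * cnj (\<xi> x)) \<in> borel_measurable \<mu>" for n
        unfolding h_def by measurable
      show "AE x in \<mu>. (\<lambda>n. h n x * cnj (\<xi> x)) \<longlonglongrightarrow> f x * cnj (\<xi> x)"
      proof (rule AE_I2)
        fix x
        have "(\<lambda>n. indicator (K n) x :: complex) \<longlonglongrightarrow> indicator (\<Union>n. K n) x"
          by (rule LIMSEQ_indicator_incseq[OF K(2)])
        then have "(\<lambda>n. indicator (K n) x * f x * cnj (\<xi> x)) \<longlonglongrightarrow> 1 * f x * cnj (\<xi> x)"
          unfolding K(3) by (intro tendsto_intros) simp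
        then show "(\<lambda>n. h n x * cnj (\<xi> x)) \<longlonglongrightarrow> f x * cnj (\<xi> x)" by (simp add: h_def)
      qed
    qed measurable
  qed
qed

section \<open>Plancherel and the extension from L1 to L2\<close>

lemma fourier_L1_L2:
  assumes "f \<in> L2 \<mu>" "integrable \<mu> f"
  shows "fourier_L1 \<mu> f \<in> L2 \<nu>" "l2norm \<nu> (fourier_L1 \<mu> f) = l2norm \<mu> f"
proof -
  have "L2_norm_sq \<nu> (fourier_L1 \<mu> f) = L2_norm_sq \<mu> f"
    using plancherel assms by (simp add: plancherel_normalized_def)
  then show "fourier_L1 \<mu> f \<in> L2 \<nu>" "l2norm \<nu> (fourier_L1 \<mu> f) = l2norm \<mu> f"
    using assms fourier_L1_measurable by (simp_all add: L2_iff l2norm_def)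
qed

lemma fourier_L1_add:
  assumes "integrable \<mu> f" "integrable \<mu> g" "\<xi> \<in> characters"
  shows "fourier_L1 \<mu> (\<lambda>x. f x + g x) \<xi> = fourier_L1 \<mu> f \<xi> + fourier_L1 \<mu> g \<xi>"
  unfolding fourier_L1_def distrib_right
  by (intro Bochner_Integration.integral_add integrable_character assms)

lemma fourier_L1_scale: "fourier_L1 \<mu> (\<lambda>x. c * f x) \<xi> = c * fourier_L1 \<mu> f \<xi>"
  unfolding fourier_L1_def by (simp add: mult.assoc)

text \<open>A relation instead of the chosen representative \<open>fourier_L2\<close>:
  representatives of sums and limits agree only almost everywhere, while the relation is stable
  under sums, scalars, limits and changes on null sets.\<close>

definition ft :: "('a \<Rightarrow> complex) \<Rightarrow> (('a \<Rightarrow> complex) \<Rightarrow> complex) \<Rightarrow> bool" where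
  "ft f g \<longleftrightarrow> f \<in> L2 \<mu> \<and> is_fourier_L2 \<mu> \<nu> f g"

lemma ft_L2: assumes "ft f g" shows "f \<in> L2 \<mu>" "g \<in> L2 \<nu>"
  using assms by (auto simp: ft_def is_fourier_L2_def)

lemma ftI:
  assumes "f \<in> L2 \<mu>" "g \<in> L2 \<nu>" "\<And>n. h n \<in> L2 \<mu>" "\<And>n. integrable \<mu> (h n)"
    "l2_tendsto \<mu> h f" "l2_tendsto \<nu> (\<lambda>n. fourier_L1 \<mu> (h n)) g"
  shows "ft f g"
  unfolding ft_def is_fourier_L2_def
  using assms(1,2)
  by (intro conjI exI[of _ h] allI assms(1-4))
     (simp_all add: L2_norm_tendsto_0_iff[OF assms(3,1)] assms(5)
        L2_norm_tendsto_0_iff[OF fourier_L1_L2(1)[OF assms(3,4)] assms(2)] assms(6))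

lemma ftE:
  assumes "ft f g"
  obtains h where "\<And>n. h n \<in> L2 \<mu>" "\<And>n. integrable \<mu> (h n)"
    "l2_tendsto \<mu> h f" "l2_tendsto \<nu> (\<lambda>n. fourier_L1 \<mu> (h n)) g"
proof -
  obtain h where h: "\<And>n. h n \<in> L2 \<mu>" "\<And>n. integrable \<mu> (h n)"
    "(\<lambda>n. L2_norm \<mu> (\<lambda>x. h n x - f x)) \<longlonglongrightarrow> 0"
    "(\<lambda>n. L2_norm \<nu> (\<lambda>\<xi>. fourier_L1 \<mu> (h n) \<xi> - g \<xi>)) \<longlonglongrightarrow> 0"
    using assms unfolding ft_def is_fourier_L2_def by blast
  show ?thesis
    by (rule that[OF h(1,2)])
       (use h(3,4) in \<open>simp_all add: L2_norm_tendsto_0_iff[OF h(1) ft_L2(1)[OF assms]]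
          L2_norm_tendsto_0_iff[OF fourier_L1_L2(1)[OF h(1,2)] ft_L2(2)[OF assms]]\<close>)
qed

lemma ft_norm: assumes "ft f g" shows "l2norm \<nu> g = l2norm \<mu> f"
proof -
  obtain h where h: "\<And>n. h n \<in> L2 \<mu>" "\<And>n. integrable \<mu> (h n)"
    "l2_tendsto \<mu> h f" "l2_tendsto \<nu> (\<lambda>n. fourier_L1 \<mu> (h n)) g"
    using ftE[OF assms] by blast
  have "(\<lambda>n. l2norm \<nu> (fourier_L1 \<mu> (h n))) \<longlonglongrightarrow> l2norm \<nu> g"
    by (rule l2_tendsto_norm[OF fourier_L1_L2(1)[OF h(1,2)] ft_L2(2)[OF assms] h(4)])
  moreover have "(\<lambda>n. l2norm \<nu> (fourier_L1 \<mu> (h n))) \<longlonglongrightarrow> l2norm \<mu> f"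
    using l2_tendsto_norm[OF h(1) ft_L2(1)[OF assms] h(3)] by (simp add: fourier_L1_L2(2)[OF h(1,2)])
  ultimately show ?thesis by (rule LIMSEQ_unique)
qed

lemma ft_norm_sq: assumes "ft f g" shows "L2_norm_sq \<nu> g = L2_norm_sq \<mu> f"
  using ft_norm[OF assms] ft_L2[OF assms] by (simp add: L2_norm_sq_eq)

lemma ft_L1: assumes "f \<in> L2 \<mu>" "integrable \<mu> f" shows "ft f (fourier_L1 \<mu> f)"
  by (rule ftI[where h="\<lambda>_. f"]) (use assms fourier_L1_L2 in \<open>simp_all add: l2_tendsto_def l2norm_def L2_norm_sq_def\<close>)

lemma ft_add:
  assumes "ft f g" "ft f' g'"
  shows "ft (\<lambda>x. f x + f' x) (\<lambda>\<xi>. g \<xi> + g' \<xi>)"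
proof -
  note L = ft_L2[OF assms(1)] ft_L2[OF assms(2)]
  obtain h where h: "\<And>n. h n \<in> L2 \<mu>" "\<And>n. integrable \<mu> (h n)"
    "l2_tendsto \<mu> h f" "l2_tendsto \<nu> (\<lambda>n. fourier_L1 \<mu> (h n)) g"
    using ftE[OF assms(1)] by blast
  obtain h' where h': "\<And>n. h' n \<in> L2 \<mu>" "\<And>n. integrable \<mu> (h' n)"
    "l2_tendsto \<mu> h' f'" "l2_tendsto \<nu> (\<lambda>n. fourier_L1 \<mu> (h' n)) g'"
    using ftE[OF assms(2)] by blast
  show ?thesis
  proof (rule ftI[where h="\<lambda>n x. h n x + h' n x"])
    show "l2_tendsto \<mu> (\<lambda>n x. h n x + h' n x) (\<lambda>x. f x + f' x)"
      by (rule l2_tendsto_add[OF h(1) L(1) h(3) h'(1) L(3) h'(3)])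
    have "l2_tendsto \<nu> (\<lambda>n \<xi>. fourier_L1 \<mu> (h n) \<xi> + fourier_L1 \<mu> (h' n) \<xi>) (\<lambda>\<xi>. g \<xi> + g' \<xi>)"
      by (rule l2_tendsto_add[OF fourier_L1_L2(1)[OF h(1,2)] L(2) h(4) fourier_L1_L2(1)[OF h'(1,2)] L(4) h'(4)])
    moreover have "l2norm \<nu> (\<lambda>\<xi>. fourier_L1 \<mu> (\<lambda>x. h n x + h' n x) \<xi> - (g \<xi> + g' \<xi>)) =
       l2norm \<nu> (\<lambda>\<xi>. fourier_L1 \<mu> (h n) \<xi> + fourier_L1 \<mu> (h' n) \<xi> - (g \<xi> + g' \<xi>))" for n
      by (rule l2norm_cong) (simp add: fourier_L1_add h h')
    ultimately show "l2_tendsto \<nu> (\<lambda>n. fourier_L1 \<mu> (\<lambda>x. h n x + h' n x)) (\<lambda>\<xi>. g \<xi> + g' \<xi>)"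
      by (simp add: l2_tendsto_def)
  qed (auto intro: L2_add L h h')
qed

lemma ft_scale:
  assumes "ft f g"
  shows "ft (\<lambda>x. c * f x) (\<lambda>\<xi>. c * g \<xi>)"
proof -
  note L = ft_L2[OF assms]
  obtain h where h: "\<And>n. h n \<in> L2 \<mu>" "\<And>n. integrable \<mu> (h n)"
    "l2_tendsto \<mu> h f" "l2_tendsto \<nu> (\<lambda>n. fourier_L1 \<mu> (h n)) g"
    using ftE[OF assms] by blast
  show ?thesis
  proof (rule ftI[where h="\<lambda>n x. c * h n x"])
    show "l2_tendsto \<mu> (\<lambda>n x. c * h n x) (\<lambda>x. c * f x)"
      by (rule l2_tendsto_scale[OF h(1) L(1) h(3)])
    have "l2_tendsto \<nu> (\<lambda>n \<xi>. c * fourier_L1 \<mu> (h n) \<xi>) (\<lambda>\<xi>. c * g \<xi>)"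
      by (rule l2_tendsto_scale[OF fourier_L1_L2(1)[OF h(1,2)] L(2) h(4)])
    then show "l2_tendsto \<nu> (\<lambda>n. fourier_L1 \<mu> (\<lambda>x. c * h n x)) (\<lambda>\<xi>. c * g \<xi>)"
      by (simp add: l2_tendsto_def fourier_L1_scale)
  qed (auto intro: L2_scale L h)
qed

lemma ft_diff: "ft f g \<Longrightarrow> ft f' g' \<Longrightarrow> ft (\<lambda>x. f x - f' x) (\<lambda>\<xi>. g \<xi> - g' \<xi>)"
  using ft_add[of f g "\<lambda>x. (-1) * f' x" "\<lambda>\<xi>. (-1) * g' \<xi>"] ft_scale[of f' g' "-1"] by simp

lemma ft_cong_AE:
  assumes "ft f g" "f' \<in> borel_measurable \<mu>" "g' \<in> borel_measurable \<nu>"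
    "AE x in \<mu>. f x = f' x" "AE \<xi> in \<nu>. g \<xi> = g' \<xi>"
  shows "ft f' g'"
proof -
  note L = ft_L2[OF assms(1)]
  have f': "f' \<in> L2 \<mu>" by (rule L2_dominated[OF L(1) assms(2)]) (use assms(4) in auto)
  have g': "g' \<in> L2 \<nu>" by (rule L2_dominated[OF L(2) assms(3)]) (use assms(5) in auto)
  obtain h where h: "\<And>n. h n \<in> L2 \<mu>" "\<And>n. integrable \<mu> (h n)"
    "l2_tendsto \<mu> h f" "l2_tendsto \<nu> (\<lambda>n. fourier_L1 \<mu> (h n)) g"
    using ftE[OF assms(1)] by blast
  show ?thesis
    by (rule ftI[OF f' g' h(1,2)])
       (use h(3,4) l2_tendsto_AE_cong[OF assms(4)] l2_tendsto_AE_cong[OF assms(5)] in auto)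
qed

text \<open>Diagonal argument: for each \<open>n\<close> pick an integrable approximant that is
  within 1 / (n + 1) of \<open>f n\<close> and whose transform is equally close to
  \<open>g n\<close>.\<close>

lemma ft_closed:
  assumes ft: "\<And>n. ft (f n) (g n)" and f: "f' \<in> L2 \<mu>" "l2_tendsto \<mu> f f'"
    and g: "g' \<in> L2 \<nu>" "l2_tendsto \<nu> g g'"
  shows "ft f' g'"
proof -
  note fL = ft_L2(1)[OF ft] and gL = ft_L2(2)[OF ft]
  have "\<exists>h. h \<in> L2 \<mu> \<and> integrable \<mu> h \<and> l2norm \<mu> (\<lambda>x. h x - f n x) < inverse (real (Suc n)) \<and>
      l2norm \<nu> (\<lambda>\<xi>. fourier_L1 \<mu> h \<xi> - g n \<xi>) < inverse (real (Suc n))" for n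
  proof -
    obtain h where h: "\<And>k. h k \<in> L2 \<mu>" "\<And>k. integrable \<mu> (h k)"
      "l2_tendsto \<mu> h (f n)" "l2_tendsto \<nu> (\<lambda>k. fourier_L1 \<mu> (h k)) (g n)"
      using ftE[OF ft[of n]] by blast
    have "eventually (\<lambda>k. l2norm \<mu> (\<lambda>x. h k x - f n x) < inverse (real (Suc n)) \<and>
      l2norm \<nu> (\<lambda>\<xi>. fourier_L1 \<mu> (h k) \<xi> - g n \<xi>) < inverse (real (Suc n))) sequentially"
      using h(3,4) unfolding l2_tendsto_def
      by (intro eventually_conj order_tendstoD(2)) auto
    then obtain k where "l2norm \<mu> (\<lambda>x. h k x - f n x) < inverse (real (Suc n)) \<and>
      l2norm \<nu> (\<lambda>\<xi>. fourier_L1 \<mu> (h k) \<xi> - g n \<xi>) < inverse (real (Suc n))"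
      by (auto simp: eventually_sequentially)
    then show ?thesis using h(1,2) by blast
  qed
  then obtain h where h: "\<And>n. h n \<in> L2 \<mu>" "\<And>n. integrable \<mu> (h n)"
    "\<And>n. l2norm \<mu> (\<lambda>x. h n x - f n x) < inverse (real (Suc n))"
    "\<And>n. l2norm \<nu> (\<lambda>\<xi>. fourier_L1 \<mu> (h n) \<xi> - g n \<xi>) < inverse (real (Suc n))"
    by metis
  note hL = fourier_L1_L2(1)[OF h(1,2)]
  show ?thesis
  proof (rule ftI[OF f(1) g(1) h(1,2)])
    have lim: "(\<lambda>n. inverse (real (Suc n)) + l2norm \<mu> (\<lambda>x. f n x - f' x)) \<longlonglongrightarrow> 0"
      using f(2) LIMSEQ_inverse_real_of_nat unfolding l2_tendsto_def by (intro tendsto_add_zero)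
    have "norm (l2norm \<mu> (\<lambda>x. h n x - f' x)) \<le> inverse (real (Suc n)) + l2norm \<mu> (\<lambda>x. f n x - f' x)" for n
      using l2norm_triangle_diff[OF h(1) fL f(1), of n n] h(3)[of n] by simp
    then show "l2_tendsto \<mu> h f'"
      unfolding l2_tendsto_def by (intro Lim_null_comparison[OF _ lim]) auto
    have lim: "(\<lambda>n. inverse (real (Suc n)) + l2norm \<nu> (\<lambda>x. g n x - g' x)) \<longlonglongrightarrow> 0"
      using g(2) LIMSEQ_inverse_real_of_nat unfolding l2_tendsto_def by (intro tendsto_add_zero)
    have "norm (l2norm \<nu> (\<lambda>x. fourier_L1 \<mu> (h n) x - g' x)) \<le> inverse (real (Suc n)) + l2norm \<nu> (\<lambda>x. g n x - g' x)" for n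
      using l2norm_triangle_diff[OF hL gL g(1), of n n] h(4)[of n] by simp
    then show "l2_tendsto \<nu> (\<lambda>n. fourier_L1 \<mu> (h n)) g'"
      unfolding l2_tendsto_def by (intro Lim_null_comparison[OF _ lim]) auto
  qed
qed

text \<open>The isometry reflects Cauchy sequences, so convergence of the transforms forces
  convergence of the signals. Completeness of \<open>L2_space F\<close> then provides a limit with
  values in \<open>F\<close>; functions with a prescribed transform are built in this way.\<close>

lemma ft_preimage_limit:
  assumes ft: "\<And>n. ft (f n) (g n)" and fF: "\<And>n. f n \<in> L2_space F \<mu>" and F: "closed F" "0 \<in> F"
    and g: "g' \<in> L2 \<nu>" "l2_tendsto \<nu> g g'"
  obtains f' where "f' \<in> L2_space F \<mu>" "ft f' g'" "l2_tendsto \<mu> f f'"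
proof -
  have cau: "\<exists>N. \<forall>m\<ge>N. \<forall>n\<ge>N. l2norm \<mu> (\<lambda>x. f m x - f n x) < e" if "e > 0" for e
    using l2_tendsto_Cauchy[OF ft_L2(2)[OF ft] g that] by (simp add: ft_norm[OF ft_diff[OF ft ft]])
  obtain f' where f': "f' \<in> L2_space F \<mu>" "l2_tendsto \<mu> f f'"
    using L2_complete[where f=f, OF fF F cau] by blast
  then have "ft f' g'" by (intro ft_closed[OF ft _ _ g] L2_space_subset)
  then show ?thesis using f' that by blast
qed

lemma ft_exists:
  assumes f: "f \<in> L2 \<mu>"
  obtains g where "ft f g"
proof -
  obtain h where h: "\<And>n. h n \<in> L2 \<mu>" "\<And>n. integrable \<mu> (h n)" "l2_tendsto \<mu> h f"
    using L2_truncation[OF f] by blast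
  note ft = ft_L1[OF h(1,2)]
  have cau: "\<exists>N. \<forall>m\<ge>N. \<forall>n\<ge>N. l2norm \<nu> (\<lambda>x. fourier_L1 \<mu> (h m) x - fourier_L1 \<mu> (h n) x) < e" if "e > 0" for e
    using l2_tendsto_Cauchy[OF h(1) f h(3) that] by (simp add: ft_norm[OF ft_diff[OF ft ft]])
  obtain g where "g \<in> L2 \<nu>" "l2_tendsto \<nu> (\<lambda>n. fourier_L1 \<mu> (h n)) g"
    using L2_complete[where f="\<lambda>n. fourier_L1 \<mu> (h n)", OF fourier_L1_L2(1)[OF h(1,2)] closed_UNIV UNIV_I cau]
    by blast
  then show ?thesis using ft_closed[OF ft f h(3)] that by blast
qed

lemma ft_fourier_L2:
  assumes "f \<in> L2 \<mu>"
  shows "ft f (fourier_L2 \<mu> \<nu> f)"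
proof -
  obtain g where "ft f g" using ft_exists[OF assms] by blast
  then have "is_fourier_L2 \<mu> \<nu> f (fourier_L2 \<mu> \<nu> f)"
    unfolding ft_def fourier_L2_def by (metis someI)
  with assms show ?thesis by (simp add: ft_def)
qed

text \<open>For integrable \<open>f\<close>, Young's inequality bounds convolution on the group and
  the L1 norm of \<open>f\<close> bounds multiplication on the dual, so the identity for integrable
  functions extends by approximating \<open>g\<close>.\<close>

lemma ft_conv_L1:
  assumes f: "f \<in> L2 \<mu>" "integrable \<mu> f" and ft: "ft g k"
  shows "ft (conv \<mu> f g) (\<lambda>\<xi>. fourier_L1 \<mu> f \<xi> * k \<xi>)"
proof -
  note L = ft_L2[OF ft]
  define B where "B = (LINT x|\<mu>. norm (f x))"
  note [measurable] = fourier_L1_measurable[OF f(2)]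
  have bd: "AE \<xi> in \<nu>. norm (fourier_L1 \<mu> f \<xi>) \<le> B"
    using norm_fourier_L1_le[OF f(2)] by (auto simp: B_def)
  obtain h where h: "\<And>n. h n \<in> L2 \<mu>" "\<And>n. integrable \<mu> (h n)"
    "l2_tendsto \<mu> h g" "l2_tendsto \<nu> (\<lambda>n. fourier_L1 \<mu> (h n)) k"
    using ftE[OF ft] by blast
  note hL = fourier_L1_L2(1)[OF h(1,2)]
  show ?thesis
  proof (rule ftI)
    show "conv \<mu> f g \<in> L2 \<mu>" by (rule conv_L1_L2(1)[OF f(2) L(1)])
    show "(\<lambda>\<xi>. fourier_L1 \<mu> f \<xi> * k \<xi>) \<in> L2 \<nu>"
      using L2_mult_bounded[OF L(2) _ bd] by (simp add: mult.commute)
    show "conv \<mu> f (h n) \<in> L2 \<mu>" for n by (rule conv_L1_L2(1)[OF f(2) h(1)])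
    show "integrable \<mu> (conv \<mu> f (h n))" for n by (rule conv_integrable_L1[OF f(2) h(2)])
    show "l2_tendsto \<mu> (\<lambda>n. conv \<mu> f (h n)) (conv \<mu> f g)"
    proof (rule l2_tendsto_comparison[OF _ h(3)])
      fix n
      have "(\<lambda>x. conv \<mu> f (h n) x - conv \<mu> f g x) = conv \<mu> f (\<lambda>x. h n x - g x)"
        by (simp add: fun_eq_iff conv_diff_right[OF f(1) h(1) L(1)])
      then show "l2norm \<mu> (\<lambda>x. conv \<mu> f (h n) x - conv \<mu> f g x) \<le> B * l2norm \<mu> (\<lambda>x. h n x - g x)"
        using conv_L1_L2(2)[OF f(2) L2_diff[OF h(1) L(1)], of n] by (simp add: B_def)
    qed
    show "l2_tendsto \<nu> (\<lambda>n. fourier_L1 \<mu> (conv \<mu> f (h n))) (\<lambda>\<xi>. fourier_L1 \<mu> f \<xi> * k \<xi>)"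
    proof (rule l2_tendsto_comparison[OF _ h(4)])
      fix n
      have d: "(\<lambda>\<xi>. fourier_L1 \<mu> (h n) \<xi> - k \<xi>) \<in> L2 \<nu>" by (rule L2_diff[OF hL L(2)])
      have B: "B \<ge> 0" by (simp add: B_def)
      have "l2norm \<nu> (\<lambda>\<xi>. fourier_L1 \<mu> (conv \<mu> f (h n)) \<xi> - fourier_L1 \<mu> f \<xi> * k \<xi>) \<le>
        l2norm \<nu> (\<lambda>\<xi>. of_real B * (fourier_L1 \<mu> (h n) \<xi> - k \<xi>))"
      proof (rule l2norm_mono_AE[OF L2_scale[OF d]], rule AE_I2)
        fix \<xi> assume "\<xi> \<in> space \<nu>"
        then have \<xi>: "\<xi> \<in> characters" by simp
        have "norm (fourier_L1 \<mu> f \<xi> * (fourier_L1 \<mu> (h n) \<xi> - k \<xi>)) \<le> B * norm (fourier_L1 \<mu> (h n) \<xi> - k \<xi>)"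
          unfolding norm_mult B_def by (intro mult_right_mono norm_fourier_L1_le[OF f(2) \<xi>]) simp
        then show "norm (fourier_L1 \<mu> (conv \<mu> f (h n)) \<xi> - fourier_L1 \<mu> f \<xi> * k \<xi>) \<le>
          norm (of_real B * (fourier_L1 \<mu> (h n) \<xi> - k \<xi>))"
          using B by (simp add: fourier_L1_conv[OF f(2) h(2) \<xi>] norm_mult flip: right_diff_distrib)
      qed
      also have "\<dots> = B * l2norm \<nu> (\<lambda>\<xi>. fourier_L1 \<mu> (h n) \<xi> - k \<xi>)"
        using B by (simp add: l2norm_scale[OF d])
      finally show "l2norm \<nu> (\<lambda>\<xi>. fourier_L1 \<mu> (conv \<mu> f (h n)) \<xi> - fourier_L1 \<mu> f \<xi> * k \<xi>) \<le>
        B * l2norm \<nu> (\<lambda>\<xi>. fourier_L1 \<mu> (h n) \<xi> - k \<xi>)" .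
    qed
  qed
qed

text \<open>
  For general \<open>f\<close> the convolution need not be square integrable; boundedness of the transform of
  \<open>g\<close> is what makes it so.
\<close>
theorem ft_conv:
  assumes ff: "ft f f'" and ft: "ft g k" and bd: "AE \<xi> in \<nu>. norm (k \<xi>) \<le> 1"
  shows "ft (conv \<mu> f g) (\<lambda>\<xi>. f' \<xi> * k \<xi>)"
proof -
  note L = ft_L2[OF ft] ft_L2[OF ff]
  have [measurable]: "f \<in> borel_measurable \<mu>" "g \<in> borel_measurable \<mu>" "f' \<in> borel_measurable \<nu>" "k \<in> borel_measurable \<nu>"
    using L by (auto simp: L2_iff)
  obtain h where h: "\<And>n. h n \<in> L2 \<mu>" "\<And>n. integrable \<mu> (h n)"
    "l2_tendsto \<mu> h f" "l2_tendsto \<nu> (\<lambda>n. fourier_L1 \<mu> (h n)) f'"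
    using ftE[OF ff] by blast
  note hL = fourier_L1_L2(1)[OF h(1,2)]
  note ftc = ft_conv_L1[OF h(1,2) ft]
  have lim: "l2_tendsto \<nu> (\<lambda>n \<xi>. fourier_L1 \<mu> (h n) \<xi> * k \<xi>) (\<lambda>\<xi>. f' \<xi> * k \<xi>)"
  proof (rule l2_tendsto_comparison[OF _ h(4)])
    fix n
    have d: "(\<lambda>\<xi>. fourier_L1 \<mu> (h n) \<xi> - f' \<xi>) \<in> L2 \<nu>" by (rule L2_diff[OF hL L(4)])
    have "l2norm \<nu> (\<lambda>\<xi>. fourier_L1 \<mu> (h n) \<xi> * k \<xi> - f' \<xi> * k \<xi>) \<le> l2norm \<nu> (\<lambda>\<xi>. fourier_L1 \<mu> (h n) \<xi> - f' \<xi>)"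
    proof (rule l2norm_mono_AE[OF d])
      show "AE \<xi> in \<nu>. norm (fourier_L1 \<mu> (h n) \<xi> * k \<xi> - f' \<xi> * k \<xi>) \<le> norm (fourier_L1 \<mu> (h n) \<xi> - f' \<xi>)"
        using bd by eventually_elim (simp add: norm_mult mult_left_le flip: left_diff_distrib)
    qed
    then show "l2norm \<nu> (\<lambda>\<xi>. fourier_L1 \<mu> (h n) \<xi> * k \<xi> - f' \<xi> * k \<xi>) \<le> 1 * l2norm \<nu> (\<lambda>\<xi>. fourier_L1 \<mu> (h n) \<xi> - f' \<xi>)"
      by simp
  qed
  obtain u where u: "u \<in> L2 \<mu>" "ft u (\<lambda>\<xi>. f' \<xi> * k \<xi>)" "l2_tendsto \<mu> (\<lambda>n. conv \<mu> (h n) g) u"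
    using ft_preimage_limit[OF ftc ft_L2(1)[OF ftc] _ _ L2_mult_bounded[OF L(4) _ bd] lim] by auto
  \<comment> \<open>By Cauchy-Schwarz the convolution at each point depends continuously on its left
    factor, so the pointwise integral has to agree with the mean-square limit
    \<open>u\<close>.\<close>
  have "AE x in \<mu>. conv \<mu> f g x = u x"
  proof (rule l2_tendsto_AE_lim[OF ft_L2(1)[OF ftc] u(1,3)])
    show "AE x in \<mu>. (\<lambda>n. conv \<mu> (h n) g x) \<longlonglongrightarrow> conv \<mu> f g x"
    proof (rule AE_I2)
      fix x
      have "(\<lambda>n. conv \<mu> (h n) g x - conv \<mu> f g x) \<longlonglongrightarrow> 0"
      proof (rule Lim_null_comparison)
        show "(\<lambda>n. l2norm \<mu> (\<lambda>x. h n x - f x) * l2norm \<mu> g) \<longlonglongrightarrow> 0"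
          using h(3) unfolding l2_tendsto_def by (rule tendsto_mult_left_zero)
        show "\<forall>\<^sub>F n in sequentially. norm (conv \<mu> (h n) g x - conv \<mu> f g x) \<le> l2norm \<mu> (\<lambda>x. h n x - f x) * l2norm \<mu> g"
          using norm_conv_le[OF L2_diff[OF h(1) L(3)] L(1), of _ x]
          by (simp add: conv_diff_left[OF h(1) L(3) L(1)])
      qed
      then show "(\<lambda>n. conv \<mu> (h n) g x) \<longlonglongrightarrow> conv \<mu> f g x" by (simp add: LIM_zero_iff)
    qed
  qed measurable
  then show ?thesis by (intro ft_cong_AE[OF u(2)]) auto
qed

lemma ft_involution:
  assumes ft: "ft g k"
  shows "ft (involution g) (\<lambda>\<xi>. cnj (k \<xi>))"
proof -
  note L = ft_L2[OF ft]
  obtain h where h: "\<And>n. h n \<in> L2 \<mu>" "\<And>n. integrable \<mu> (h n)"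
    "l2_tendsto \<mu> h g" "l2_tendsto \<nu> (\<lambda>n. fourier_L1 \<mu> (h n)) k"
    using ftE[OF ft] by blast
  have hm: "h n \<in> borel_measurable \<mu>" for n using h(1) by (simp add: L2_iff)
  show ?thesis
  proof (rule ftI[OF involution_L2(1)[OF L(1)] L2_cnj[OF L(2)] involution_L2(1)[OF h(1)]])
    have "integrable \<mu> (\<lambda>x. h n (- x))" for n
      by (rule integrable_distr[OF measurable_uminus]) (simp add: distr_uminus h(2))
    then show "integrable \<mu> (involution (h n))" for n
      unfolding involution_def[abs_def] by auto
    show "l2_tendsto \<mu> (\<lambda>n. involution (h n)) (involution g)"
    proof (rule l2_tendsto_comparison[OF _ h(3)])
      fix n
      have "(\<lambda>x. involution (h n) x - involution g x) = involution (\<lambda>x. h n x - g x)"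
        by (simp add: involution_def fun_eq_iff)
      then show "l2norm \<mu> (\<lambda>x. involution (h n) x - involution g x) \<le> 1 * l2norm \<mu> (\<lambda>x. h n x - g x)"
        by (simp add: involution_L2(2)[OF L2_diff[OF h(1) L(1)]])
    qed
    show "l2_tendsto \<nu> (\<lambda>n. fourier_L1 \<mu> (involution (h n))) (\<lambda>\<xi>. cnj (k \<xi>))"
    proof (rule l2_tendsto_comparison[OF _ h(4)])
      fix n
      have "l2norm \<nu> (\<lambda>\<xi>. fourier_L1 \<mu> (involution (h n)) \<xi> - cnj (k \<xi>)) =
         l2norm \<nu> (\<lambda>\<xi>. cnj (fourier_L1 \<mu> (h n) \<xi> - k \<xi>))"
        by (rule l2norm_cong) (simp add: fourier_L1_involution[OF hm])
      then show "l2norm \<nu> (\<lambda>\<xi>. fourier_L1 \<mu> (involution (h n)) \<xi> - cnj (k \<xi>)) \<le> 1 * l2norm \<nu> (\<lambda>\<xi>. fourier_L1 \<mu> (h n) \<xi> - k \<xi>)"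
        by (simp only: l2norm_cnj)
    qed
  qed
qed

end

section \<open>Countable sums as integrals\<close>

text \<open>The bridge between the infinite sums of the graph definitions and integrals against
  counting measure, to which Tonelli applies. Countability gives an increasing sequence of finite
  sets that exhausts \<open>A\<close>.\<close>

lemma nn_integral_count_space_eq_infsum:
  fixes f :: "'i \<Rightarrow> ennreal"
  assumes "countable A"
  shows "(\<integral>\<^sup>+i. f i \<partial>count_space A) = infsum f A"
proof (cases "A = {}")
  case True
  then show ?thesis by (simp add: nn_integral_empty)
next
  case False
  have sum_eq: "sum f G = (\<integral>\<^sup>+i. f i * indicator G i \<partial>count_space A)" if "finite G" "G \<subseteq> A" for G
  proof -
    have "(\<integral>\<^sup>+i. f i * indicator G i \<partial>count_space A) = (\<integral>\<^sup>+i. f i * indicator G i \<partial>count_space G)"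
      by (rule nn_integral_count_space_eq) (use that in auto)
    also have "\<dots> = sum f G" using that by (simp add: nn_integral_count_space_finite)
    finally show ?thesis by simp
  qed
  define G where "G n = from_nat_into A ` {..n}" for n :: nat
  have G: "finite (G n)" "G n \<subseteq> A" for n by (auto simp: G_def from_nat_into[OF False])
  have G_inc: "incseq G" unfolding G_def by (intro monoI image_mono) auto
  have f_SUP: "f i = (SUP n. f i * indicator (G n) i)" if i: "i \<in> A" for i
  proof (rule antisym)
    obtain n where "from_nat_into A n = i" using from_nat_into_surj[OF assms i] by blast
    then have "i \<in> G n" by (auto simp: G_def)
    then show "f i \<le> (SUP n. f i * indicator (G n) i)" by (intro SUP_upper2[of n]) auto
    show "(SUP n. f i * indicator (G n) i) \<le> f i" by (rule SUP_least) (auto simp: indicator_def)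
  qed
  have "(\<integral>\<^sup>+i. f i \<partial>count_space A) = (\<integral>\<^sup>+i. (SUP n. f i * indicator (G n) i) \<partial>count_space A)"
    by (rule nn_integral_cong) (use f_SUP in simp)
  also have "\<dots> = (SUP n. \<integral>\<^sup>+i. f i * indicator (G n) i \<partial>count_space A)"
    by (rule nn_integral_monotone_convergence_SUP)
       (use incseqD[OF G_inc] in \<open>auto simp: incseq_def le_fun_def indicator_def\<close>)
  also have "\<dots> = (SUP n. sum f (G n))" using sum_eq[OF G] by simp
  finally have eq_SUP: "(\<integral>\<^sup>+i. f i \<partial>count_space A) = (SUP n. sum f (G n))" .
  also have "\<dots> = (SUP H\<in>{H. finite H \<and> H \<subseteq> A}. sum f H)"
  proof (rule antisym)
    show "(SUP n. sum f (G n)) \<le> (SUP H\<in>{H. finite H \<and> H \<subseteq> A}. sum f H)"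
      by (rule SUP_least) (use G in \<open>auto intro: SUP_upper\<close>)
    show "(SUP H\<in>{H. finite H \<and> H \<subseteq> A}. sum f H) \<le> (SUP n. sum f (G n))"
    proof (rule SUP_least)
      fix H assume "H \<in> {H. finite H \<and> H \<subseteq> A}"
      then have H: "finite H" "H \<subseteq> A" by auto
      have "sum f H \<le> (\<integral>\<^sup>+i. f i \<partial>count_space A)"
        unfolding sum_eq[OF H] by (rule nn_integral_mono) (auto simp: indicator_def)
      also have "\<dots> = (SUP n. sum f (G n))" by (rule eq_SUP)
      finally show "sum f H \<le> (SUP n. sum f (G n))" .
    qed
  qed
  also have "\<dots> = infsum f A" by (rule nonneg_infsum_complete[symmetric]) simp
  finally show ?thesis .
qed

lemma has_sum_imp_nn_integral_count_space:
  fixes f :: "'i \<Rightarrow> real"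
  assumes "(f has_sum s) A" "\<And>i. i \<in> A \<Longrightarrow> f i \<ge> 0"
  shows "(\<integral>\<^sup>+i. ennreal (f i) \<partial>count_space A) = ennreal s"
proof -
  have "f summable_on A" using assms(1) by (rule has_sum_imp_summable)
  then have "Infinite_Sum.abs_summable_on f A"
    using assms(2) by (simp cong: summable_on_cong)
  then have abs: "Infinite_Set_Sum.abs_summable_on f A" unfolding abs_summable_equivalent .
  have "(\<integral>\<^sup>+i. ennreal (f i) \<partial>count_space A) = ennreal (infsum f A)"
    using nn_integral_conv_infsetsum[OF abs assms(2)] by (simp add: infsetsum_infsum[OF abs])
  then show ?thesis using assms(1) by (simp add: infsumI)
qed

lemma nn_integral_count_space_split:
  assumes "T \<subseteq> A"
  shows "(\<integral>\<^sup>+i. f i \<partial>count_space A) = (\<integral>\<^sup>+i. f i \<partial>count_space T) + (\<integral>\<^sup>+i. f i \<partial>count_space (A - T))"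
proof -
  have 1: "(\<integral>\<^sup>+i. f i \<partial>count_space T) = (\<integral>\<^sup>+i. f i * indicator T i \<partial>count_space A)"
    using assms by (subst nn_integral_count_space_eq[of A T])
      (auto intro!: nn_integral_cong simp: indicator_def)
  have 2: "(\<integral>\<^sup>+i. f i \<partial>count_space (A - T)) = (\<integral>\<^sup>+i. f i * indicator (A - T) i \<partial>count_space A)"
    by (subst nn_integral_count_space_eq[of A "A - T"])
      (auto intro!: nn_integral_cong simp: indicator_def)
  show ?thesis
    unfolding 1 2 by (subst nn_integral_add[symmetric]) (auto intro!: nn_integral_cong simp: indicator_def)
qed

lemma borel_measurable_nn_integral_count_space:
  fixes f :: "'i \<Rightarrow> 'b \<Rightarrow> ennreal"
  assumes "countable A" "\<And>i. i \<in> A \<Longrightarrow> f i \<in> borel_measurable M"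
  shows "(\<lambda>x. \<integral>\<^sup>+i. f i x \<partial>count_space A) \<in> borel_measurable M"
proof -
  interpret sigma_finite_measure "count_space A"
    using assms(1) by (rule sigma_finite_measure_count_space_countable)
  have "(\<lambda>(i, x). f i x) \<in> borel_measurable (count_space A \<Otimes>\<^sub>M M)"
    by (rule measurable_pair_measure_countable1) (use assms in auto)
  from measurable_pair_swap[OF this]
  have "(\<lambda>(x, i). f i x) \<in> borel_measurable (M \<Otimes>\<^sub>M count_space A)"
    by (simp add: case_prod_beta')
  then show ?thesis using borel_measurable_nn_integral[of "\<lambda>x i. f i x" M] by simp
qed

text \<open>Factorizes the double sum over all pairs that cross a cut.\<close>

lemma nn_integral_count_space_prod:
  assumes "countable A" "countable B"
  shows "(\<integral>\<^sup>+p. f (fst p) * g (snd p) \<partial>count_space (A \<times> B)) =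
    (\<integral>\<^sup>+a. f a \<partial>count_space A) * (\<integral>\<^sup>+b. g b \<partial>count_space B)"
proof -
  interpret sigma_finite_measure "count_space B"
    using assms(2) by (rule sigma_finite_measure_count_space_countable)
  have "(\<integral>\<^sup>+p. f (fst p) * g (snd p) \<partial>count_space (A \<times> B)) =
    (\<integral>\<^sup>+a. \<integral>\<^sup>+b. f a * g b \<partial>count_space B \<partial>count_space A)"
    unfolding pair_measure_countable[OF assms, symmetric]
    by (subst nn_integral_fst[symmetric]) (simp_all add: pair_measure_countable[OF assms])
  then show ?thesis by (simp add: nn_integral_cmult nn_integral_multc)
qed

lemma ennreal_divide_le_1: "x \<le> y \<Longrightarrow> 0 < y \<Longrightarrow> x / y \<le> (1::ennreal)"
  by (metis divide_right_mono_ennreal ennreal_divide_self ennreal_divide_top less_irrefl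
      order_le_less top.not_eq_extremum zero_le_one)

lemma inverse_le_ennreal:
  assumes "ennreal r \<le> x" "0 < r"
  shows "inverse x \<le> ennreal (inverse r)"
proof (cases x)
  case (real s)
  then have "r \<le> s" using assms by simp
  then show ?thesis using real assms by (simp add: inverse_ennreal le_imp_inverse_le)
qed simp

section \<open>The generalized wavelet transform\<close>

locale wavelet_system = haar_dual \<mu> \<nu>
  for \<mu> :: "'a::{topological_ab_group_add, t2_space, second_countable_topology} measure"
    and \<nu> :: "('a \<Rightarrow> complex) measure" +
  fixes F :: "complex set" and \<Lambda> :: "'l set" and \<psi> :: "'l \<Rightarrow> 'a \<Rightarrow> complex"
  assumes scalars: "F = \<real> \<or> F = UNIV"
    and countable: "countable \<Lambda>"
    and psi: "\<And>l. l \<in> \<Lambda> \<Longrightarrow> \<psi> l \<in> L2_space F \<mu>"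
    and calderon: "calderon_condition \<mu> \<nu> \<Lambda> \<psi>"
begin

abbreviation W where "W \<equiv> wavelet_transform \<mu> \<psi>"
abbreviation Ph where "Ph \<equiv> phase_space \<mu> \<Lambda>"

definition psihat :: "'l \<Rightarrow> ('a \<Rightarrow> complex) \<Rightarrow> complex" where
  "psihat l = fourier_L2 \<mu> \<nu> (\<psi> l)"

text \<open>The multiplier \<open>m_T\<close> as a real function defined everywhere; where the sum
  is infinite it is 0. Its expected properties hold almost everywhere.\<close>

definition mass :: "'l set \<Rightarrow> ('a \<Rightarrow> complex) \<Rightarrow> real" where
  "mass T \<xi> = enn2real (\<integral>\<^sup>+l. ennreal ((norm (psihat l \<xi>))\<^sup>2) \<partial>count_space T)"

lemma psi_ft: "l \<in> \<Lambda> \<Longrightarrow> ft (\<psi> l) (psihat l)"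
  unfolding psihat_def by (intro ft_fourier_L2 L2_space_subset[OF psi])

lemma psihat_measurable [measurable]: "l \<in> \<Lambda> \<Longrightarrow> psihat l \<in> borel_measurable \<nu>"
  using ft_L2(2)[OF psi_ft] by (simp add: L2_iff)

lemma countable_sub: "T \<subseteq> \<Lambda> \<Longrightarrow> Countable_Set.countable T"
  using countable countable_subset by auto

lemma mass_measurable [measurable]: 
  assumes "T \<subseteq> \<Lambda>"
  shows "mass T \<in> borel_measurable \<nu>"
  unfolding mass_def[abs_def] using assms
  by (intro borel_measurable_enn2real borel_measurable_nn_integral_count_space countable_sub) auto

text \<open>The Calderon identity split along \<open>T\<close>. All almost everywhere facts are
  bundled, so that later arguments fix a frequency only once.\<close>

lemma AE_mass:
  assumes T: "T \<subseteq> \<Lambda>"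
  shows "AE \<xi> in \<nu>. ((\<lambda>l. (norm (psihat l \<xi>))\<^sup>2) has_sum mass T \<xi>) T \<and>
    (\<integral>\<^sup>+l. ennreal ((norm (psihat l \<xi>))\<^sup>2) \<partial>count_space T) = ennreal (mass T \<xi>) \<and>
    (\<integral>\<^sup>+l. ennreal ((norm (psihat l \<xi>))\<^sup>2) \<partial>count_space (\<Lambda> - T)) = ennreal (1 - mass T \<xi>) \<and>
    0 \<le> mass T \<xi> \<and> mass T \<xi> \<le> 1"
  using calderon[unfolded calderon_condition_def]
proof eventually_elim
  case (elim \<xi>)
  let ?a = "\<lambda>l. (norm (psihat l \<xi>))\<^sup>2"
  have sum1: "(?a has_sum 1) \<Lambda>" using elim by (simp add: psihat_def)
  have sub: "(?a has_sum infsum ?a U) U" if "U \<subseteq> \<Lambda>" for U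
    using summable_on_subset_banach[OF has_sum_imp_summable[OF sum1] that] by simp
  have nn: "(\<integral>\<^sup>+l. ennreal (?a l) \<partial>count_space U) = ennreal (infsum ?a U)" if "U \<subseteq> \<Lambda>" for U
    by (rule has_sum_imp_nn_integral_count_space[OF sub[OF that]]) simp
  have nonneg: "infsum ?a U \<ge> 0" for U by (rule infsum_nonneg) simp
  have m: "mass T \<xi> = infsum ?a T" unfolding mass_def nn[OF T] by (simp add: nonneg)
  have "(?a has_sum (infsum ?a T + infsum ?a (\<Lambda> - T))) (T \<union> (\<Lambda> - T))"
    by (rule has_sum_Un_disjoint) (use sub T in auto)
  then have "infsum ?a T + infsum ?a (\<Lambda> - T) = 1"
    using sum1 T has_sum_unique by (metis Diff_partition)
  then show ?case using sub[OF T] nn[OF T] nn[of "\<Lambda> - T"] nonneg[of T] nonneg[of "\<Lambda> - T"]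
    by (simp add: m eq_diff_eq)
qed

lemma mass_singleton: "mass {l} \<xi> = (norm (psihat l \<xi>))\<^sup>2"
  by (simp add: mass_def nn_integral_count_space_finite)

text \<open>A single term of a nonnegative sum equal to 1. This is the boundedness that the
  convolution theorem asks for.\<close>

lemma AE_psihat_le_1:
  assumes "l \<in> \<Lambda>"
  shows "AE \<xi> in \<nu>. norm (psihat l \<xi>) \<le> 1"
proof -
  have "{l} \<subseteq> \<Lambda>" using assms by simp
  from AE_mass[OF this] show ?thesis
  proof eventually_elim
    case (elim \<xi>)
    then have "(norm (psihat l \<xi>))\<^sup>2 \<le> 1"
      by (simp only: mass_singleton)
    then show ?case by (simp add: power_le_one_iff)
  qed
qed

lemma ft_conv_psi:
  assumes "ft f f'" "l \<in> \<Lambda>"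
  shows "ft (conv \<mu> f (\<psi> l)) (\<lambda>\<xi>. f' \<xi> * psihat l \<xi>)"
  by (rule ft_conv[OF assms(1) psi_ft[OF assms(2)] AE_psihat_le_1[OF assms(2)]])

lemma ft_W:
  assumes "ft f f'" "l \<in> \<Lambda>"
  shows "ft (\<lambda>x. W f (x, l)) (\<lambda>\<xi>. f' \<xi> * cnj (psihat l \<xi>))"
proof -
  have "AE \<xi> in \<nu>. norm (cnj (psihat l \<xi>)) \<le> 1" using AE_psihat_le_1[OF assms(2)] by simp
  from ft_conv[OF assms(1) ft_involution[OF psi_ft[OF assms(2)]] this]
  show ?thesis by (simp add: wavelet_transform_def)
qed

lemma scalars_closed: "closed F" "0 \<in> F"
  using scalars closed_complex_Reals by auto

lemma conv_scalars:
  assumes "f \<in> L2_space F \<mu>" "g \<in> L2_space F \<mu>"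
  shows "conv \<mu> f g x \<in> F"
  using scalars conv_real[of f g x] L2_spaceD[OF assms(1)] L2_spaceD[OF assms(2)] by auto

lemma involution_scalars:
  assumes "f \<in> L2_space F \<mu>"
  shows "involution f \<in> L2_space F \<mu>"
proof (rule L2_spaceI[OF involution_L2(1)[OF L2_space_subset[OF assms]]])
  fix x
  have "f (- x) \<in> F" using L2_spaceD[OF assms] by simp
  then show "involution f x \<in> F" using scalars by (auto simp: involution_def Reals_cnj_iff)
qed

lemma W_scalars: "f \<in> L2_space F \<mu> \<Longrightarrow> l \<in> \<Lambda> \<Longrightarrow> W f (x, l) \<in> F"
  unfolding wavelet_transform_def by (simp add: conv_scalars involution_scalars psi)

section \<open>Norms on phase space\<close>

lemma space_phase: "space Ph = UNIV \<times> \<Lambda>"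
  by (simp add: phase_space_def space_pair_measure)

lemma phase_measurable:
  assumes "\<And>l. l \<in> \<Lambda> \<Longrightarrow> (\<lambda>x. G (x, l)) \<in> borel_measurable \<mu>"
  shows "G \<in> borel_measurable Ph"
proof -
  have "(\<lambda>(l, x). G (x, l)) \<in> borel_measurable (count_space \<Lambda> \<Otimes>\<^sub>M \<mu>)"
    by (rule measurable_pair_measure_countable1[OF countable]) (use assms in auto)
  from measurable_pair_swap[OF this] show ?thesis
    by (simp add: phase_space_def case_prod_beta')
qed

lemma phase_norm_sq:
  fixes G :: "'a \<times> 'l \<Rightarrow> complex"
  assumes "\<And>l. l \<in> \<Lambda> \<Longrightarrow> (\<lambda>x. G (x, l)) \<in> borel_measurable \<mu>"
  shows "L2_norm_sq Ph G = (\<integral>\<^sup>+l. L2_norm_sq \<mu> (\<lambda>x. G (x, l)) \<partial>count_space \<Lambda>)"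
proof -
  interpret C: sigma_finite_measure "count_space \<Lambda>"
    using countable by (rule sigma_finite_measure_count_space_countable)
  interpret P: pair_sigma_finite \<mu> "count_space \<Lambda>" ..
  have "(\<lambda>p. ennreal ((norm (G p))\<^sup>2)) \<in> borel_measurable (\<mu> \<Otimes>\<^sub>M count_space \<Lambda>)"
    using phase_measurable[OF assms] unfolding phase_space_def by measurable
  from P.nn_integral_snd[OF this] show ?thesis
    by (simp add: L2_norm_sq_def phase_space_def)
qed

text \<open>Plancherel on every slice, followed by Tonelli over the countable index set.\<close>

lemma phase_norm_sq_ft:
  assumes "\<And>l. l \<in> \<Lambda> \<Longrightarrow> ft (\<lambda>x. G (x, l)) (k l)"
  shows "L2_norm_sq Ph G = (\<integral>\<^sup>+\<xi>. \<integral>\<^sup>+l. ennreal ((norm (k l \<xi>))\<^sup>2) \<partial>count_space \<Lambda> \<partial>\<nu>)"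
proof -
  have [measurable]: "(\<lambda>x. G (x, l)) \<in> borel_measurable \<mu>" "k l \<in> borel_measurable \<nu>" if "l \<in> \<Lambda>" for l
    using ft_L2[OF assms[OF that]] by (auto simp: L2_iff)
  have "L2_norm_sq Ph G = (\<integral>\<^sup>+l. L2_norm_sq \<mu> (\<lambda>x. G (x, l)) \<partial>count_space \<Lambda>)"
    by (rule phase_norm_sq) measurable
  also have "\<dots> = (\<integral>\<^sup>+l. L2_norm_sq \<nu> (k l) \<partial>count_space \<Lambda>)"
    by (rule nn_integral_cong) (use ft_norm_sq[OF assms] in simp)
  also have "\<dots> = (\<integral>\<^sup>+\<xi>. \<integral>\<^sup>+l. ennreal ((norm (k l \<xi>))\<^sup>2) \<partial>count_space \<Lambda> \<partial>\<nu>)"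
    unfolding L2_norm_sq_def
    by (rule nn_integral_count_space_nn_integral[symmetric, OF countable]) measurable
  finally show ?thesis .
qed

text \<open>If the slices are \<open>psihat l\<close> with one weight on \<open>T\<close> and
  another off \<open>T\<close>, the sum over the indices collapses to the masses of \<open>T\<close>
  and of its complement.\<close>

lemma phase_norm_sq_two_valued:
  assumes ft: "\<And>l. l \<in> \<Lambda> \<Longrightarrow> ft (\<lambda>x. G (x, l)) (k l)" and T: "T \<subseteq> \<Lambda>"
    and k: "\<And>l \<xi>. l \<in> \<Lambda> \<Longrightarrow> (norm (k l \<xi>))\<^sup>2 = (if l \<in> T then A \<xi> else B \<xi>) * (norm (psihat l \<xi>))\<^sup>2"
    and nonneg: "\<And>\<xi>. A \<xi> \<ge> 0" "\<And>\<xi>. B \<xi> \<ge> 0"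
  shows "L2_norm_sq Ph G = (\<integral>\<^sup>+\<xi>. ennreal (A \<xi> * mass T \<xi> + B \<xi> * (1 - mass T \<xi>)) \<partial>\<nu>)"
proof -
  have "L2_norm_sq Ph G = (\<integral>\<^sup>+\<xi>. \<integral>\<^sup>+l. ennreal ((norm (k l \<xi>))\<^sup>2) \<partial>count_space \<Lambda> \<partial>\<nu>)"
    by (rule phase_norm_sq_ft[OF ft])
  also have "\<dots> = (\<integral>\<^sup>+\<xi>. ennreal (A \<xi> * mass T \<xi> + B \<xi> * (1 - mass T \<xi>)) \<partial>\<nu>)"
  proof (rule nn_integral_cong_AE)
    show "AE \<xi> in \<nu>. (\<integral>\<^sup>+l. ennreal ((norm (k l \<xi>))\<^sup>2) \<partial>count_space \<Lambda>) =
      ennreal (A \<xi> * mass T \<xi> + B \<xi> * (1 - mass T \<xi>))"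
      using AE_mass[OF T]
    proof eventually_elim
      case (elim \<xi>)
      have "(\<integral>\<^sup>+l. ennreal ((norm (k l \<xi>))\<^sup>2) \<partial>count_space T) =
        (\<integral>\<^sup>+l. ennreal (A \<xi>) * ennreal ((norm (psihat l \<xi>))\<^sup>2) \<partial>count_space T)"
        by (rule nn_integral_cong) (use T k nonneg in \<open>auto simp: ennreal_mult\<close>)
      also have "\<dots> = ennreal (A \<xi>) * ennreal (mass T \<xi>)"
        using elim by (simp add: nn_integral_cmult)
      finally have 1: "(\<integral>\<^sup>+l. ennreal ((norm (k l \<xi>))\<^sup>2) \<partial>count_space T) = ennreal (A \<xi> * mass T \<xi>)"
        using nonneg elim by (simp add: ennreal_mult)
      have "(\<integral>\<^sup>+l. ennreal ((norm (k l \<xi>))\<^sup>2) \<partial>count_space (\<Lambda> - T)) =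
        (\<integral>\<^sup>+l. ennreal (B \<xi>) * ennreal ((norm (psihat l \<xi>))\<^sup>2) \<partial>count_space (\<Lambda> - T))"
        by (rule nn_integral_cong) (use T k nonneg in \<open>auto simp: ennreal_mult\<close>)
      also have "\<dots> = ennreal (B \<xi>) * ennreal (1 - mass T \<xi>)"
        using elim by (simp add: nn_integral_cmult)
      finally have 2: "(\<integral>\<^sup>+l. ennreal ((norm (k l \<xi>))\<^sup>2) \<partial>count_space (\<Lambda> - T)) = ennreal (B \<xi> * (1 - mass T \<xi>))"
        using nonneg elim by (simp add: ennreal_mult)
      show ?case
        unfolding nn_integral_count_space_split[OF T] 1 2
        using nonneg elim by (simp add: ennreal_plus)
    qed
  qed
  finally show ?thesis .
qed

lemma phase_L2:
  assumes "\<And>l. l \<in> \<Lambda> \<Longrightarrow> ft (\<lambda>x. G (x, l)) (k l)" "L2_norm_sq Ph G < \<infinity>"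
  shows "G \<in> L2 Ph"
  unfolding L2_iff using assms ft_L2(1)[OF assms(1)] by (auto intro!: phase_measurable simp: L2_iff)

section \<open>Frequency multipliers and the adjoint\<close>

lemma scalars_add: "a \<in> F \<Longrightarrow> b \<in> F \<Longrightarrow> a + b \<in> F"
  using scalars by auto

lemma conv_psi_scalars:
  assumes "f \<in> L2_space F \<mu>" "l \<in> \<Lambda>"
  shows "conv \<mu> f (\<psi> l) \<in> L2_space F \<mu>"
proof -
  have f: "ft f (fourier_L2 \<mu> \<nu> f)" by (rule ft_fourier_L2[OF L2_space_subset[OF assms(1)]])
  show ?thesis
    by (rule L2_spaceI[OF ft_L2(1)[OF ft_conv_psi[OF f assms(2)]]]) (rule conv_scalars[OF assms(1) psi[OF assms(2)]])
qed

lemma W_slice_scalars: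
  assumes "f \<in> L2_space F \<mu>" "l \<in> \<Lambda>"
  shows "(\<lambda>x. W f (x, l)) \<in> L2_space F \<mu>"
proof -
  have f: "ft f (fourier_L2 \<mu> \<nu> f)" by (rule ft_fourier_L2[OF L2_space_subset[OF assms(1)]])
  show ?thesis
    by (rule L2_spaceI[OF ft_L2(1)[OF ft_W[OF f assms(2)]]]) (rule W_scalars[OF assms])
qed

text \<open>The signal f * psi_l^* * psi_l has transform |psihat_l|^2 f' and takes values in
  \<open>F\<close>; a finite multiplier is a sum of such signals.\<close>

lemma multiplier_finite:
  assumes f: "f \<in> L2_space F \<mu>" "ft f f'" and T: "finite T" "T \<subseteq> \<Lambda>"
  shows "\<exists>u\<in>L2_space F \<mu>. ft u (\<lambda>\<xi>. of_real (\<Sum>l\<in>T. (norm (psihat l \<xi>))\<^sup>2) * f' \<xi>)"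
  using T
proof (induction T rule: finite_induct)
  case empty
  have "(\<lambda>x. 0) \<in> L2_space F \<mu>" by (rule L2_spaceI[OF L2_zero]) (rule scalars_closed)
  moreover have "ft (\<lambda>x. 0) (\<lambda>\<xi>. 0)" using ft_scale[OF f(2), of 0] by simp
  ultimately show ?case by (auto intro: bexI[rotated])
next
  case (insert l T)
  then have l: "l \<in> \<Lambda>" by simp
  obtain u where u: "u \<in> L2_space F \<mu>" "ft u (\<lambda>\<xi>. of_real (\<Sum>l\<in>T. (norm (psihat l \<xi>))\<^sup>2) * f' \<xi>)"
    using insert by auto
  let ?v = "conv \<mu> (\<lambda>x. W f (x, l)) (\<psi> l)"
  have v: "?v \<in> L2_space F \<mu>" by (rule conv_psi_scalars[OF W_slice_scalars[OF f(1) l] l])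
  have "ft ?v (\<lambda>\<xi>. f' \<xi> * cnj (psihat l \<xi>) * psihat l \<xi>)"
    by (rule ft_conv_psi[OF ft_W[OF f(2) l] l])
  from ft_add[OF u(2) this]
  have "ft (\<lambda>x. u x + ?v x) (\<lambda>\<xi>. of_real (\<Sum>l\<in>T. (norm (psihat l \<xi>))\<^sup>2) * f' \<xi> + f' \<xi> * cnj (psihat l \<xi>) * psihat l \<xi>)" .
  moreover have "(\<lambda>\<xi>. of_real (\<Sum>l\<in>T. (norm (psihat l \<xi>))\<^sup>2) * f' \<xi> + f' \<xi> * cnj (psihat l \<xi>) * psihat l \<xi>) =
    (\<lambda>\<xi>. of_real (\<Sum>l\<in>insert l T. (norm (psihat l \<xi>))\<^sup>2) * f' \<xi>)"
  proof
    fix \<xi>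
    have "f' \<xi> * cnj (psihat l \<xi>) * psihat l \<xi> = of_real ((norm (psihat l \<xi>))\<^sup>2) * f' \<xi>"
      unfolding complex_norm_square by (simp only: mult_ac)
    then show "of_real (\<Sum>l\<in>T. (norm (psihat l \<xi>))\<^sup>2) * f' \<xi> + f' \<xi> * cnj (psihat l \<xi>) * psihat l \<xi> =
      of_real (\<Sum>l\<in>insert l T. (norm (psihat l \<xi>))\<^sup>2) * f' \<xi>"
      using insert.hyps by (simp add: distrib_right)
  qed
  ultimately have ft: "ft (\<lambda>x. u x + ?v x) (\<lambda>\<xi>. of_real (\<Sum>l\<in>insert l T. (norm (psihat l \<xi>))\<^sup>2) * f' \<xi>)"
    by (simp only:)
  moreover have "(\<lambda>x. u x + ?v x) \<in> L2_space F \<mu>"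
    by (rule L2_spaceI[OF ft_L2(1)[OF ft]]) (intro scalars_add L2_spaceD[OF u(1)] L2_spaceD[OF v])
  ultimately show ?case by blast
qed

text \<open>This is \<open>f_T\<close>. For infinite \<open>T\<close> the partial sums lie between 0
  and \<open>m_T\<close>, and \<open>m_T\<close> is at most 1 almost everywhere, so their transforms
  converge with \<open>f'\<close> as dominating function; the limit is then pulled back to the
  group.\<close>

lemma multiplier_exists:
  assumes f: "f \<in> L2_space F \<mu>" "ft f f'" and T: "T \<subseteq> \<Lambda>"
  obtains u where "u \<in> L2_space F \<mu>" "ft u (\<lambda>\<xi>. of_real (mass T \<xi>) * f' \<xi>)"
proof (cases "finite T")
  case True
  obtain u where u: "u \<in> L2_space F \<mu>" "ft u (\<lambda>\<xi>. of_real (\<Sum>l\<in>T. (norm (psihat l \<xi>))\<^sup>2) * f' \<xi>)"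
    using multiplier_finite[OF f True T] by blast
  have "mass T \<xi> = (\<Sum>l\<in>T. (norm (psihat l \<xi>))\<^sup>2)" for \<xi>
    unfolding mass_def nn_integral_count_space_finite[OF True]
    by (subst sum_ennreal) (simp_all add: sum_nonneg)
  then show ?thesis using u that by simp
next
  case False
  define e where "e = from_nat_into T"
  have e: "bij_betw e UNIV T" unfolding e_def by (rule bij_betw_from_nat_into[OF countable_sub[OF T] False])
  have eT: "e n \<in> T" for n using e by (auto simp: bij_betw_def)
  define G where "G n = e ` {..<n}" for n
  have G: "finite (G n)" "G n \<subseteq> \<Lambda>" for n using eT T by (auto simp: G_def)
  define s where "s n \<xi> = (\<Sum>l\<in>G n. (norm (psihat l \<xi>))\<^sup>2)" for n \<xi>
  have s_eq: "s n \<xi> = (\<Sum>k<n. (norm (psihat (e k) \<xi>))\<^sup>2)" for n \<xi>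
    unfolding s_def G_def using e by (subst sum.reindex) (auto simp: bij_betw_def intro: inj_on_subset)
  have "\<exists>u\<in>L2_space F \<mu>. ft u (\<lambda>\<xi>. of_real (s n \<xi>) * f' \<xi>)" for n
    unfolding s_def by (rule multiplier_finite[OF f G])
  then obtain u where u: "\<And>n. u n \<in> L2_space F \<mu>" "\<And>n. ft (u n) (\<lambda>\<xi>. of_real (s n \<xi>) * f' \<xi>)"
    by metis
  have f'L: "f' \<in> L2 \<nu>" by (rule ft_L2(2)[OF f(2)])
  note [measurable] = L2_measurable[OF f'L] mass_measurable[OF T]
  have AE_lim: "AE \<xi> in \<nu>. (\<lambda>n. s n \<xi>) \<longlonglongrightarrow> mass T \<xi> \<and> (\<forall>n. 0 \<le> s n \<xi> \<and> s n \<xi> \<le> mass T \<xi>) \<and> mass T \<xi> \<le> 1"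
    using AE_mass[OF T]
  proof eventually_elim
    case (elim \<xi>)
    have "((\<lambda>k. (norm (psihat (e k) \<xi>))\<^sup>2) has_sum mass T \<xi>) UNIV"
      using elim by (subst has_sum_reindex_bij_betw[OF e]) blast
    then have sums: "(\<lambda>k. (norm (psihat (e k) \<xi>))\<^sup>2) sums mass T \<xi>"
      by (rule has_sum_imp_sums)
    have "s n \<xi> \<le> mass T \<xi>" for n
      unfolding s_eq sums_unique[OF sums] by (rule sum_le_suminf) (use sums in \<open>auto simp: sums_iff\<close>)
    moreover have "0 \<le> s n \<xi>" for n unfolding s_def by (rule sum_nonneg) simp
    moreover have "(\<lambda>n. s n \<xi>) \<longlonglongrightarrow> mass T \<xi>" using sums by (simp add: sums_def s_eq)
    ultimately show ?case using elim by blast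
  qed
  have gL: "(\<lambda>\<xi>. of_real (mass T \<xi>) * f' \<xi>) \<in> L2 \<nu>"
  proof (rule L2_dominated[OF f'L])
    show "AE \<xi> in \<nu>. norm (of_real (mass T \<xi>) * f' \<xi>) \<le> norm (f' \<xi>)"
      using AE_mass[OF T] by eventually_elim (simp add: norm_mult mult_left_le_one_le)
  qed measurable
  have lim: "l2_tendsto \<nu> (\<lambda>n \<xi>. of_real (s n \<xi>) * f' \<xi>) (\<lambda>\<xi>. of_real (mass T \<xi>) * f' \<xi>)"
  proof (rule l2_tendsto_dominated[OF ft_L2(2)[OF u(2)] gL f'L])
    show "AE \<xi> in \<nu>. (\<lambda>n. of_real (s n \<xi>) * f' \<xi>) \<longlonglongrightarrow> of_real (mass T \<xi>) * f' \<xi>"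
      using AE_lim by eventually_elim (intro tendsto_intros, blast)
    show "AE \<xi> in \<nu>. norm (of_real (s n \<xi>) * f' \<xi> - of_real (mass T \<xi>) * f' \<xi>) \<le> norm (f' \<xi>)" for n
      using AE_lim
    proof eventually_elim
      case (elim \<xi>)
      have "0 \<le> s n \<xi>" "s n \<xi> \<le> mass T \<xi>" "mass T \<xi> \<le> 1" using elim by blast+
      then have "\<bar>s n \<xi> - mass T \<xi>\<bar> \<le> 1" by linarith
      then have "\<bar>s n \<xi> - mass T \<xi>\<bar> * norm (f' \<xi>) \<le> 1 * norm (f' \<xi>)" by (rule mult_right_mono) simp
      then show ?case by (simp add: norm_mult flip: left_diff_distrib of_real_diff)
    qed
  qed
  show ?thesis
    using ft_preimage_limit[OF u(2,1) scalars_closed gL lim] that by blast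
qed

text \<open>The adjoint is chosen arbitrarily among functions that agree almost everywhere.
  Convolution does not see null sets, so the projection is determined at every point.\<close>

lemma kernel_projection_eqI:
  assumes u: "u \<in> L2_space F \<mu>"
    and eq: "\<And>g. g \<in> L2_space F \<mu> \<Longrightarrow> L2_inner \<mu> u g = L2_inner Ph H (W g)"
    and l: "l \<in> \<Lambda>"
  shows "kernel_projection F \<mu> \<Lambda> \<psi> H (x, l) = W u (x, l)"
proof -
  define v where "v = wavelet_adjoint F \<mu> \<Lambda> \<psi> H"
  have "v \<in> L2_space F \<mu> \<and> (\<forall>g \<in> L2_space F \<mu>. L2_inner \<mu> v g = L2_inner Ph H (W g))"
    unfolding v_def wavelet_adjoint_def by (rule someI[of _ u]) (use assms in auto)
  then have v: "v \<in> L2_space F \<mu>" "\<And>g. g \<in> L2_space F \<mu> \<Longrightarrow> L2_inner \<mu> v g = L2_inner \<mu> u g"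
    using eq by auto
  have "AE y in \<mu>. v y = u y"
    by (rule L2_inner_eq_imp_AE_eq[OF scalars v(1) u v(2)])
  then have "conv \<mu> v (involution (\<psi> l)) x = conv \<mu> u (involution (\<psi> l)) x"
    using L2_measurable[OF L2_space_subset[OF v(1)]] L2_measurable[OF L2_space_subset[OF u]]
      L2_measurable[OF involution_L2(1)[OF L2_space_subset[OF psi[OF l]]]]
    by (intro conv_cong_AE) auto
  then show ?thesis by (simp add: kernel_projection_def v_def wavelet_transform_def)
qed

lemma parseval:
  assumes "ft f f'" "ft g g'"
  shows "L2_inner \<mu> f g = L2_inner \<nu> f' g'"
  using assms by (intro L2_inner_eqI ft_norm_sq[symmetric] ft_add ft_scale) (auto dest: ft_L2)

text \<open>Restriction to A x T, phrased through the index so that each slice is either the full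
  slice or 0.\<close>

definition cut :: "'l set \<Rightarrow> ('a \<times> 'l \<Rightarrow> complex) \<Rightarrow> 'a \<times> 'l \<Rightarrow> complex" where
  "cut T H p = (if snd p \<in> T then H p else 0)"

lemma W_add:
  assumes "ft f f'" "ft g g'" "l \<in> \<Lambda>"
  shows "W (\<lambda>x. f x + c * g x) (x, l) = W f (x, l) + c * W g (x, l)"
  unfolding wavelet_transform_def
  using conv_add_left[OF ft_L2(1)[OF assms(1)] L2_scale[OF ft_L2(1)[OF assms(2)]]
      involution_L2(1)[OF L2_space_subset[OF psi[OF assms(3)]]]]
  by (simp add: conv_scale_left)

lemma cut_norm_sq:
  assumes f: "ft f f'" and T: "T \<subseteq> \<Lambda>"
  shows "L2_norm_sq Ph (cut T (W f)) = (\<integral>\<^sup>+\<xi>. ennreal ((norm (f' \<xi>))\<^sup>2 * mass T \<xi>) \<partial>\<nu>)"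
    and "cut T (W f) \<in> L2 Ph"
proof -
  define k where "k l \<xi> = (if l \<in> T then f' \<xi> * cnj (psihat l \<xi>) else 0)" for l \<xi>
  have z: "ft (\<lambda>x. 0) (\<lambda>\<xi>. 0)" using ft_scale[OF f, of 0] by simp
  have ft: "ft (\<lambda>x. cut T (W f) (x, l)) (k l)" if "l \<in> \<Lambda>" for l
    using ft_W[OF f that] z by (cases "l \<in> T") (simp_all add: cut_def k_def[abs_def])
  show eq: "L2_norm_sq Ph (cut T (W f)) = (\<integral>\<^sup>+\<xi>. ennreal ((norm (f' \<xi>))\<^sup>2 * mass T \<xi>) \<partial>\<nu>)"
    using phase_norm_sq_two_valued[OF ft T, of "\<lambda>\<xi>. (norm (f' \<xi>))\<^sup>2" "\<lambda>_. 0"]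
    by (simp add: k_def norm_mult power_mult_distrib)
  have "\<dots> \<le> L2_norm_sq \<nu> f'"
    unfolding L2_norm_sq_def
  proof (rule nn_integral_mono_AE)
    show "AE \<xi> in \<nu>. ennreal ((norm (f' \<xi>))\<^sup>2 * mass T \<xi>) \<le> ennreal ((norm (f' \<xi>))\<^sup>2)"
      using AE_mass[OF T] by eventually_elim (auto intro!: ennreal_leI mult_left_le)
  qed
  also have "\<dots> < \<infinity>" using ft_L2(2)[OF f] by (simp add: L2_iff)
  finally have "L2_norm_sq Ph (cut T (W f)) < \<infinity>" by (simp add: eq)
  then show "cut T (W f) \<in> L2 Ph" by (intro phase_L2[OF ft])
qed

text \<open>
  Both sides are polarizations of the quadratic form \<open>\<integral> m\<^sub>T \<bar>f'\<bar>\<^sup>2\<close>, so no interchange of a sum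
  with a complex-valued integral is needed.
\<close>
lemma cut_adjoint:
  assumes f: "ft f f'" and g: "ft g g'" and u: "ft u (\<lambda>\<xi>. of_real (mass T \<xi>) * f' \<xi>)" and T: "T \<subseteq> \<Lambda>"
  shows "L2_inner \<mu> u g = L2_inner Ph (cut T (W f)) (W g)"
proof -
  \<comment> \<open>The square root divides the multiplier evenly between the two factors, which
    makes the form an inner product of two L2 functions and opens it to polarization.\<close>
  define r where "r \<xi> = complex_of_real (sqrt (mass T \<xi>))" for \<xi>
  note [measurable] = mass_measurable[OF T]
  have [measurable]: "r \<in> borel_measurable \<nu>" unfolding r_def by measurable
  have r1: "AE \<xi> in \<nu>. norm (r \<xi>) \<le> 1"
    using AE_mass[OF T] by eventually_elim (simp add: r_def)
  have L: "(\<lambda>\<xi>. h \<xi> * r \<xi>) \<in> L2 \<nu>" if "h \<in> L2 \<nu>" for h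
    by (rule L2_mult_bounded[OF that _ r1]) measurable
  have "L2_inner \<mu> u g = L2_inner \<nu> (\<lambda>\<xi>. of_real (mass T \<xi>) * f' \<xi>) g'"
    by (rule parseval[OF u g])
  also have "\<dots> = L2_inner \<nu> (\<lambda>\<xi>. f' \<xi> * r \<xi>) (\<lambda>\<xi>. g' \<xi> * r \<xi>)"
    unfolding L2_inner_def
  proof (rule integral_cong_AE)
    show "AE \<xi> in \<nu>. of_real (mass T \<xi>) * f' \<xi> * cnj (g' \<xi>) = f' \<xi> * r \<xi> * cnj (g' \<xi> * r \<xi>)"
      using AE_mass[OF T]
    proof eventually_elim
      case (elim \<xi>)
      then have "r \<xi> * cnj (r \<xi>) = of_real (mass T \<xi>)"
        by (simp add: r_def flip: of_real_mult)
      then show ?case by (simp add: algebra_simps)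
    qed
  qed (use L2_measurable[OF ft_L2(2)[OF f]] L2_measurable[OF ft_L2(2)[OF g]] in measurable)
  also have "\<dots> = L2_inner Ph (cut T (W f)) (cut T (W g))"
  proof (rule L2_inner_eqI)
    fix c
    have fg: "ft (\<lambda>x. f x + c * g x) (\<lambda>\<xi>. f' \<xi> + c * g' \<xi>)" by (intro ft_add ft_scale f g)
    have "L2_norm_sq Ph (\<lambda>p. cut T (W f) p + c * cut T (W g) p) = L2_norm_sq Ph (cut T (W (\<lambda>x. f x + c * g x)))"
      by (rule L2_norm_sq_cong) (auto simp: space_phase cut_def W_add[OF f g])
    also have "\<dots> = (\<integral>\<^sup>+\<xi>. ennreal ((norm (f' \<xi> + c * g' \<xi>))\<^sup>2 * mass T \<xi>) \<partial>\<nu>)"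
      by (rule cut_norm_sq(1)[OF fg T])
    also have "\<dots> = L2_norm_sq \<nu> (\<lambda>\<xi>. f' \<xi> * r \<xi> + c * (g' \<xi> * r \<xi>))"
      unfolding L2_norm_sq_def
    proof (rule nn_integral_cong_AE)
      show "AE \<xi> in \<nu>. ennreal ((norm (f' \<xi> + c * g' \<xi>))\<^sup>2 * mass T \<xi>) = ennreal ((norm (f' \<xi> * r \<xi> + c * (g' \<xi> * r \<xi>)))\<^sup>2)"
        using AE_mass[OF T]
      proof eventually_elim
        case (elim \<xi>)
        have "f' \<xi> * r \<xi> + c * (g' \<xi> * r \<xi>) = (f' \<xi> + c * g' \<xi>) * r \<xi>" by (simp add: algebra_simps)
        then show ?case using elim by (simp add: norm_mult power_mult_distrib r_def)
      qed
    qed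
    finally show "L2_norm_sq \<nu> (\<lambda>\<xi>. f' \<xi> * r \<xi> + c * (g' \<xi> * r \<xi>)) =
      L2_norm_sq Ph (\<lambda>p. cut T (W f) p + c * cut T (W g) p)" by (rule sym)
  qed (intro L ft_L2(2)[OF f] ft_L2(2)[OF g] cut_norm_sq(2)[OF f T] cut_norm_sq(2)[OF g T])+
  also have "\<dots> = L2_inner Ph (cut T (W f)) (W g)"
    unfolding L2_inner_def by (rule Bochner_Integration.integral_cong[OF refl]) (simp add: cut_def)
  finally show ?thesis .
qed

lemma kernel_projection_cut:
  assumes f: "f \<in> L2_space F \<mu>" "ft f f'" and T: "T \<subseteq> \<Lambda>"
    and u: "u \<in> L2_space F \<mu>" "ft u (\<lambda>\<xi>. of_real (mass T \<xi>) * f' \<xi>)"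
    and H: "\<And>p. p \<in> space Ph \<Longrightarrow> H p = cut T (W f) p" and l: "l \<in> \<Lambda>"
  shows "kernel_projection F \<mu> \<Lambda> \<psi> H (x, l) = W u (x, l)"
proof -
  have "L2_inner \<mu> u g = L2_inner Ph H (W g)" if "g \<in> L2_space F \<mu>" for g
  proof -
    have "L2_inner \<mu> u g = L2_inner Ph (cut T (W f)) (W g)"
      by (rule cut_adjoint[OF f(2) ft_fourier_L2[OF L2_space_subset[OF that]] u(2) T])
    also have "\<dots> = L2_inner Ph H (W g)" by (rule L2_inner_cong) (use H in auto)
    finally show ?thesis .
  qed
  then show ?thesis by (rule kernel_projection_eqI[OF u(1) _ l])
qed

text \<open>The case T = \<Lambda>: there the multiplier is 1 almost everywhere, and
  \<open>f\<close> itself plays the role of \<open>f_T\<close>.\<close>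

lemma kernel_projection_W:
  assumes f: "f \<in> L2_space F \<mu>" and l: "l \<in> \<Lambda>"
  shows "kernel_projection F \<mu> \<Lambda> \<psi> (W f) (x, l) = W f (x, l)"
proof -
  define f' where "f' = fourier_L2 \<mu> \<nu> f"
  have ft: "ft f f'" unfolding f'_def by (rule ft_fourier_L2[OF L2_space_subset[OF f]])
  note [measurable] = mass_measurable[OF order_refl] L2_measurable[OF ft_L2(2)[OF ft]]
  have "ft f (\<lambda>\<xi>. of_real (mass \<Lambda> \<xi>) * f' \<xi>)"
  proof (rule ft_cong_AE[OF ft])
    show "AE \<xi> in \<nu>. f' \<xi> = of_real (mass \<Lambda> \<xi>) * f' \<xi>"
      using AE_mass[OF order_refl]
    proof eventually_elim
      case (elim \<xi>)
      then have "1 - mass \<Lambda> \<xi> \<le> 0" by (simp add: nn_integral_empty ennreal_eq_0_iff)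
      then have "mass \<Lambda> \<xi> = 1" using elim by simp
      then show ?case by simp
    qed
  qed (use L2_measurable[OF L2_space_subset[OF f]] in auto)
  then show ?thesis
    by (rule kernel_projection_cut[OF f ft order_refl f _ _ l]) (auto simp: space_phase cut_def)
qed

section \<open>Cuts along sets of vertices\<close>

text \<open>One formula for three uses: \<open>t = m_T\<close> with constants 1, 0 is the
  commutator; t = 0 with 0, 1 is the restriction to the complement; \<open>t = 2 m_T - 1\<close>
  with 1, -1 compares the test signal of the stability bound with the sign flip of
  \<open>W f\<close>.\<close>

lemma phase_norm_sq_multiplier:
  assumes f: "ft f f'" and u: "ft u (\<lambda>\<xi>. of_real (t \<xi>) * f' \<xi>)" and T: "T \<subseteq> \<Lambda>"
  shows "L2_norm_sq Ph (\<lambda>p. W u p - of_real (if snd p \<in> T then c1 else c2) * W f p) =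
    (\<integral>\<^sup>+\<xi>. ennreal ((norm (f' \<xi>))\<^sup>2 * ((t \<xi> - c1)\<^sup>2 * mass T \<xi> + (t \<xi> - c2)\<^sup>2 * (1 - mass T \<xi>))) \<partial>\<nu>)"
proof -
  define c where "c l = (if l \<in> T then c1 else c2)" for l
  define k where "k l \<xi> = of_real (t \<xi>) * f' \<xi> * cnj (psihat l \<xi>) - of_real (c l) * (f' \<xi> * cnj (psihat l \<xi>))" for l \<xi>
  have ft: "ft (\<lambda>x. W u (x, l) - of_real (c l) * W f (x, l)) (k l)" if "l \<in> \<Lambda>" for l
    unfolding k_def[abs_def] by (intro ft_diff ft_scale ft_W f u that)
  have k_eq: "k l \<xi> = of_real (t \<xi> - c l) * f' \<xi> * cnj (psihat l \<xi>)" for l \<xi>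
    by (simp add: k_def algebra_simps)
  have sq: "(norm (complex_of_real r))\<^sup>2 = r\<^sup>2" for r by simp
  have "L2_norm_sq Ph (\<lambda>p. W u p - of_real (c (snd p)) * W f p) =
    (\<integral>\<^sup>+\<xi>. ennreal ((t \<xi> - c1)\<^sup>2 * (norm (f' \<xi>))\<^sup>2 * mass T \<xi> + (t \<xi> - c2)\<^sup>2 * (norm (f' \<xi>))\<^sup>2 * (1 - mass T \<xi>)) \<partial>\<nu>)"
  proof (rule phase_norm_sq_two_valued[OF _ T])
    show "ft (\<lambda>x. W u (x, l) - of_real (c (snd (x, l))) * W f (x, l)) (k l)" if "l \<in> \<Lambda>" for l
      using ft[OF that] by simp
    show "(norm (k l \<xi>))\<^sup>2 = (if l \<in> T then (t \<xi> - c1)\<^sup>2 * (norm (f' \<xi>))\<^sup>2 else (t \<xi> - c2)\<^sup>2 * (norm (f' \<xi>))\<^sup>2) * (norm (psihat l \<xi>))\<^sup>2" for l \<xi>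
      unfolding k_eq norm_mult power_mult_distrib sq by (simp add: c_def)
  qed auto
  then show ?thesis by (simp add: c_def algebra_simps)
qed

lemma vertex_weight_ft:
  assumes f: "ft f f'" and l: "l \<in> \<Lambda>"
  shows "vertex_weight \<mu> \<psi> f l = (\<integral>\<^sup>+\<xi>. ennreal ((norm (f' \<xi>))\<^sup>2) * ennreal ((norm (psihat l \<xi>))\<^sup>2) \<partial>\<nu>)"
  unfolding vertex_weight_def ft_norm_sq[OF ft_conv_psi[OF f l], symmetric]
  by (simp add: L2_norm_sq_def norm_mult power_mult_distrib ennreal_mult)

lemma edge_weight_ft:
  assumes f: "ft f f'" and l: "l \<in> \<Lambda>" "l' \<in> \<Lambda>"
  shows "edge_weight \<mu> \<psi> f (l, l') = (\<integral>\<^sup>+\<xi>. ennreal ((norm (f' \<xi>))\<^sup>2) *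
    (ennreal ((norm (psihat l \<xi>))\<^sup>2) * ennreal ((norm (psihat l' \<xi>))\<^sup>2)) \<partial>\<nu>)"
  unfolding edge_weight_def prod.case ft_norm_sq[OF ft_conv_psi[OF ft_conv_psi[OF f l(1)] l(2)], symmetric]
  by (simp add: L2_norm_sq_def norm_mult power_mult_distrib ennreal_mult mult.assoc)

lemma sum_vertex_weight:
  assumes f: "ft f f'" and T: "T \<subseteq> \<Lambda>"
  shows "infsum (vertex_weight \<mu> \<psi> f) T = (\<integral>\<^sup>+\<xi>. ennreal ((norm (f' \<xi>))\<^sup>2) *
    (\<integral>\<^sup>+l. ennreal ((norm (psihat l \<xi>))\<^sup>2) \<partial>count_space T) \<partial>\<nu>)"
proof -
  note [measurable] = L2_measurable[OF ft_L2(2)[OF f]]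
  have psim [measurable]: "psihat l \<in> borel_measurable \<nu>" if "l \<in> T" for l using that T by auto
  have "infsum (vertex_weight \<mu> \<psi> f) T = (\<integral>\<^sup>+l. vertex_weight \<mu> \<psi> f l \<partial>count_space T)"
    by (rule nn_integral_count_space_eq_infsum[OF countable_sub[OF T], symmetric])
  also have "\<dots> = (\<integral>\<^sup>+l. \<integral>\<^sup>+\<xi>. ennreal ((norm (f' \<xi>))\<^sup>2) * ennreal ((norm (psihat l \<xi>))\<^sup>2) \<partial>\<nu> \<partial>count_space T)"
    by (rule nn_integral_cong) (use vertex_weight_ft[OF f] T in auto)
  also have "\<dots> = (\<integral>\<^sup>+\<xi>. \<integral>\<^sup>+l. ennreal ((norm (f' \<xi>))\<^sup>2) * ennreal ((norm (psihat l \<xi>))\<^sup>2) \<partial>count_space T \<partial>\<nu>)"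
    by (rule nn_integral_count_space_nn_integral[symmetric, OF countable_sub[OF T]]) (use psim in measurable)
  finally show ?thesis by (simp add: nn_integral_cmult)
qed

lemma graph_vertices_subset: "graph_vertices \<mu> \<Lambda> \<psi> f \<subseteq> \<Lambda>"
  by (auto simp: graph_vertices_def)

lemma in_graph_vertices: "l \<in> \<Lambda> \<Longrightarrow> l \<in> graph_vertices \<mu> \<Lambda> \<psi> f \<longleftrightarrow> vertex_weight \<mu> \<psi> f l \<noteq> 0"
  unfolding graph_vertices_def L2_norm_pos_iff by (simp add: vertex_weight_def zero_less_iff_neq_zero)

text \<open>Indices outside the vertex set have weight 0, so the complement within the vertices may
  be enlarged to \<Lambda> - T, whose mass is \<open>1 - m_T\<close>.\<close>

lemma vertex_sums:
  assumes f: "ft f f'" and T: "T \<subseteq> graph_vertices \<mu> \<Lambda> \<psi> f"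
  shows "infsum (vertex_weight \<mu> \<psi> f) T = (\<integral>\<^sup>+\<xi>. ennreal ((norm (f' \<xi>))\<^sup>2 * mass T \<xi>) \<partial>\<nu>)" (is ?A)
    and "infsum (vertex_weight \<mu> \<psi> f) (graph_vertices \<mu> \<Lambda> \<psi> f - T) =
      (\<integral>\<^sup>+\<xi>. ennreal ((norm (f' \<xi>))\<^sup>2 * (1 - mass T \<xi>)) \<partial>\<nu>)" (is ?B)
proof -
  have T': "T \<subseteq> \<Lambda>" using T graph_vertices_subset by blast
  show ?A
    unfolding sum_vertex_weight[OF f T']
  proof (rule nn_integral_cong_AE)
    show "AE \<xi> in \<nu>. ennreal ((norm (f' \<xi>))\<^sup>2) * (\<integral>\<^sup>+l. ennreal ((norm (psihat l \<xi>))\<^sup>2) \<partial>count_space T) =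
      ennreal ((norm (f' \<xi>))\<^sup>2 * mass T \<xi>)"
      using AE_mass[OF T'] by eventually_elim (simp add: ennreal_mult)
  qed
  have "infsum (vertex_weight \<mu> \<psi> f) (graph_vertices \<mu> \<Lambda> \<psi> f - T) = infsum (vertex_weight \<mu> \<psi> f) (\<Lambda> - T)"
    by (rule infsum_cong_neutral) (use in_graph_vertices[of _ f] graph_vertices_subset[of f] in auto)
  also have "\<dots> = (\<integral>\<^sup>+\<xi>. ennreal ((norm (f' \<xi>))\<^sup>2) *
    (\<integral>\<^sup>+l. ennreal ((norm (psihat l \<xi>))\<^sup>2) \<partial>count_space (\<Lambda> - T)) \<partial>\<nu>)"
    by (rule sum_vertex_weight[OF f]) auto
  also have "\<dots> = (\<integral>\<^sup>+\<xi>. ennreal ((norm (f' \<xi>))\<^sup>2 * (1 - mass T \<xi>)) \<partial>\<nu>)"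
  proof (rule nn_integral_cong_AE)
    show "AE \<xi> in \<nu>. ennreal ((norm (f' \<xi>))\<^sup>2) * (\<integral>\<^sup>+l. ennreal ((norm (psihat l \<xi>))\<^sup>2) \<partial>count_space (\<Lambda> - T)) =
      ennreal ((norm (f' \<xi>))\<^sup>2 * (1 - mass T \<xi>))"
      using AE_mass[OF T'] by eventually_elim (simp add: ennreal_mult)
  qed
  finally show ?B .
qed

text \<open>Ensures that a pair ending outside the vertex set carries no weight.\<close>

lemma edge_weight_le_vertex_weight:
  assumes f: "ft f f'" and l: "l \<in> \<Lambda>" "l' \<in> \<Lambda>"
  shows "edge_weight \<mu> \<psi> f (l, l') \<le> vertex_weight \<mu> \<psi> f l'"
  unfolding edge_weight_ft[OF assms] vertex_weight_ft[OF f l(2)]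
proof (rule nn_integral_mono_AE)
  show "AE \<xi> in \<nu>. ennreal ((norm (f' \<xi>))\<^sup>2) * (ennreal ((norm (psihat l \<xi>))\<^sup>2) * ennreal ((norm (psihat l' \<xi>))\<^sup>2)) \<le>
    ennreal ((norm (f' \<xi>))\<^sup>2) * ennreal ((norm (psihat l' \<xi>))\<^sup>2)"
    using AE_psihat_le_1[OF l(1)]
  proof eventually_elim
    case (elim \<xi>)
    have "ennreal ((norm (psihat l \<xi>))\<^sup>2) \<le> 1"
      using elim by (simp add: power_le_one)
    then have "ennreal ((norm (psihat l \<xi>))\<^sup>2) * ennreal ((norm (psihat l' \<xi>))\<^sup>2) \<le> 1 * ennreal ((norm (psihat l' \<xi>))\<^sup>2)"
      by (rule mult_right_mono) simp
    then show ?case by (intro mult_left_mono) simp_all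
  qed
qed

text \<open>The boundary may be enlarged to the rectangle T x (\<Lambda> - T): an added pair either
  ends outside the vertex set or is not an edge, and has weight 0 in both cases. Over the rectangle
  the double sum of |psihat_l|^2 |psihat_l'|^2 factorizes.\<close>

lemma edge_sum:
  assumes f: "ft f f'" and T: "T \<subseteq> graph_vertices \<mu> \<Lambda> \<psi> f"
  shows "infsum (edge_weight \<mu> \<psi> f) (edge_boundary \<mu> \<Lambda> \<psi> f T) =
    (\<integral>\<^sup>+\<xi>. ennreal ((norm (f' \<xi>))\<^sup>2 * (mass T \<xi> * (1 - mass T \<xi>))) \<partial>\<nu>)"
proof -
  note [measurable] = L2_measurable[OF ft_L2(2)[OF f]]
  have T': "T \<subseteq> \<Lambda>" using T graph_vertices_subset by blast
  define E where "E = T \<times> (\<Lambda> - T)"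
  have cE: "Countable_Set.countable E" unfolding E_def by (intro countable_SIGMA countable_sub T') auto
  have psim [measurable]: "psihat (fst e) \<in> borel_measurable \<nu>" "psihat (snd e) \<in> borel_measurable \<nu>" if "e \<in> E" for e
    using that T' by (auto simp: E_def)
  have "infsum (edge_weight \<mu> \<psi> f) (edge_boundary \<mu> \<Lambda> \<psi> f T) = infsum (edge_weight \<mu> \<psi> f) E"
  proof (rule infsum_cong_neutral)
    fix e assume e: "e \<in> E - edge_boundary \<mu> \<Lambda> \<psi> f T"
    obtain l l' where ll: "e = (l, l')" by (cases e)
    have l: "l \<in> T" "l' \<in> \<Lambda>" "l' \<notin> T" "l \<in> \<Lambda>" using e T' by (auto simp: ll E_def)
    show "edge_weight \<mu> \<psi> f e = 0"
    proof (cases "l' \<in> graph_vertices \<mu> \<Lambda> \<psi> f")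
      case False
      then have "vertex_weight \<mu> \<psi> f l' = 0" using in_graph_vertices[OF l(2)] by simp
      then show ?thesis
        using edge_weight_le_vertex_weight[OF f l(4,2)] by (simp add: ll)
    next
      case True
      then have "(l, l') \<notin> graph_edges \<mu> \<Lambda> \<psi> f"
        using e l by (auto simp: ll E_def edge_boundary_def)
      then show ?thesis
        using True l T by (auto simp: graph_edges_def L2_norm_pos_iff edge_weight_def ll)
    qed
  qed (use T in \<open>auto simp: E_def edge_boundary_def graph_vertices_def\<close>)
  also have "\<dots> = (\<integral>\<^sup>+e. edge_weight \<mu> \<psi> f e \<partial>count_space E)"
    by (rule nn_integral_count_space_eq_infsum[OF cE, symmetric])
  also have "\<dots> = (\<integral>\<^sup>+e. \<integral>\<^sup>+\<xi>. ennreal ((norm (f' \<xi>))\<^sup>2) *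
    (ennreal ((norm (psihat (fst e) \<xi>))\<^sup>2) * ennreal ((norm (psihat (snd e) \<xi>))\<^sup>2)) \<partial>\<nu> \<partial>count_space E)"
  proof (rule nn_integral_cong)
    fix e assume "e \<in> space (count_space E)"
    then have "fst e \<in> \<Lambda>" "snd e \<in> \<Lambda>" using T' by (auto simp: E_def)
    from edge_weight_ft[OF f this] show "edge_weight \<mu> \<psi> f e = (\<integral>\<^sup>+\<xi>. ennreal ((norm (f' \<xi>))\<^sup>2) *
      (ennreal ((norm (psihat (fst e) \<xi>))\<^sup>2) * ennreal ((norm (psihat (snd e) \<xi>))\<^sup>2)) \<partial>\<nu>)" by simp
  qed
  also have "\<dots> = (\<integral>\<^sup>+\<xi>. \<integral>\<^sup>+e. ennreal ((norm (f' \<xi>))\<^sup>2) *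
    (ennreal ((norm (psihat (fst e) \<xi>))\<^sup>2) * ennreal ((norm (psihat (snd e) \<xi>))\<^sup>2)) \<partial>count_space E \<partial>\<nu>)"
    by (rule nn_integral_count_space_nn_integral[symmetric, OF cE]) (use psim in measurable)
  also have "\<dots> = (\<integral>\<^sup>+\<xi>. ennreal ((norm (f' \<xi>))\<^sup>2 * (mass T \<xi> * (1 - mass T \<xi>))) \<partial>\<nu>)"
  proof (rule nn_integral_cong_AE)
    show "AE \<xi> in \<nu>. (\<integral>\<^sup>+e. ennreal ((norm (f' \<xi>))\<^sup>2) *
      (ennreal ((norm (psihat (fst e) \<xi>))\<^sup>2) * ennreal ((norm (psihat (snd e) \<xi>))\<^sup>2)) \<partial>count_space E) =
      ennreal ((norm (f' \<xi>))\<^sup>2 * (mass T \<xi> * (1 - mass T \<xi>)))"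
      using AE_mass[OF T']
    proof eventually_elim
      case (elim \<xi>)
      have "(\<integral>\<^sup>+e. ennreal ((norm (psihat (fst e) \<xi>))\<^sup>2) * ennreal ((norm (psihat (snd e) \<xi>))\<^sup>2) \<partial>count_space E) =
        ennreal (mass T \<xi>) * ennreal (1 - mass T \<xi>)"
        unfolding E_def
        by (subst nn_integral_count_space_prod[OF countable_sub[OF T'] countable_sub,
              of "\<Lambda> - T" "\<lambda>l. ennreal ((norm (psihat l \<xi>))\<^sup>2)" "\<lambda>l. ennreal ((norm (psihat l \<xi>))\<^sup>2)"])
           (use elim in auto)
      then show ?case using elim by (simp add: nn_integral_cmult ennreal_mult)
    qed
  qed
  finally show ?thesis .
qed

lemma commutator_norm_sq:
  assumes f: "f \<in> L2_space F \<mu>" "ft f f'" and T: "T \<subseteq> \<Lambda>"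
  shows "L2_norm_sq Ph (kernel_commutator F \<mu> \<Lambda> \<psi> (UNIV \<times> T) (W f)) =
    (\<integral>\<^sup>+\<xi>. ennreal ((norm (f' \<xi>))\<^sup>2 * (mass T \<xi> * (1 - mass T \<xi>))) \<partial>\<nu>)"
proof -
  obtain u where u: "u \<in> L2_space F \<mu>" "ft u (\<lambda>\<xi>. of_real (mass T \<xi>) * f' \<xi>)"
    using multiplier_exists[OF f T] by blast
  have "L2_norm_sq Ph (kernel_commutator F \<mu> \<Lambda> \<psi> (UNIV \<times> T) (W f)) =
    L2_norm_sq Ph (\<lambda>p. W u p - of_real (if snd p \<in> T then 1 else 0) * W f p)"
  proof (rule L2_norm_sq_cong)
    fix p assume "p \<in> space Ph"
    then obtain x l where p: "p = (x, l)" "l \<in> \<Lambda>" by (auto simp: space_phase)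
    have "kernel_projection F \<mu> \<Lambda> \<psi> (restrict_to (UNIV \<times> T) (W f)) (x, l) = W u (x, l)"
      by (rule kernel_projection_cut[OF f T u _ p(2)]) (auto simp: restrict_to_def cut_def indicator_def)
    then show "norm (kernel_commutator F \<mu> \<Lambda> \<psi> (UNIV \<times> T) (W f) p) =
      norm (W u p - of_real (if snd p \<in> T then 1 else 0) * W f p)"
      using kernel_projection_W[OF f(1) p(2)]
      by (simp add: kernel_commutator_def restrict_to_def p(1) indicator_def)
  qed
  also have "\<dots> = (\<integral>\<^sup>+\<xi>. ennreal ((norm (f' \<xi>))\<^sup>2 * ((mass T \<xi> - 1)\<^sup>2 * mass T \<xi> + (mass T \<xi> - 0)\<^sup>2 * (1 - mass T \<xi>))) \<partial>\<nu>)"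
    by (rule phase_norm_sq_multiplier[OF f(2) u(2) T])
  \<comment> \<open>With m the mass, (m - 1)^2 m + m^2 (1 - m) = m (1 - m).\<close>
  also have "\<dots> = (\<integral>\<^sup>+\<xi>. ennreal ((norm (f' \<xi>))\<^sup>2 * (mass T \<xi> * (1 - mass T \<xi>))) \<partial>\<nu>)"
    by (rule nn_integral_cong, rule arg_cong[where f=ennreal], rule arg_cong2[where f="(*)"])
      (auto simp: power2_eq_square algebra_simps)
  finally show ?thesis .
qed

lemma restrict_norm_sq:
  assumes f: "ft f f'" and T: "T \<subseteq> \<Lambda>"
  shows "L2_norm_sq Ph (restrict_to (UNIV \<times> T) (W f)) = (\<integral>\<^sup>+\<xi>. ennreal ((norm (f' \<xi>))\<^sup>2 * mass T \<xi>) \<partial>\<nu>)"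
    and "L2_norm_sq Ph (restrict_to (space Ph - UNIV \<times> T) (W f)) =
      (\<integral>\<^sup>+\<xi>. ennreal ((norm (f' \<xi>))\<^sup>2 * (1 - mass T \<xi>)) \<partial>\<nu>)"
proof -
  have "L2_norm_sq Ph (restrict_to (UNIV \<times> T) (W f)) = L2_norm_sq Ph (cut T (W f))"
    by (rule L2_norm_sq_cong) (auto simp: restrict_to_def cut_def indicator_def)
  then show "L2_norm_sq Ph (restrict_to (UNIV \<times> T) (W f)) = (\<integral>\<^sup>+\<xi>. ennreal ((norm (f' \<xi>))\<^sup>2 * mass T \<xi>) \<partial>\<nu>)"
    using cut_norm_sq(1)[OF f T] by simp
  have z: "ft (\<lambda>x. 0) (\<lambda>\<xi>. of_real 0 * f' \<xi>)" using ft_scale[OF f, of 0] by simp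
  have "L2_norm_sq Ph (restrict_to (space Ph - UNIV \<times> T) (W f)) =
    L2_norm_sq Ph (\<lambda>p. W (\<lambda>x. 0) p - of_real (if snd p \<in> T then 0 else 1) * W f p)"
    by (rule L2_norm_sq_cong)
       (auto simp: restrict_to_def indicator_def wavelet_transform_def conv_def)
  also have "\<dots> = (\<integral>\<^sup>+\<xi>. ennreal ((norm (f' \<xi>))\<^sup>2 * (1 - mass T \<xi>)) \<partial>\<nu>)"
    using phase_norm_sq_multiplier[OF f z T, of 0 1] by simp
  finally show "L2_norm_sq Ph (restrict_to (space Ph - UNIV \<times> T) (W f)) =
      (\<integral>\<^sup>+\<xi>. ennreal ((norm (f' \<xi>))\<^sup>2 * (1 - mass T \<xi>)) \<partial>\<nu>)" .
qed

text \<open>Vertices have positive weight, so both sides of a proper cut do as well; this makes the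
  corresponding set admissible for the kernel constant and keeps its denominator positive.\<close>

lemma vertex_sum_pos:
  assumes T: "T \<subseteq> graph_vertices \<mu> \<Lambda> \<psi> f" "T \<noteq> {}"
  shows "0 < infsum (vertex_weight \<mu> \<psi> f) T"
proof -
  have T': "T \<subseteq> \<Lambda>" using T graph_vertices_subset by blast
  have "infsum (vertex_weight \<mu> \<psi> f) T \<noteq> 0"
    using T T' unfolding nn_integral_count_space_eq_infsum[OF countable_sub[OF T'], symmetric]
    by (subst nn_integral_0_iff_AE) (auto simp: AE_count_space in_graph_vertices subset_iff)
  then show ?thesis by (simp add: zero_less_iff_neq_zero)
qed

lemma kernel_cheeger_le_cut:
  assumes f: "f \<in> L2_space F \<mu>" and T: "T \<noteq> {}" "T \<subset> graph_vertices \<mu> \<Lambda> \<psi> f"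
  shows "kernel_cheeger F \<mu> \<Lambda> \<psi> (W f) \<le> infsum (edge_weight \<mu> \<psi> f) (edge_boundary \<mu> \<Lambda> \<psi> f T) /
    min (infsum (vertex_weight \<mu> \<psi> f) T) (infsum (vertex_weight \<mu> \<psi> f) (graph_vertices \<mu> \<Lambda> \<psi> f - T))"
proof -
  define f' where "f' = fourier_L2 \<mu> \<nu> f"
  have ft: "ft f f'" unfolding f'_def by (rule ft_fourier_L2[OF L2_space_subset[OF f]])
  have TV: "T \<subseteq> graph_vertices \<mu> \<Lambda> \<psi> f" using T by blast
  then have T': "T \<subseteq> \<Lambda>" using graph_vertices_subset by blast
  let ?S = "UNIV \<times> T :: ('a \<times> 'l) set"
  have S: "?S \<in> sets Ph"
    unfolding phase_space_def by (rule pair_measureI) (use T' in auto)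
  have pos: "0 < L2_norm Ph (restrict_to ?S (W f))" "0 < L2_norm Ph (restrict_to (space Ph - ?S) (W f))"
    using vertex_sum_pos[OF TV T(1)] vertex_sum_pos[of "graph_vertices \<mu> \<Lambda> \<psi> f - T" f] T
    unfolding L2_norm_pos_iff restrict_norm_sq[OF ft T'] vertex_sums[OF ft TV] by auto
  have "kernel_cheeger F \<mu> \<Lambda> \<psi> (W f) \<le> L2_norm_sq Ph (kernel_commutator F \<mu> \<Lambda> \<psi> ?S (W f)) /
     min (L2_norm_sq Ph (restrict_to ?S (W f))) (L2_norm_sq Ph (restrict_to (space Ph - ?S) (W f)))"
    unfolding kernel_cheeger_def Let_def using S pos by (auto intro!: INF_lower)
  then show ?thesis
    unfolding commutator_norm_sq[OF f ft T'] restrict_norm_sq[OF ft T'] vertex_sums[OF ft TV] edge_sum[OF ft TV] .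
qed

section \<open>Graphs with a single vertex\<close>

lemma phase_norm_sq_concentrated:
  fixes G :: "'a \<times> 'l \<Rightarrow> complex"
  assumes l0: "l0 \<in> \<Lambda>" and [measurable]: "\<And>l. l \<in> \<Lambda> \<Longrightarrow> (\<lambda>x. G (x, l)) \<in> borel_measurable \<mu>"
    and zero: "\<And>l. l \<in> \<Lambda> \<Longrightarrow> l \<noteq> l0 \<Longrightarrow> AE x in \<mu>. G (x, l) = 0"
  shows "L2_norm_sq Ph G = L2_norm_sq \<mu> (\<lambda>x. G (x, l0))"
proof -
  have z: "L2_norm_sq \<mu> (\<lambda>x. G (x, l)) = 0" if "l \<in> \<Lambda>" "l \<noteq> l0" for l
    using zero[OF that] that by (subst L2_norm_sq_eq_0_iff) auto
  have "L2_norm_sq Ph G = (\<integral>\<^sup>+l. L2_norm_sq \<mu> (\<lambda>x. G (x, l)) \<partial>count_space \<Lambda>)"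
    by (rule phase_norm_sq) measurable
  also have "\<dots> = (\<integral>\<^sup>+l. L2_norm_sq \<mu> (\<lambda>x. G (x, l)) \<partial>count_space {l0})"
    by (rule nn_integral_count_space_eq) (use z l0 in auto)
  finally show ?thesis by (simp add: nn_integral_count_space_finite)
qed

lemma phase_slice_sets:
  assumes "S \<in> sets Ph"
  shows "{x. (x, l) \<in> S} \<in> sets \<mu>"
  using sets_Pair2[of S \<mu> "count_space \<Lambda>" l] assms
  by (simp add: phase_space_def vimage_def)

text \<open>
  If only one vertex \<open>l0\<close> survives, \<open>W f\<close> lives on the single slice \<open>l0\<close>, and the adjoint of a
  function \<open>h\<close> on that slice is simply \<open>h * \<psi>\<^sub>l\<^sub>0\<close>.
\<close>
lemma kernel_projection_single_slice:
  assumes f: "f \<in> L2_space F \<mu>" and l0: "l0 \<in> \<Lambda>" and S: "S \<in> sets Ph"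
    and zero: "\<And>l. l \<in> \<Lambda> \<Longrightarrow> l \<noteq> l0 \<Longrightarrow> AE x in \<mu>. W f (x, l) = 0"
    and l: "l \<in> \<Lambda>"
  defines "h \<equiv> \<lambda>x. restrict_to S (W f) (x, l0)"
  shows "h \<in> L2_space F \<mu>"
    and "kernel_projection F \<mu> \<Lambda> \<psi> (restrict_to S (W f)) (x, l) = W (conv \<mu> h (\<psi> l0)) (x, l)"
proof -
  define H where "H = restrict_to S (W f)"
  have Wm [measurable]: "(\<lambda>x. W g (x, l)) \<in> borel_measurable \<mu>" if "g \<in> L2_space F \<mu>" "l \<in> \<Lambda>" for g l
    by (rule L2_measurable[OF L2_space_subset[OF W_slice_scalars[OF that]]])
  have [measurable]: "{x. (x, l) \<in> S} \<in> sets \<mu>" for l by (rule phase_slice_sets[OF S])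
  have H_eq: "H (x, l) = W f (x, l) * indicator {x. (x, l) \<in> S} x" for x l
    by (simp add: H_def restrict_to_def indicator_def)
  have Hm [measurable]: "(\<lambda>x. H (x, l)) \<in> borel_measurable \<mu>" if "l \<in> \<Lambda>" for l
    unfolding H_eq using Wm[OF f that] by measurable
  have H0: "AE x in \<mu>. H (x, l) = 0" if "l \<in> \<Lambda>" "l \<noteq> l0" for l
    using zero[OF that] by eventually_elim (simp add: H_eq)
  have h_eq: "h x = H (x, l0)" for x by (simp add: h_def H_def)
  have hL: "h \<in> L2 \<mu>"
    by (rule L2_dominated[OF L2_space_subset[OF W_slice_scalars[OF f l0]]])
       (use Hm[OF l0] in \<open>auto simp: h_eq[abs_def] H_eq indicator_def\<close>)
  show h: "h \<in> L2_space F \<mu>"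
    by (rule L2_spaceI[OF hL]) (use W_scalars[OF f l0] scalars_closed in \<open>auto simp: h_eq H_eq indicator_def\<close>)
  define h' where "h' = fourier_L2 \<mu> \<nu> h"
  have fth: "ft h h'" unfolding h'_def by (rule ft_fourier_L2[OF hL])
  have "L2_inner \<mu> (conv \<mu> h (\<psi> l0)) g = L2_inner Ph H (W g)" if g: "g \<in> L2_space F \<mu>" for g
  proof -
    define g' where "g' = fourier_L2 \<mu> \<nu> g"
    have ftg: "ft g g'" unfolding g'_def by (rule ft_fourier_L2[OF L2_space_subset[OF g]])
    \<comment> \<open>Off a null set \<open>H\<close> is its own restriction to the slice of
      \<open>l0\<close>, so norms and inner products may be computed there.\<close>
    have AE_H: "AE p in Ph. H p - cut {l0} H p = 0"
    proof (subst L2_norm_sq_eq_0_iff[symmetric])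
      have m: "(\<lambda>x. H (x, l) - cut {l0} H (x, l)) \<in> borel_measurable \<mu>" if "l \<in> \<Lambda>" for l
        using Hm[OF that] by (cases "l = l0") (simp_all add: cut_def)
      then show "(\<lambda>p. H p - cut {l0} H p) \<in> borel_measurable Ph" by (rule phase_measurable)
      have "L2_norm_sq Ph (\<lambda>p. H p - cut {l0} H p) = L2_norm_sq \<mu> (\<lambda>x. H (x, l0) - cut {l0} H (x, l0))"
        by (rule phase_norm_sq_concentrated[OF l0 m]) (use H0 in \<open>auto simp: cut_def\<close>)
      then show "L2_norm_sq Ph (\<lambda>p. H p - cut {l0} H p) = 0"
        by (simp add: cut_def L2_norm_sq_def)
    qed
    have norm_eq: "L2_norm_sq Ph (\<lambda>p. cut {l0} H p + c * cut {l0} (W g) p) =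
        L2_norm_sq \<mu> (\<lambda>x. h x + c * W g (x, l0))" for c
    proof -
      have "(\<lambda>x. cut {l0} H (x, l) + c * cut {l0} (W g) (x, l)) \<in> borel_measurable \<mu>" if "l \<in> \<Lambda>" for l
        using Hm[OF that] Wm[OF g that] by (cases "l = l0") (simp_all add: cut_def)
      then have "L2_norm_sq Ph (\<lambda>p. cut {l0} H p + c * cut {l0} (W g) p) =
        L2_norm_sq \<mu> (\<lambda>x. cut {l0} H (x, l0) + c * cut {l0} (W g) (x, l0))"
        by (rule phase_norm_sq_concentrated[OF l0]) (simp_all add: cut_def)
      then show ?thesis by (simp add: cut_def h_eq)
    qed
    have HL: "cut {l0} H \<in> L2 Ph"
    proof -
      have "(\<lambda>x. cut {l0} H (x, l)) \<in> borel_measurable \<mu>" if "l \<in> \<Lambda>" for l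
        using Hm[OF that] by (cases "l = l0") (simp_all add: cut_def)
      then have "cut {l0} H \<in> borel_measurable Ph" by (rule phase_measurable)
      moreover have "L2_norm_sq Ph (cut {l0} H) < \<infinity>"
        using norm_eq[of 0] hL by (simp add: L2_iff)
      ultimately show ?thesis by (simp add: L2_iff)
    qed
    have gL: "cut {l0} (W g) \<in> L2 Ph" by (rule cut_norm_sq(2)[OF ftg]) (use l0 in simp)
    \<comment> \<open>On the Fourier side the adjoint of multiplication by
      \<open>cnj (psihat l0)\<close> is multiplication by \<open>psihat l0\<close>; the result is
      then moved from the slice to phase space by polarization.\<close>
    have "L2_inner \<mu> (conv \<mu> h (\<psi> l0)) g = L2_inner \<nu> (\<lambda>\<xi>. h' \<xi> * psihat l0 \<xi>) g'"
      by (rule parseval[OF ft_conv_psi[OF fth l0] ftg])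
    also have "\<dots> = L2_inner \<nu> h' (\<lambda>\<xi>. g' \<xi> * cnj (psihat l0 \<xi>))"
      by (simp add: L2_inner_def mult_ac)
    also have "\<dots> = L2_inner \<mu> h (\<lambda>x. W g (x, l0))"
      by (rule parseval[OF fth ft_W[OF ftg l0], symmetric])
    also have "\<dots> = L2_inner Ph (cut {l0} H) (cut {l0} (W g))"
      by (rule L2_inner_eqI[OF hL ft_L2(1)[OF ft_W[OF ftg l0]] HL gL]) (simp add: norm_eq)
    also have "\<dots> = L2_inner Ph (cut {l0} H) (W g)"
      unfolding L2_inner_def by (rule Bochner_Integration.integral_cong[OF refl]) (simp add: cut_def)
    also have "\<dots> = L2_inner Ph H (W g)"
      unfolding L2_inner_def
    proof (rule integral_cong_AE)
      have "W g \<in> borel_measurable Ph" "H \<in> borel_measurable Ph"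
        using Wm[OF g] Hm by (auto intro: phase_measurable)
      then show "(\<lambda>p. cut {l0} H p * cnj (W g p)) \<in> borel_measurable Ph" "(\<lambda>p. H p * cnj (W g p)) \<in> borel_measurable Ph"
        using L2_measurable[OF HL] by measurable
      show "AE p in Ph. cut {l0} H p * cnj (W g p) = H p * cnj (W g p)"
        using AE_H by eventually_elim simp
    qed
    finally show ?thesis .
  qed
  then show "kernel_projection F \<mu> \<Lambda> \<psi> (restrict_to S (W f)) (x, l) = W (conv \<mu> h (\<psi> l0)) (x, l)"
    unfolding H_def by (rule kernel_projection_eqI[OF conv_psi_scalars[OF h l0] _ l])
qed

text \<open>Slices of \<open>W f\<close> and convolutions with \<open>\<psi> l\<close> have
  transforms of equal modulus, so the slices at non-vertices vanish. Likewise the complement of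
  \<open>l0\<close> has total weight 0, which confines \<open>f'\<close> to frequencies where
  |psihat_l0| = 1.\<close>

lemma single_vertex_vanishing:
  assumes ft: "ft f f'" and V: "graph_vertices \<mu> \<Lambda> \<psi> f = {l0}"
  shows "\<And>l. l \<in> \<Lambda> \<Longrightarrow> l \<noteq> l0 \<Longrightarrow> AE x in \<mu>. W f (x, l) = 0"
    and "AE \<xi> in \<nu>. f' \<xi> * of_real (1 - mass {l0} \<xi>) = 0"
proof -
  fix l assume l: "l \<in> \<Lambda>" "l \<noteq> l0"
  have "L2_norm_sq \<mu> (\<lambda>x. W f (x, l)) = L2_norm_sq \<nu> (\<lambda>\<xi>. f' \<xi> * cnj (psihat l \<xi>))"
    by (rule ft_norm_sq[OF ft_W[OF ft l(1)], symmetric])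
  also have "\<dots> = L2_norm_sq \<nu> (\<lambda>\<xi>. f' \<xi> * psihat l \<xi>)"
    by (rule L2_norm_sq_cong) (simp add: norm_mult)
  also have "\<dots> = vertex_weight \<mu> \<psi> f l"
    unfolding vertex_weight_def by (rule ft_norm_sq[OF ft_conv_psi[OF ft l(1)]])
  also have "\<dots> = 0" using in_graph_vertices[OF l(1), of f] V l(2) by simp
  finally show "AE x in \<mu>. W f (x, l) = 0"
    using L2_measurable[OF ft_L2(1)[OF ft_W[OF ft l(1)]]] by (simp add: L2_norm_sq_eq_0_iff)
next
  have l0: "{l0} \<subseteq> \<Lambda>" using V graph_vertices_subset[of f] by simp
  note [measurable] = mass_measurable[OF l0] L2_measurable[OF ft_L2(2)[OF ft]]
  have "(\<integral>\<^sup>+\<xi>. ennreal ((norm (f' \<xi>))\<^sup>2 * (1 - mass {l0} \<xi>)) \<partial>\<nu>) = 0"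
    using vertex_sums(2)[OF ft, of "{l0}"] V by simp
  then have "AE \<xi> in \<nu>. ennreal ((norm (f' \<xi>))\<^sup>2 * (1 - mass {l0} \<xi>)) = 0"
    by (subst (asm) nn_integral_0_iff_AE) auto
  then show "AE \<xi> in \<nu>. f' \<xi> * of_real (1 - mass {l0} \<xi>) = 0"
    using AE_mass[OF l0]
  proof eventually_elim
    case (elim \<xi>)
    then have "(norm (f' \<xi>))\<^sup>2 * (1 - mass {l0} \<xi>) \<le> 0" "0 \<le> 1 - mass {l0} \<xi>"
      by (auto simp: ennreal_eq_0_iff)
    moreover have "0 \<le> (norm (f' \<xi>))\<^sup>2 * (1 - mass {l0} \<xi>)"
      using calculation(2) by (intro mult_nonneg_nonneg) auto
    ultimately have "(norm (f' \<xi>))\<^sup>2 * (1 - mass {l0} \<xi>) = 0" by linarith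
    then show ?case by auto
  qed
qed

text \<open>An admissible set need not be a product, but \<open>W f\<close> lives on one slice,
  which it splits into \<open>h\<close> and \<open>hc\<close>. The commutator has squared norm
  \<integral>|h'|^2 (1 - m), clearly at most the squared norm of \<open>h\<close>. Where m < 1 the
  transform of \<open>f\<close> vanishes, so \<open>h'\<close> and \<open>hc'\<close> are opposite
  there, which gives the bound by \<open>hc\<close>. If no set is admissible, the constant is 1 by
  convention.\<close>

lemma kernel_cheeger_le_1:
  assumes f: "f \<in> L2_space F \<mu>" and V: "graph_vertices \<mu> \<Lambda> \<psi> f = {l0}"
  shows "kernel_cheeger F \<mu> \<Lambda> \<psi> (W f) \<le> 1"
proof -
  define f' where "f' = fourier_L2 \<mu> \<nu> f"
  have ft: "ft f f'" unfolding f'_def by (rule ft_fourier_L2[OF L2_space_subset[OF f]])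
  have l0: "l0 \<in> \<Lambda>" and l0': "{l0} \<subseteq> \<Lambda>" using V graph_vertices_subset[of f] by auto
  note zero = single_vertex_vanishing(1)[OF ft V] and f'0 = single_vertex_vanishing(2)[OF ft V]
  have quot: "L2_norm_sq Ph (kernel_commutator F \<mu> \<Lambda> \<psi> S (W f)) /
      min (L2_norm_sq Ph (restrict_to S (W f))) (L2_norm_sq Ph (restrict_to (space Ph - S) (W f))) \<le> 1"
    if S: "S \<in> sets Ph" and pos: "0 < L2_norm Ph (restrict_to S (W f))" "0 < L2_norm Ph (restrict_to (space Ph - S) (W f))" for S
  proof -
    have Sc: "space Ph - S \<in> sets Ph" using S by auto
    define h where "h x = restrict_to S (W f) (x, l0)" for x
    define hc where "hc x = restrict_to (space Ph - S) (W f) (x, l0)" for x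
    have h: "h \<in> L2_space F \<mu>"
      unfolding h_def by (rule kernel_projection_single_slice(1)[OF f l0 S zero l0])
    define h' where "h' = fourier_L2 \<mu> \<nu> h"
    have fth: "ft h h'" unfolding h'_def by (rule ft_fourier_L2[OF L2_space_subset[OF h]])
    define hc' where "hc' \<xi> = f' \<xi> * cnj (psihat l0 \<xi>) - h' \<xi>" for \<xi>
    have hc_eq: "hc = (\<lambda>x. W f (x, l0) - h x)"
      using l0 by (auto simp: fun_eq_iff hc_def h_def restrict_to_def indicator_def space_phase)
    have fthc: "ft hc hc'"
      unfolding hc_eq hc'_def[abs_def] by (rule ft_diff[OF ft_W[OF ft l0] fth])
    have slice: "(\<lambda>x. restrict_to R (W f) (x, l)) \<in> borel_measurable \<mu>" if R: "R \<in> sets Ph" and l: "l \<in> \<Lambda>" for R l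
    proof -
      have [measurable]: "{x. (x, l) \<in> R} \<in> sets \<mu>" by (rule phase_slice_sets[OF R])
      have "(\<lambda>x. W f (x, l) * indicator {x. (x, l) \<in> R} x) \<in> borel_measurable \<mu>"
        using L2_measurable[OF ft_L2(1)[OF ft_W[OF ft l]]] by measurable
      then show ?thesis by (simp add: restrict_to_def indicator_def)
    qed
    have slice0: "AE x in \<mu>. restrict_to R (W f) (x, l) = 0" if "l \<in> \<Lambda>" "l \<noteq> l0" for R l
      using zero[OF that] by eventually_elim (simp add: restrict_to_def)
    have norm_h: "L2_norm_sq Ph (restrict_to S (W f)) = L2_norm_sq \<nu> h'"
      using phase_norm_sq_concentrated[OF l0 slice[OF S] slice0] ft_norm_sq[OF fth] by (simp add: h_def[abs_def])
    have norm_hc: "L2_norm_sq Ph (restrict_to (space Ph - S) (W f)) = L2_norm_sq \<nu> hc'"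
      using phase_norm_sq_concentrated[OF l0 slice[OF Sc] slice0] ft_norm_sq[OF fthc] by (simp add: hc_def[abs_def])
    \<comment> \<open>The first term is the transform of the projection of the slice
      \<open>h\<close>, the second that of the restriction of \<open>W f\<close>, which
      \<open>K\<close> fixes.\<close>
    define k where "k l \<xi> = h' \<xi> * psihat l0 \<xi> * cnj (psihat l \<xi>) - (if l = l0 then h' \<xi> else 0)" for l \<xi>
    have "L2_norm_sq Ph (kernel_commutator F \<mu> \<Lambda> \<psi> S (W f)) =
      (\<integral>\<^sup>+\<xi>. \<integral>\<^sup>+l. ennreal ((norm (k l \<xi>))\<^sup>2) \<partial>count_space \<Lambda> \<partial>\<nu>)"
    proof (rule phase_norm_sq_ft)
      fix l assume l: "l \<in> \<Lambda>"
      have "ft (\<lambda>x. restrict_to S (W f) (x, l)) (\<lambda>\<xi>. if l = l0 then h' \<xi> else 0)"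
      proof (cases "l = l0")
        case True
        then show ?thesis using fth by (simp add: h_def[abs_def])
      next
        case False
        have z: "ft (\<lambda>x. 0) (\<lambda>\<xi>. 0)" using ft_scale[OF ft, of 0] by simp
        show ?thesis
          by (rule ft_cong_AE[OF z slice[OF S l]]) (use slice0[OF l False, of S] False in \<open>auto elim: eventually_mono\<close>)
      qed
      from ft_diff[OF ft_W[OF ft_conv_psi[OF fth l0] l] this]
      show "ft (\<lambda>x. kernel_commutator F \<mu> \<Lambda> \<psi> S (W f) (x, l)) (k l)"
        using kernel_projection_single_slice(2)[OF f l0 S zero l] kernel_projection_W[OF f l]
        by (simp add: kernel_commutator_def k_def[abs_def] h_def[abs_def] restrict_to_def)
    qed
    also have "\<dots> = (\<integral>\<^sup>+\<xi>. ennreal ((norm (h' \<xi>))\<^sup>2 * (1 - mass {l0} \<xi>)) \<partial>\<nu>)"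
    proof (rule nn_integral_cong_AE)
      show "AE \<xi> in \<nu>. (\<integral>\<^sup>+l. ennreal ((norm (k l \<xi>))\<^sup>2) \<partial>count_space \<Lambda>) = ennreal ((norm (h' \<xi>))\<^sup>2 * (1 - mass {l0} \<xi>))"
        using AE_mass[OF l0']
      proof eventually_elim
        case (elim \<xi>)
        let ?m = "mass {l0} \<xi>"
        have m: "0 \<le> ?m" "?m \<le> 1" "(norm (psihat l0 \<xi>))\<^sup>2 = ?m" using elim by (simp_all add: mass_singleton)
        have "k l0 \<xi> = h' \<xi> * (psihat l0 \<xi> * cnj (psihat l0 \<xi>) - 1)" by (simp add: k_def algebra_simps)
        also have "psihat l0 \<xi> * cnj (psihat l0 \<xi>) - 1 = of_real (?m - 1)"
          using m(3) complex_norm_square[of "psihat l0 \<xi>"] by simp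
        finally have k0: "(norm (k l0 \<xi>))\<^sup>2 = (norm (h' \<xi>))\<^sup>2 * (?m - 1)\<^sup>2"
          by (simp add: norm_mult power_mult_distrib del: of_real_diff)
        have "(\<integral>\<^sup>+l. ennreal ((norm (k l \<xi>))\<^sup>2) \<partial>count_space (\<Lambda> - {l0})) =
          (\<integral>\<^sup>+l. ennreal ((norm (h' \<xi>))\<^sup>2 * ?m) * ennreal ((norm (psihat l \<xi>))\<^sup>2) \<partial>count_space (\<Lambda> - {l0}))"
          by (rule nn_integral_cong) (use m in \<open>auto simp: k_def norm_mult power_mult_distrib ennreal_mult\<close>)
        also have "\<dots> = ennreal ((norm (h' \<xi>))\<^sup>2 * ?m * (1 - ?m))"
          using elim m by (simp add: nn_integral_cmult ennreal_mult)
        finally have "(\<integral>\<^sup>+l. ennreal ((norm (k l \<xi>))\<^sup>2) \<partial>count_space \<Lambda>) =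
          ennreal ((norm (h' \<xi>))\<^sup>2 * (?m - 1)\<^sup>2) + ennreal ((norm (h' \<xi>))\<^sup>2 * ?m * (1 - ?m))"
          by (subst nn_integral_count_space_split[OF l0']) (simp add: nn_integral_count_space_finite k0)
        also have "\<dots> = ennreal ((norm (h' \<xi>))\<^sup>2 * (?m - 1)\<^sup>2 + (norm (h' \<xi>))\<^sup>2 * ?m * (1 - ?m))"
          using m by (subst ennreal_plus) auto
        \<comment> \<open>The slice of \<open>l0\<close> contributes (m - 1)^2 and all the others
          together m (1 - m), in sum 1 - m.\<close>
        also have "(norm (h' \<xi>))\<^sup>2 * (?m - 1)\<^sup>2 + (norm (h' \<xi>))\<^sup>2 * ?m * (1 - ?m) = (norm (h' \<xi>))\<^sup>2 * (1 - ?m)"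
          by (simp add: power2_eq_square algebra_simps)
        finally show ?case .
      qed
    qed
    finally have comm: "L2_norm_sq Ph (kernel_commutator F \<mu> \<Lambda> \<psi> S (W f)) =
      (\<integral>\<^sup>+\<xi>. ennreal ((norm (h' \<xi>))\<^sup>2 * (1 - mass {l0} \<xi>)) \<partial>\<nu>)" .
    have "\<dots> \<le> L2_norm_sq \<nu> h'"
      unfolding L2_norm_sq_def
    proof (rule nn_integral_mono_AE)
      show "AE \<xi> in \<nu>. ennreal ((norm (h' \<xi>))\<^sup>2 * (1 - mass {l0} \<xi>)) \<le> ennreal ((norm (h' \<xi>))\<^sup>2)"
        using AE_mass[OF l0'] by eventually_elim (auto intro!: ennreal_leI mult_left_le)
    qed
    moreover have "(\<integral>\<^sup>+\<xi>. ennreal ((norm (h' \<xi>))\<^sup>2 * (1 - mass {l0} \<xi>)) \<partial>\<nu>) \<le> L2_norm_sq \<nu> hc'"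
      unfolding L2_norm_sq_def
    proof (rule nn_integral_mono_AE)
      show "AE \<xi> in \<nu>. ennreal ((norm (h' \<xi>))\<^sup>2 * (1 - mass {l0} \<xi>)) \<le> ennreal ((norm (hc' \<xi>))\<^sup>2)"
        using AE_mass[OF l0'] f'0
      proof eventually_elim
        case (elim \<xi>)
        \<comment> \<open>For mass 1 the left side is 0; otherwise \<open>f'\<close> vanishes, and
          \<open>hc'\<close> is \<open>- h'\<close>.\<close>
        show ?case
        proof (cases "mass {l0} \<xi> = 1")
          case False
          then have "1 - mass {l0} \<xi> \<noteq> 0" by simp
          then have "f' \<xi> = 0" using elim(2) by (simp del: of_real_diff)
          then have "norm (hc' \<xi>) = norm (h' \<xi>)" by (simp add: hc'_def)
          then show ?thesis using elim(1) by (auto intro!: ennreal_leI mult_left_le)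
        qed simp
      qed
    qed
    ultimately have "L2_norm_sq Ph (kernel_commutator F \<mu> \<Lambda> \<psi> S (W f)) \<le>
      min (L2_norm_sq Ph (restrict_to S (W f))) (L2_norm_sq Ph (restrict_to (space Ph - S) (W f)))"
      by (simp add: comm norm_h norm_hc)
    then show ?thesis using pos by (intro ennreal_divide_le_1) (simp_all add: L2_norm_pos_iff)
  qed
  define \<S> where "\<S> = {S \<in> sets Ph. 0 < L2_norm Ph (restrict_to S (W f)) \<and> 0 < L2_norm Ph (restrict_to (space Ph - S) (W f))}"
  have def: "kernel_cheeger F \<mu> \<Lambda> \<psi> (W f) = (if \<S> = {} then 1 else
    INF S\<in>\<S>. L2_norm_sq Ph (kernel_commutator F \<mu> \<Lambda> \<psi> S (W f)) /
      min (L2_norm_sq Ph (restrict_to S (W f))) (L2_norm_sq Ph (restrict_to (space Ph - S) (W f))))"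
    unfolding kernel_cheeger_def Let_def \<S>_def ..
  show ?thesis
  proof (cases "\<S> = {}")
    case False
    then obtain S where S: "S \<in> \<S>" by blast
    then show ?thesis unfolding def using quot[of S] False by (auto simp: \<S>_def intro: INF_lower2)
  qed (simp add: def)
qed

lemma kernel_cheeger_le_graph_cheeger:
  assumes "f \<in> L2_space F \<mu>"
  shows "kernel_cheeger F \<mu> \<Lambda> \<psi> (W f) \<le> graph_cheeger \<mu> \<Lambda> \<psi> f"
proof (cases "is_singleton (graph_vertices \<mu> \<Lambda> \<psi> f)")
  case True
  then obtain l0 where "graph_vertices \<mu> \<Lambda> \<psi> f = {l0}" by (auto simp: is_singleton_def)
  then show ?thesis using kernel_cheeger_le_1[OF assms] True by (simp add: graph_cheeger_def)
next
  case False
  then show ?thesis unfolding graph_cheeger_def Let_def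
    by (auto intro!: INF_greatest kernel_cheeger_le_cut[OF assms])
qed

section \<open>Local stability\<close>

text \<open>
  The test signal \<open>g = 2 f\<^sub>T - f\<close> has transform \<open>(2 m\<^sub>T - 1) f'\<close>: it flips the sign of \<open>W f\<close> off \<open>T\<close>, up to
  the commutator.
\<close>
lemma stability_imp_cut_bound:
  assumes f: "f \<in> L2_space F \<mu>" and T: "T \<noteq> {}" "T \<subset> graph_vertices \<mu> \<Lambda> \<psi> f" and C: "C > 0"
    and stable: "\<And>g. g \<in> L2_space F \<mu> \<Longrightarrow> (INF \<alpha>\<in>unit_scalars F. L2_norm \<mu> (\<lambda>x. f x - \<alpha> * g x)) \<le>
        ennreal C * L2_norm Ph (\<lambda>p. norm (W f p) - norm (W g p))"
  shows "ennreal (1 / (1 + C\<^sup>2)) \<le> infsum (edge_weight \<mu> \<psi> f) (edge_boundary \<mu> \<Lambda> \<psi> f T) /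
    min (infsum (vertex_weight \<mu> \<psi> f) T) (infsum (vertex_weight \<mu> \<psi> f) (graph_vertices \<mu> \<Lambda> \<psi> f - T))"
proof -
  define f' where "f' = fourier_L2 \<mu> \<nu> f"
  have ft: "ft f f'" unfolding f'_def by (rule ft_fourier_L2[OF L2_space_subset[OF f]])
  have TV: "T \<subseteq> graph_vertices \<mu> \<Lambda> \<psi> f" using T by blast
  then have T': "T \<subseteq> \<Lambda>" using graph_vertices_subset by blast
  let ?m = "mass T"
  note [measurable] = mass_measurable[OF T'] L2_measurable[OF ft_L2(2)[OF ft]]
  define w1 where "w1 = (\<integral>\<^sup>+\<xi>. ennreal ((norm (f' \<xi>))\<^sup>2 * ?m \<xi>) \<partial>\<nu>)"
  define w2 where "w2 = (\<integral>\<^sup>+\<xi>. ennreal ((norm (f' \<xi>))\<^sup>2 * (1 - ?m \<xi>)) \<partial>\<nu>)"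
  define B where "B = (\<integral>\<^sup>+\<xi>. ennreal ((norm (f' \<xi>))\<^sup>2 * (?m \<xi> * (1 - ?m \<xi>))) \<partial>\<nu>)"
  have w: "infsum (vertex_weight \<mu> \<psi> f) T = w1"
    "infsum (vertex_weight \<mu> \<psi> f) (graph_vertices \<mu> \<Lambda> \<psi> f - T) = w2"
    "infsum (edge_weight \<mu> \<psi> f) (edge_boundary \<mu> \<Lambda> \<psi> f T) = B"
    unfolding w1_def w2_def B_def by (rule vertex_sums[OF ft TV] edge_sum[OF ft TV])+
  have "w1 > 0" "w2 > 0"
    using vertex_sum_pos[OF TV T(1)] vertex_sum_pos[of "graph_vertices \<mu> \<Lambda> \<psi> f - T" f] T
    unfolding w by auto
  have w1_fin: "w1 < \<infinity>"
  proof -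
    have "w1 \<le> L2_norm_sq \<nu> f'"
      unfolding w1_def L2_norm_sq_def
    proof (rule nn_integral_mono_AE)
      show "AE \<xi> in \<nu>. ennreal ((norm (f' \<xi>))\<^sup>2 * ?m \<xi>) \<le> ennreal ((norm (f' \<xi>))\<^sup>2)"
        using AE_mass[OF T'] by eventually_elim (auto intro!: ennreal_leI mult_left_le)
    qed
    also have "\<dots> < \<infinity>" using ft_L2(2)[OF ft] by (simp add: L2_iff)
    finally show ?thesis .
  qed
  \<comment> \<open>Finiteness of the boundary weight and of the smaller vertex weight moves the
    final comparison, which subtracts, into the reals.\<close>
  have "B \<le> w1"
    unfolding w1_def B_def
  proof (rule nn_integral_mono_AE)
    show "AE \<xi> in \<nu>. ennreal ((norm (f' \<xi>))\<^sup>2 * (?m \<xi> * (1 - ?m \<xi>))) \<le> ennreal ((norm (f' \<xi>))\<^sup>2 * ?m \<xi>)"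
      using AE_mass[OF T'] by eventually_elim (auto intro!: ennreal_leI mult_left_mono mult_left_le)
  qed
  then have B_fin: "B < \<infinity>" using w1_fin by (rule le_less_trans)
  define b where "b = enn2real B"
  have b: "B = ennreal b" "b \<ge> 0" using B_fin by (simp_all add: b_def)
  define w0 where "w0 = enn2real (min w1 w2)"
  have "min w1 w2 < \<infinity>" using w1_fin by (simp add: min_less_iff_disj)
  then have w0: "min w1 w2 = ennreal w0" "w0 > 0"
    using \<open>w1 > 0\<close> \<open>w2 > 0\<close> by (simp_all add: w0_def enn2real_positive_iff)
  obtain u where u: "u \<in> L2_space F \<mu>" "ft u (\<lambda>\<xi>. of_real (?m \<xi>) * f' \<xi>)"
    using multiplier_exists[OF f ft T'] by blast
  define g where "g x = 2 * u x - f x" for x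
  have "ft g (\<lambda>\<xi>. 2 * (of_real (?m \<xi>) * f' \<xi>) - f' \<xi>)"
    unfolding g_def[abs_def] by (intro ft_diff ft_scale u ft)
  then have ftg: "ft g (\<lambda>\<xi>. of_real (2 * ?m \<xi> - 1) * f' \<xi>)"
    by (simp add: algebra_simps)
  have gF: "g \<in> L2_space F \<mu>"
    by (rule L2_spaceI[OF ft_L2(1)[OF ftg]])
       (use scalars L2_spaceD[OF f] L2_spaceD[OF u(1)] in \<open>auto simp: g_def\<close>)
  \<comment> \<open>Moduli ignore signs, so the reverse triangle inequality may be used with + or -
    separately on each slice: \<open>W g\<close> is compared with \<open>W f\<close> on
    \<open>T\<close> and with its negative elsewhere.\<close>
  have "L2_norm_sq Ph (\<lambda>p. norm (W f p) - norm (W g p)) \<le>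
      L2_norm_sq Ph (\<lambda>p. W g p - of_real (if snd p \<in> T then 1 else - 1) * W f p)"
  proof (rule L2_norm_sq_mono_AE, rule AE_I2)
    fix p
    have "\<bar>norm (W f p) - norm (W g p)\<bar> \<le> norm (W g p - W f p)"
      using norm_triangle_ineq3[of "W f p" "W g p"] by (simp add: norm_minus_commute)
    moreover have "\<bar>norm (W f p) - norm (W g p)\<bar> \<le> norm (W g p + W f p)"
      using norm_triangle_ineq3[of "W g p" "- W f p"] by simp
    ultimately show "norm (norm (W f p) - norm (W g p)) \<le> norm (W g p - of_real (if snd p \<in> T then 1 else - 1) * W f p)"
      by simp
  qed
  also have "\<dots> = (\<integral>\<^sup>+\<xi>. ennreal ((norm (f' \<xi>))\<^sup>2 * ((2 * ?m \<xi> - 1 - 1)\<^sup>2 * ?m \<xi> + (2 * ?m \<xi> - 1 - - 1)\<^sup>2 * (1 - ?m \<xi>))) \<partial>\<nu>)"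
    by (rule phase_norm_sq_multiplier[OF ft ftg T'])
  \<comment> \<open>With m the mass, (2 m - 2)^2 m + (2 m)^2 (1 - m) = 4 m (1 - m).\<close>
  also have "\<dots> = (\<integral>\<^sup>+\<xi>. ennreal 4 * ennreal ((norm (f' \<xi>))\<^sup>2 * (?m \<xi> * (1 - ?m \<xi>))) \<partial>\<nu>)"
  proof (rule nn_integral_cong)
    fix \<xi>
    have "(norm (f' \<xi>))\<^sup>2 * ((2 * ?m \<xi> - 1 - 1)\<^sup>2 * ?m \<xi> + (2 * ?m \<xi> - 1 - - 1)\<^sup>2 * (1 - ?m \<xi>)) =
      4 * ((norm (f' \<xi>))\<^sup>2 * (?m \<xi> * (1 - ?m \<xi>)))"
      by (simp add: power2_eq_square algebra_simps)
    then show "ennreal ((norm (f' \<xi>))\<^sup>2 * ((2 * ?m \<xi> - 1 - 1)\<^sup>2 * ?m \<xi> + (2 * ?m \<xi> - 1 - - 1)\<^sup>2 * (1 - ?m \<xi>))) =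
      ennreal 4 * ennreal ((norm (f' \<xi>))\<^sup>2 * (?m \<xi> * (1 - ?m \<xi>)))"
      by (simp only: ennreal_mult'[of 4])
  qed
  also have "\<dots> = ennreal 4 * B"
    unfolding B_def by (rule nn_integral_cmult) measurable
  also have "\<dots> = ennreal (4 * b)" using b by (simp add: ennreal_mult)
  finally have upper: "L2_norm Ph (\<lambda>p. norm (W f p) - norm (W g p)) \<le> ennreal (sqrt (4 * b))"
    unfolding L2_norm_def using b by (intro ennreal_sqrt_le) auto
  have lower: "ennreal (sqrt (4 * w0 - 4 * b)) \<le> L2_norm \<mu> (\<lambda>x. f x - \<alpha> * g x)" if \<alpha>: "\<alpha> \<in> unit_scalars F" for \<alpha>
  proof -
    define \<rho> where "\<rho> = Re \<alpha>"
    have "norm \<alpha> = 1" using \<alpha> by (simp add: unit_scalars_def)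
    then have \<rho>: "\<bar>\<rho>\<bar> \<le> 1" "\<rho>\<^sup>2 + (Im \<alpha>)\<^sup>2 = 1"
      using abs_Re_le_cmod[of \<alpha>] cmod_power2[of \<alpha>] by (simp_all add: \<rho>_def)
    have ftd: "ft (\<lambda>x. f x - \<alpha> * g x) (\<lambda>\<xi>. f' \<xi> - \<alpha> * (of_real (2 * ?m \<xi> - 1) * f' \<xi>))"
      by (intro ft_diff ft_scale ft ftg)
    \<comment> \<open>Put t = 2 m - 1. As |\<alpha>| = 1, |1 - \<alpha> t|^2 = 1 - 2 \<rho> t + t^2,
      and 4 m (1 - m) = 1 - t^2. The sum 2 - 2 \<rho> t is linear in m, hence a combination of m and
      1 - m.\<close>
    have sq: "(norm (f' \<xi> - \<alpha> * (of_real (2 * ?m \<xi> - 1) * f' \<xi>)))\<^sup>2 + 4 * ((norm (f' \<xi>))\<^sup>2 * (?m \<xi> * (1 - ?m \<xi>)))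
      = 2 * (1 - \<rho>) * ((norm (f' \<xi>))\<^sup>2 * ?m \<xi>) + 2 * (1 + \<rho>) * ((norm (f' \<xi>))\<^sup>2 * (1 - ?m \<xi>))" for \<xi>
    proof -
      define t where "t = 2 * ?m \<xi> - 1"
      have "f' \<xi> - \<alpha> * (of_real t * f' \<xi>) = (1 - \<alpha> * of_real t) * f' \<xi>" by (simp add: algebra_simps)
      then have "(norm (f' \<xi> - \<alpha> * (of_real t * f' \<xi>)))\<^sup>2 = (norm (1 - \<alpha> * of_real t))\<^sup>2 * (norm (f' \<xi>))\<^sup>2"
        by (simp add: norm_mult power_mult_distrib)
      also have "(norm (1 - \<alpha> * of_real t))\<^sup>2 = (1 - \<rho> * t)\<^sup>2 + (Im \<alpha> * t)\<^sup>2"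
        by (simp add: cmod_power2 \<rho>_def)
      also have "\<dots> = 1 - 2 * \<rho> * t + (\<rho>\<^sup>2 + (Im \<alpha>)\<^sup>2) * t\<^sup>2"
        by (simp add: power2_eq_square algebra_simps)
      also have "\<dots> = 1 - 2 * \<rho> * t + t\<^sup>2" using \<rho>(2) by simp
      finally have 1: "(norm (f' \<xi> - \<alpha> * (of_real t * f' \<xi>)))\<^sup>2 = (1 - 2 * \<rho> * t + t\<^sup>2) * (norm (f' \<xi>))\<^sup>2" .
      show ?thesis
        unfolding t_def[symmetric] 1 unfolding t_def by (simp add: power2_eq_square algebra_simps)
    qed
    \<comment> \<open>The coefficients are nonnegative and add up to 4 for every \<alpha>, so the
      smaller vertex weight gives a bound uniform in the phase.\<close>
    have "4 * min w1 w2 = ennreal (2 * (1 - \<rho>)) * min w1 w2 + ennreal (2 * (1 + \<rho>)) * min w1 w2"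
    proof -
      have "ennreal (2 * (1 - \<rho>)) + ennreal (2 * (1 + \<rho>)) = ennreal 4"
        using \<rho>(1) by (subst ennreal_plus[symmetric]) auto
      then show ?thesis by (simp flip: distrib_right)
    qed
    also have "\<dots> \<le> ennreal (2 * (1 - \<rho>)) * w1 + ennreal (2 * (1 + \<rho>)) * w2"
      by (intro add_mono mult_left_mono) auto
    also have "\<dots> = (\<integral>\<^sup>+\<xi>. ennreal (2 * (1 - \<rho>)) * ennreal ((norm (f' \<xi>))\<^sup>2 * ?m \<xi>) +
        ennreal (2 * (1 + \<rho>)) * ennreal ((norm (f' \<xi>))\<^sup>2 * (1 - ?m \<xi>)) \<partial>\<nu>)"
      unfolding w1_def w2_def by (simp add: nn_integral_add nn_integral_cmult)
    also have "\<dots> = (\<integral>\<^sup>+\<xi>. ennreal ((norm (f' \<xi> - \<alpha> * (of_real (2 * ?m \<xi> - 1) * f' \<xi>)))\<^sup>2) +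
        ennreal 4 * ennreal ((norm (f' \<xi>))\<^sup>2 * (?m \<xi> * (1 - ?m \<xi>))) \<partial>\<nu>)"
    proof (rule nn_integral_cong_AE)
      show "AE \<xi> in \<nu>. ennreal (2 * (1 - \<rho>)) * ennreal ((norm (f' \<xi>))\<^sup>2 * ?m \<xi>) +
        ennreal (2 * (1 + \<rho>)) * ennreal ((norm (f' \<xi>))\<^sup>2 * (1 - ?m \<xi>)) =
        ennreal ((norm (f' \<xi> - \<alpha> * (of_real (2 * ?m \<xi> - 1) * f' \<xi>)))\<^sup>2) +
        ennreal 4 * ennreal ((norm (f' \<xi>))\<^sup>2 * (?m \<xi> * (1 - ?m \<xi>)))"
        using AE_mass[OF T']
      proof eventually_elim
        case (elim \<xi>)
        then have m: "0 \<le> ?m \<xi>" "?m \<xi> \<le> 1" by blast+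
        have "ennreal (2 * (1 - \<rho>)) * ennreal ((norm (f' \<xi>))\<^sup>2 * ?m \<xi>) +
          ennreal (2 * (1 + \<rho>)) * ennreal ((norm (f' \<xi>))\<^sup>2 * (1 - ?m \<xi>)) =
          ennreal (2 * (1 - \<rho>) * ((norm (f' \<xi>))\<^sup>2 * ?m \<xi>) + 2 * (1 + \<rho>) * ((norm (f' \<xi>))\<^sup>2 * (1 - ?m \<xi>)))"
          using \<rho>(1) m by (subst ennreal_plus) (auto simp: ennreal_mult)
        also have "\<dots> = ennreal ((norm (f' \<xi> - \<alpha> * (of_real (2 * ?m \<xi> - 1) * f' \<xi>)))\<^sup>2 +
          4 * ((norm (f' \<xi>))\<^sup>2 * (?m \<xi> * (1 - ?m \<xi>))))"
          unfolding sq ..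
        also have "\<dots> = ennreal ((norm (f' \<xi> - \<alpha> * (of_real (2 * ?m \<xi> - 1) * f' \<xi>)))\<^sup>2) +
          ennreal 4 * ennreal ((norm (f' \<xi>))\<^sup>2 * (?m \<xi> * (1 - ?m \<xi>)))"
          unfolding ennreal_mult'[of 4, symmetric, simplified] using m
          by (subst ennreal_plus) (auto simp: ennreal_mult)
        finally show ?case .
      qed
    qed
    also have "\<dots> = L2_norm_sq \<nu> (\<lambda>\<xi>. f' \<xi> - \<alpha> * (of_real (2 * ?m \<xi> - 1) * f' \<xi>)) + ennreal 4 * B"
      unfolding B_def L2_norm_sq_def
      by (subst nn_integral_add) (auto simp: nn_integral_cmult)
    also have "\<dots> = ennreal ((l2norm \<mu> (\<lambda>x. f x - \<alpha> * g x))\<^sup>2) + ennreal 4 * ennreal b"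
      by (simp only: ft_norm_sq[OF ftd] L2_norm_sq_eq[OF ft_L2(1)[OF ftd]] b)
    also have "\<dots> = ennreal ((l2norm \<mu> (\<lambda>x. f x - \<alpha> * g x))\<^sup>2 + 4 * b)"
      using b(2) by (subst ennreal_plus) (auto simp: ennreal_mult)
    finally have "ennreal (4 * w0) \<le> ennreal ((l2norm \<mu> (\<lambda>x. f x - \<alpha> * g x))\<^sup>2 + 4 * b)"
      using w0 by (simp add: ennreal_mult)
    then have "4 * w0 - 4 * b \<le> (l2norm \<mu> (\<lambda>x. f x - \<alpha> * g x))\<^sup>2"
      using b(2) by (subst (asm) ennreal_le_iff) auto
    then have "sqrt (4 * w0 - 4 * b) \<le> l2norm \<mu> (\<lambda>x. f x - \<alpha> * g x)"
      using real_le_lsqrt real_sqrt_le_mono by fastforce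
    then show ?thesis by (simp add: L2_norm_eq[OF ft_L2(1)[OF ftd]] ennreal_leI)
  qed
  have "ennreal (sqrt (4 * w0 - 4 * b)) \<le> (INF \<alpha>\<in>unit_scalars F. L2_norm \<mu> (\<lambda>x. f x - \<alpha> * g x))"
    by (rule INF_greatest) (rule lower)
  also have "\<dots> \<le> ennreal C * L2_norm Ph (\<lambda>p. norm (W f p) - norm (W g p))"
    by (rule stable[OF gF])
  also have "\<dots> \<le> ennreal C * ennreal (sqrt (4 * b))"
    by (rule mult_left_mono[OF upper]) simp
  also have "\<dots> = ennreal (C * sqrt (4 * b))"
    using C by (simp add: ennreal_mult')
  finally have "sqrt (4 * w0 - 4 * b) \<le> C * sqrt (4 * b)"
    using C b by (subst (asm) ennreal_le_iff) auto
  also have "\<dots> = sqrt (C\<^sup>2 * (4 * b))"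
    using C by (simp add: real_sqrt_mult)
  finally have "4 * w0 - 4 * b \<le> C\<^sup>2 * (4 * b)" by simp
  \<comment> \<open>Rearranged, the inequality reads w0 <= (1 + C^2) b.\<close>
  then have "1 / (1 + C\<^sup>2) \<le> b / w0"
    using w0(2) C by (simp add: field_simps add_pos_nonneg)
  then show ?thesis
    unfolding w w0(1) b(1) using w0(2) b(2) by (simp add: divide_ennreal ennreal_leI)
qed

text \<open>Every admissible \<open>C\<close> forces the graph constant to be at least 1 / (1 +
  C^2), also for a single vertex, where it is 1. If the graph constant is 0, no \<open>C\<close> is
  admissible and both sides are infinite.\<close>

lemma local_stability_ge:
  assumes f: "f \<in> L2_space F \<mu>"
  shows "ennreal_sqrt (inverse (graph_cheeger \<mu> \<Lambda> \<psi> f) - 1) \<le> local_stability_constant F \<mu> \<Lambda> \<psi> f"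
  unfolding local_stability_constant_def
proof (rule Inf_greatest, clarify)
  fix C :: real
  assume C: "0 < C" and stable: "\<forall>g\<in>L2_space F \<mu>. (INF \<alpha>\<in>unit_scalars F. L2_norm \<mu> (\<lambda>x. f x - \<alpha> * g x)) \<le>
    ennreal C * L2_norm Ph (\<lambda>p. norm (W f p) - norm (W g p))"
  have pos: "1 + C\<^sup>2 > 0" by (simp add: add_pos_nonneg)
  have "ennreal (1 / (1 + C\<^sup>2)) \<le> graph_cheeger \<mu> \<Lambda> \<psi> f"
  proof (cases "is_singleton (graph_vertices \<mu> \<Lambda> \<psi> f)")
    case True
    have "1 / (1 + C\<^sup>2) \<le> 1" using pos by simp
    then show ?thesis using True by (simp add: graph_cheeger_def ennreal_le_1)
  next
    case False
    then show ?thesis unfolding graph_cheeger_def Let_def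
      by (auto intro!: INF_greatest stability_imp_cut_bound[OF f _ _ C] stable[rule_format])
  qed
  then have "inverse (graph_cheeger \<mu> \<Lambda> \<psi> f) \<le> ennreal (inverse (1 / (1 + C\<^sup>2)))"
    by (rule inverse_le_ennreal) (use pos in simp)
  also have "inverse (1 / (1 + C\<^sup>2)) = 1 + C\<^sup>2" by simp
  finally have "inverse (graph_cheeger \<mu> \<Lambda> \<psi> f) - 1 \<le> ennreal (C\<^sup>2)"
    by (simp add: ennreal_minus_le_iff)
  then have "ennreal_sqrt (inverse (graph_cheeger \<mu> \<Lambda> \<psi> f) - 1) \<le> ennreal (sqrt (C\<^sup>2))"
    by (rule ennreal_sqrt_le) simp
  then show "ennreal_sqrt (inverse (graph_cheeger \<mu> \<Lambda> \<psi> f) - 1) \<le> ennreal C"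
    using C by simp
qed

end

theorem theorem4p6:
  fixes F :: "complex set"
    and \<mu> :: "'a::{topological_ab_group_add, t2_space, second_countable_topology} measure"
    and \<nu> :: "('a \<Rightarrow> complex) measure"
    and \<Lambda> :: "'l set"
    and \<psi> :: "'l \<Rightarrow> 'a \<Rightarrow> complex"
    and f :: "'a \<Rightarrow> complex"
  assumes "F = \<real> \<or> F = UNIV"
    and "locally_compact_space (euclidean :: 'a topology)"
    and "haar_measure euclidean (+) \<mu>"
    and "haar_measure dual_topology dual_mult \<nu>"
    and "plancherel_normalized \<mu> \<nu>"
    and "countable \<Lambda>"
    and "\<And>l. l \<in> \<Lambda> \<Longrightarrow> \<psi> l \<in> L2_space F \<mu>"
    and "calderon_condition \<mu> \<nu> \<Lambda> \<psi>"
    and "f \<in> L2_space F \<mu>"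
    and "\<not> (AE x in \<mu>. f x = 0)"
  shows "kernel_cheeger F \<mu> \<Lambda> \<psi> (wavelet_transform \<mu> \<psi> f) \<le> graph_cheeger \<mu> \<Lambda> \<psi> f \<and>
         (phase_retrievable F \<mu> \<Lambda> \<psi> f \<longrightarrow>
            local_stability_constant F \<mu> \<Lambda> \<psi> f
              \<ge> ennreal_sqrt (inverse (graph_cheeger \<mu> \<Lambda> \<psi> f) - 1))"
proof -
  interpret wavelet_system \<mu> \<nu> F \<Lambda> \<psi>
    by unfold_locales (use assms in auto)
  show ?thesis
    using kernel_cheeger_le_graph_cheeger[OF assms(9)] local_stability_ge[OF assms(9)] by blast
qed

end
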